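(* Let $s\geq 1$ and for $m\geq 1$ let $b_s(m)=\dim_{\mathbb{Q}} H_{s-1}(X_s^m;\mathbb{Q})$, where $X_s^m=\mathcal{MCG}_{1,s}^m$ is the moduli space of $m$-colored one-loop graphs with $s$ legs. Then $b_s(m)$ grows at most polynomially in $m$ of degree $s$; that is, there is a polynomial $p_s$ of degree $s$ such that $b_s(m)\leq p_s(m)$ for all $m\geq 1$.
   Context: Graphs are finite non-empty multigraphs (self-loops and multiple edges allowed) with a set $E(G)$ of internal edges and $s$ external legs labeled bijectively by $1,\ldots,s$, each leg attached to a vertex. The valency of a vertex is the number of half-edges at it (legs count once, self-loops twice). A graph is admissible if it is connected, stays connected upon removal of any single internal edge, and all vertices have valency $\geq 3$. Its rank is its first Betti number. Hence an admissible graph of rank one with $s$ legs is a cycle with $k$ vertices and $k$ internal edges, $1\leq k\leq s$ ($k=1$: one vertex with a self-loop; $k=2$: two vertices joined by a double edge), each vertex carrying at least one leg. An $m$-coloring is any map $c:E(G)\to\{1,\ldots,m\}$. A metric $\lambda:E(G)\to\mathbb{R}_{\geq 0}$ is regular if $Z=\{e:\lambda(e)=0\}$ is (the edge set of) a forest; in rank one this means $\lambda\not\equiv 0$. $G/Z$ denotes $G$ with the edges of $Z$ collapsed. The points of $X_s^m$ are the triples $(G,\lambda,c)$ with $G$ admissible of rank one with $s$ legs, $\lambda$ a regular metric, $c$ an $m$-coloring, modulo the relation: $(G,\lambda,c)\sim(G',\lambda',c')$ iff, with $Z,Z'$ the zero sets of $\lambda,\lambda'$, there are a graph isomorphism $\varphi:G/Z\to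 G'/Z'$ preserving the leg labels and a constant $a>0$ with $\lambda'\circ\varphi=a\lambda$ and $c'\circ\varphi=c$ on $E(G)\setminus Z$. Topology: for each isomorphism class of pairs $(G,c)$ the regular metrics of total length $1$ form a closed simplex of dimension $|E(G)|-1$; $X_s^m$ carries the quotient topology from the disjoint union of these simplices. *)

theory Defs
  imports
    "HOL-Homology.Homology"
    "HOL-Computational_Algebra.Polynomial"
    "Jordan_Normal_Form.VS_Connect"
begin

section \<open>Multigraphs with legs\<close>

text \<open>
  The two ends of an internal edge form a multiset of size two, a self-loop at \<open>v\<close> having
  ends \<open>{#v, v#}\<close>.  The number \<open>s\<close> of legs is a parameter of the predicates below; the leg
  labelled \<open>i \<in> {1..s}\<close> is attached to \<open>leg G i\<close>.  The values of \<open>ends\<close> off the edge set and of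
  \<open>leg\<close> off \<open>{1..s}\<close> are irrelevant.
\<close>

record ('v, 'e) legged_graph =
  verts :: "'v set"
  edges :: "'e set"
  ends :: "'e \<Rightarrow> 'v multiset"
  leg :: "nat \<Rightarrow> 'v"

definition legged_graph :: "nat \<Rightarrow> ('v, 'e) legged_graph \<Rightarrow> bool" where
  "legged_graph s G \<longleftrightarrow>
     finite (verts G) \<and> verts G \<noteq> {} \<and> finite (edges G) \<and>
     (\<forall>e\<in>edges G. size (ends G e) = 2 \<and> set_mset (ends G e) \<subseteq> verts G) \<and>
     (\<forall>i\<in>{1..s}. leg G i \<in> verts G)"

definition valency :: "nat \<Rightarrow> ('v, 'e) legged_graph \<Rightarrow> 'v \<Rightarrow> nat" where
  "valency s G v = (\<Sum>e\<in>edges G. count (ends G e) v) + card {i\<in>{1..s}. leg G i = v}"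

definition adjacent :: "('v, 'e) legged_graph \<Rightarrow> 'e set \<Rightarrow> 'v rel" where
  "adjacent G F = {(u, v). \<exists>e\<in>F. ends G e = {#u, v#}}"

definition component :: "('v, 'e) legged_graph \<Rightarrow> 'e set \<Rightarrow> 'v \<Rightarrow> 'v set" where
  "component G F v = (adjacent G F)\<^sup>* `` {v}"

definition connected_by :: "('v, 'e) legged_graph \<Rightarrow> 'e set \<Rightarrow> bool" where
  "connected_by G F \<longleftrightarrow> (\<forall>u\<in>verts G. \<forall>v\<in>verts G. v \<in> component G F u)"

definition admissible :: "nat \<Rightarrow> ('v, 'e) legged_graph \<Rightarrow> bool" where
  "admissible s G \<longleftrightarrow>
     connected_by G (edges G) \<and>
     (\<forall>e\<in>edges G. connected_by G (edges G - {e})) \<and>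
     (\<forall>v\<in>verts G. valency s G v \<ge> 3)"

definition betti1 :: "('v, 'e) legged_graph \<Rightarrow> int" where
  "betti1 G = int (card (edges G)) - int (card (verts G))
            + int (card (component G (edges G) ` verts G))"

text \<open>
  Cycles of length one are self-loops, cycles of length two are pairs of parallel edges.
\<close>

definition is_cycle :: "('v, 'e) legged_graph \<Rightarrow> 'v list \<Rightarrow> 'e list \<Rightarrow> bool" where
  "is_cycle G vs es \<longleftrightarrow>
     es \<noteq> [] \<and> length vs = length es \<and> distinct vs \<and> distinct es \<and>
     (\<forall>i<length es. ends G (es ! i) = {#vs ! i, vs ! (Suc i mod length es)#})"

definition forest :: "('v, 'e) legged_graph \<Rightarrow> 'e set \<Rightarrow> bool" where
  "forest G Z \<longleftrightarrow> (\<nexists>vs es. set es \<subseteq> Z \<and> is_cycle G vs es)"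

text \<open>The vertices of \<open>G/Z\<close> are the vertex sets of the connected components of \<open>(verts G, Z)\<close>.\<close>

definition collapse :: "('v, 'e) legged_graph \<Rightarrow> 'e set \<Rightarrow> ('v set, 'e) legged_graph" where
  "collapse G Z =
     \<lparr>verts = component G Z ` verts G,
      edges = edges G - Z,
      ends = (\<lambda>e. image_mset (component G Z) (ends G e)),
      leg = (\<lambda>i. component G Z (leg G i))\<rparr>"

definition graph_iso ::
  "nat \<Rightarrow> ('v, 'e) legged_graph \<Rightarrow> ('w, 'f) legged_graph \<Rightarrow> ('v \<Rightarrow> 'w) \<Rightarrow> ('e \<Rightarrow> 'f) \<Rightarrow> bool" where
  "graph_iso s G H \<phi> \<psi> \<longleftrightarrow>
     bij_betw \<phi> (verts G) (verts H) \<and> bij_betw \<psi> (edges G) (edges H) \<and>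
     (\<forall>e\<in>edges G. ends H (\<psi> e) = image_mset \<phi> (ends G e)) \<and>
     (\<forall>i\<in>{1..s}. leg H i = \<phi> (leg G i))"


section \<open>Colored metric one-loop graphs\<close>

text \<open>
  Since \<open>nat\<close> is infinite, every finite graph is isomorphic to one of the following type.
\<close>

type_synonym graph = "(nat, nat) legged_graph"
type_synonym metric = "nat \<Rightarrow> real"
type_synonym coloring = "nat \<Rightarrow> nat"

definition one_loop_graph :: "nat \<Rightarrow> graph \<Rightarrow> bool" where
  "one_loop_graph s G \<longleftrightarrow> legged_graph s G \<and> admissible s G \<and> betti1 G = 1"

definition zero_set :: "graph \<Rightarrow> metric \<Rightarrow> nat set" where
  "zero_set G l = {e\<in>edges G. l e = 0}"

definition regular_metrics :: "graph \<Rightarrow> metric set" where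
  "regular_metrics G = {l \<in> edges G \<rightarrow>\<^sub>E {0..}. forest G (zero_set G l)}"

definition colorings :: "nat \<Rightarrow> graph \<Rightarrow> coloring set" where
  "colorings m G = edges G \<rightarrow>\<^sub>E {1..m}"

definition triples :: "nat \<Rightarrow> nat \<Rightarrow> (graph \<times> metric \<times> coloring) set" where
  "triples s m =
     {(G, l, c). one_loop_graph s G \<and> l \<in> regular_metrics G \<and> c \<in> colorings m G}"

definition triple_rel ::
  "nat \<Rightarrow> nat \<Rightarrow> (graph \<times> metric \<times> coloring) rel" where
  "triple_rel s m =
     {((G, l, c), (G', l', c')).
        (G, l, c) \<in> triples s m \<and> (G', l', c') \<in> triples s m \<and>
        (\<exists>\<phi> \<psi> a. graph_iso s (collapse G (zero_set G l)) (collapse G' (zero_set G' l')) \<phi> \<psi> \<and>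
           a > 0 \<and>
           (\<forall>e \<in> edges G - zero_set G l. l' (\<psi> e) = a * l e \<and> c' (\<psi> e) = c e))}"


section \<open>The moduli space\<close>

definition colored_graphs :: "nat \<Rightarrow> nat \<Rightarrow> (graph \<times> coloring) set" where
  "colored_graphs s m = {(G, c). one_loop_graph s G \<and> c \<in> colorings m G}"

definition colored_iso :: "nat \<Rightarrow> graph \<times> coloring \<Rightarrow> graph \<times> coloring \<Rightarrow> bool" where
  "colored_iso s = (\<lambda>(G, c) (G', c').
     \<exists>\<phi> \<psi>. graph_iso s G G' \<phi> \<psi> \<and> (\<forall>e\<in>edges G. c' (\<psi> e) = c e))"

text \<open>One chosen representative for each isomorphism class of pairs \<open>(G, c)\<close>.\<close>

definition representatives :: "nat \<Rightarrow> nat \<Rightarrow> (graph \<times> coloring) set" where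
  "representatives s m =
     (\<lambda>p. SOME q. q \<in> colored_graphs s m \<and> colored_iso s p q) ` colored_graphs s m"

definition simplex_of :: "graph \<Rightarrow> metric topology" where
  "simplex_of G =
     subtopology (product_topology (\<lambda>_. euclideanreal) (edges G))
       {l \<in> regular_metrics G. (\<Sum>e\<in>edges G. l e) = 1}"

definition simplices :: "nat \<Rightarrow> nat \<Rightarrow> ((graph \<times> coloring) \<times> metric) topology" where
  "simplices s m = sum_topology (\<lambda>(G, c). simplex_of G) (representatives s m)"

definition point_of ::
  "nat \<Rightarrow> nat \<Rightarrow> (graph \<times> coloring) \<times> metric \<Rightarrow> (graph \<times> metric \<times> coloring) set" where
  "point_of s m = (\<lambda>((G, c), l). triple_rel s m `` {(G, l, c)})"

definition MCG1 :: "nat \<Rightarrow> nat \<Rightarrow> (graph \<times> metric \<times> coloring) set topology" where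
  "MCG1 s m =
     topology (\<lambda>U. U \<subseteq> triples s m // triple_rel s m \<and>
       openin (simplices s m) {x \<in> topspace (simplices s m). point_of s m x \<in> U})"

lemma openin_MCG1:
  "openin (MCG1 s m) U \<longleftrightarrow>
     U \<subseteq> triples s m // triple_rel s m \<and>
     openin (simplices s m) {x \<in> topspace (simplices s m). point_of s m x \<in> U}"
proof -
  let ?P = "\<lambda>U. U \<subseteq> triples s m // triple_rel s m \<and>
     openin (simplices s m) {x \<in> topspace (simplices s m). point_of s m x \<in> U}"
  have "istopology ?P"
    unfolding istopology_def
  proof (intro conjI allI impI)
    fix S T assume "?P S" "?P T"
    moreover have "{x \<in> topspace (simplices s m). point_of s m x \<in> S \<inter> T} =
        {x \<in> topspace (simplices s m). point_of s m x \<in> S} \<inter>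
        {x \<in> topspace (simplices s m). point_of s m x \<in> T}" by auto
    ultimately show "S \<inter> T \<subseteq> triples s m // triple_rel s m"
      and "openin (simplices s m) {x \<in> topspace (simplices s m). point_of s m x \<in> S \<inter> T}"
      by auto
  next
    fix \<K> assume K: "\<forall>K\<in>\<K>. ?P K"
    then show "\<Union>\<K> \<subseteq> triples s m // triple_rel s m" by auto
    have "{x \<in> topspace (simplices s m). point_of s m x \<in> \<Union>\<K>} =
        (\<Union>K\<in>\<K>. {x \<in> topspace (simplices s m). point_of s m x \<in> K})" by auto
    then show "openin (simplices s m) {x \<in> topspace (simplices s m). point_of s m x \<in> \<Union>\<K>}"
      using K by auto
  qed
  then show ?thesis
    by (simp add: MCG1_def)
qed


section \<open>Rational singular homology\<close>

text \<open>
  \<^theory>\<open>HOL-Homology.Homology\<close> provides singular simplices and their faces, but only chains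
  with integer coefficients.
\<close>

type_synonym 'a rat_chain = "((nat \<Rightarrow> real) \<Rightarrow> 'a) \<Rightarrow>\<^sub>0 rat"

definition rat_chains :: "nat \<Rightarrow> 'a topology \<Rightarrow> 'a rat_chain set" where
  "rat_chains p X = {c. Poly_Mapping.keys c \<subseteq> singular_simplex_set p X}"

definition rat_scale :: "rat \<Rightarrow> 'a rat_chain \<Rightarrow> 'a rat_chain" where
  "rat_scale q c = Poly_Mapping.map ((*) q) c"

definition rat_boundary :: "nat \<Rightarrow> 'a rat_chain \<Rightarrow> 'a rat_chain" where
  "rat_boundary p c =
     (if p = 0 then 0
      else \<Sum>f\<in>Poly_Mapping.keys c. \<Sum>k\<le>p.
             Poly_Mapping.single (singular_face p k f) ((-1) ^ k * Poly_Mapping.lookup c f))"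

definition rat_cycles :: "nat \<Rightarrow> 'a topology \<Rightarrow> 'a rat_chain set" where
  "rat_cycles p X = {c \<in> rat_chains p X. rat_boundary p c = 0}"

definition rat_boundaries :: "nat \<Rightarrow> 'a topology \<Rightarrow> 'a rat_chain set" where
  "rat_boundaries p X = rat_boundary (Suc p) ` rat_chains (Suc p) X"

text \<open>
  The quotient vector space of cycles modulo boundaries, with cosets as elements.  Adding a
  boundary in the scalar multiplication matters only for the scalar zero.
\<close>

definition rat_class :: "nat \<Rightarrow> 'a topology \<Rightarrow> 'a rat_chain \<Rightarrow> 'a rat_chain set" where
  "rat_class p X z = {z + b |b. b \<in> rat_boundaries p X}"

definition rat_homology :: "nat \<Rightarrow> 'a topology \<Rightarrow> (rat, 'a rat_chain set) module" where
  "rat_homology p X =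
     \<lparr>carrier = rat_class p X ` rat_cycles p X,
      mult = undefined,
      one = undefined,
      zero = rat_boundaries p X,
      add = (\<lambda>C D. {x + y |x y. x \<in> C \<and> y \<in> D}),
      smult = (\<lambda>q C. {rat_scale q x + b |x b. x \<in> C \<and> b \<in> rat_boundaries p X})\<rparr>"

end

theory Submission
  imports Defs "HOL-Analysis.Abstract_Topological_Spaces"
begin

text \<open>
  The moduli space is a finite complex glued from simplices: one simplex for each isomorphism class
  of colored graphs, points being identified along faces.  A graph with \<open>k \<le> s\<close> edges
  has \<open>m ^ k\<close> colorings, so there are at most \<open>K * m ^ s\<close> cells for a constant \<open>K\<close>
  depending only on \<open>s\<close>.  Removing the cells one by one, from the top dimension downwards,
  excision and the long exact sequence of a pair show that each cell raises the rank of an integral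
  homology group by at most \<open>2 ^ s\<close>: an open cell is contractible, and an open cell without its
  barycentre is a union of at most \<open>s\<close> open convex sets.  Clearing denominators, the dimension
  of rational homology is at most the rank of integral homology.

  The cells are open faces of simplices, possibly reversed by an automorphism of the collapsed graph.
  In a one-loop graph no two distinct edges can be removed without disconnecting it, and every vertex
  carries a leg.  Hence such automorphisms are trivial except for the exchange of two parallel edges,
  which folds a one-dimensional cell onto one of its halves.
\<close>

section \<open>Rank of abelian groups\<close>

text \<open>No boundary map is computed. Every estimate is subadditivity of the rank along an exact
  sequence, and the resulting bound is the same in every degree. This is enough because only the
  exponent of m matters: the price of a cell depends on s alone. A cell with k coordinates costs 1
  for the contractible open cell and 2^k - 1 for the open cell without its barycentre. The latter
  solves r(n+1) = 2 r(n) + 1, the recursion for adding one convex set to a union of n of them. The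
  obstacle is that the map from a simplex to the space need not be injective: faces are glued to
  faces of other simplices, and a face may be glued to itself. Two facts are enough to attach cells.
  The images of two open faces are equal or disjoint, and each of them is parametrized injectively
  by a convex piece of the face that contains the barycentre. The piece is cut out by an inequality
  x p <= x q between two coordinates, where p = q if nothing is folded, so that one argument covers
  both cases.\<close>

definition lin_comb :: "('a, 'b) monoid_scheme \<Rightarrow> ('i \<Rightarrow> 'a) \<Rightarrow> ('i \<Rightarrow> int) \<Rightarrow> 'i set \<Rightarrow> 'a" where
  "lin_comb G x a I = finprod G (\<lambda>i. x i [^]\<^bsub>G\<^esub> a i) I"

text \<open>The rank, i.e. the greatest size of a family independent over the integers, is at most
  n; torsion does not count. Families are indexed by natural numbers instead of being subsets of the
  carrier: a repeated entry is then itself a dependence, and families can be pushed along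
  homomorphisms that are not injective.\<close>

definition rank_le :: "('a, 'b) monoid_scheme \<Rightarrow> nat \<Rightarrow> bool" where
  "rank_le G n \<longleftrightarrow>
     (\<forall>(I :: nat set) x. finite I \<longrightarrow> n < card I \<longrightarrow> x \<in> I \<rightarrow> carrier G \<longrightarrow>
        (\<exists>a. (\<exists>i\<in>I. a i \<noteq> 0) \<and> lin_comb G x a I = \<one>\<^bsub>G\<^esub>))"

lemma rank_leD:
  assumes "rank_le G n" "finite (I :: nat set)" "n < card I" "\<And>i. i \<in> I \<Longrightarrow> x i \<in> carrier G"
  shows "\<exists>a. (\<exists>i\<in>I. a i \<noteq> 0) \<and> lin_comb G x a I = \<one>\<^bsub>G\<^esub>"
  using assms unfolding rank_le_def by blast

lemma rank_le_mono: "rank_le G n \<Longrightarrow> n \<le> k \<Longrightarrow> rank_le G k"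
  unfolding rank_le_def by (meson le_less_trans)

context comm_group
begin

lemma lin_comb_closed:
  "(\<And>i. i \<in> I \<Longrightarrow> x i \<in> carrier G) \<Longrightarrow> lin_comb G x a I \<in> carrier G"
  unfolding lin_comb_def by (intro finprod_closed) auto

lemma lin_comb_cong:
  assumes "\<And>i. i \<in> I \<Longrightarrow> x i \<in> carrier G" "\<And>i. i \<in> I \<Longrightarrow> x i = y i" "\<And>i. i \<in> I \<Longrightarrow> a i = b i"
  shows "lin_comb G x a I = lin_comb G y b I"
  unfolding lin_comb_def using assms by (intro finprod_cong') auto

lemma lin_comb_add:
  assumes "\<And>i. i \<in> I \<Longrightarrow> x i \<in> carrier G"
  shows "lin_comb G x a I \<otimes> lin_comb G x b I = lin_comb G x (\<lambda>i. a i + b i) I"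
proof -
  have "lin_comb G x (\<lambda>i. a i + b i) I
      = finprod G (\<lambda>i. x i [^] a i \<otimes> x i [^] b i) I"
    unfolding lin_comb_def using assms by (intro finprod_cong') (auto simp: int_pow_mult)
  then show ?thesis
    unfolding lin_comb_def using assms by (subst (asm) finprod_multf) auto
qed

lemma lin_comb_scale:
  assumes "finite I" "\<And>i. i \<in> I \<Longrightarrow> x i \<in> carrier G"
  shows "lin_comb G x a I [^] (d :: int) = lin_comb G x (\<lambda>i. d * a i) I"
  using assms
proof (induction I rule: finite_induct)
  case empty
  then show ?case by (simp add: lin_comb_def)
next
  case (insert i I)
  have 1: "lin_comb G x c (insert i I) = x i [^] c i \<otimes> lin_comb G x c I" for c
    unfolding lin_comb_def using insert by (subst finprod_insert) auto
  have 2: "lin_comb G x a I \<in> carrier G"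
    using insert by (intro lin_comb_closed) auto
  show ?case
    using insert 2 by (simp add: 1 int_pow_distrib int_pow_pow mult.commute)
qed

lemma lin_comb_lin_comb:
  assumes "finite I" "finite K" "\<And>i. i \<in> I \<Longrightarrow> x i \<in> carrier G"
  shows "lin_comb G (\<lambda>k. lin_comb G x (b k) I) d K = lin_comb G x (\<lambda>i. \<Sum>k\<in>K. d k * b k i) I"
  using assms(2)
proof (induction K rule: finite_induct)
  case empty
  have "lin_comb G x (\<lambda>i. 0) I = \<one>"
    unfolding lin_comb_def using assms by (simp add: finprod_one_eqI)
  then show ?case by (simp add: lin_comb_def[of _ _ _ "{}"])
next
  case (insert k K)
  have c: "lin_comb G x c I \<in> carrier G" for c
    by (intro lin_comb_closed assms)
  have "lin_comb G (\<lambda>k. lin_comb G x (b k) I) d (insert k K)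
      = lin_comb G x (b k) I [^] d k \<otimes> lin_comb G (\<lambda>k. lin_comb G x (b k) I) d K"
    unfolding lin_comb_def[of _ _ d] using insert c by (subst finprod_insert) auto
  also have "\<dots> = lin_comb G x (\<lambda>i. \<Sum>k\<in>insert k K. d k * b k i) I"
    using insert assms by (simp add: lin_comb_scale lin_comb_add)
  finally show ?case .
qed

lemma lin_comb_single:
  assumes "finite I" "k \<in> I" "\<And>i. i \<in> I \<Longrightarrow> x i \<in> carrier G"
  shows "lin_comb G x (\<lambda>i. if i = k then d else 0) I = x k [^] d"
proof -
  have "lin_comb G x (\<lambda>i. if i = k then d else 0) I
      = finprod G (\<lambda>i. if k = i then x i [^] d else \<one>) I"
    unfolding lin_comb_def using assms by (intro finprod_cong') auto
  then show ?thesis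
    using assms finprod_singleton[of k I "\<lambda>i. x i [^] d"] by auto
qed

lemma lin_comb_mono_neutral:
  assumes "finite I" "J \<subseteq> I" "\<And>i. i \<in> I \<Longrightarrow> x i \<in> carrier G" "\<And>i. i \<in> I - J \<Longrightarrow> a i = 0"
  shows "lin_comb G x a I = lin_comb G x a J"
  unfolding lin_comb_def using assms
  by (intro finprod_mono_neutral_cong_right) auto

end

lemma hom_lin_comb:
  assumes "comm_group G" "comm_group H" "h \<in> hom G H" "finite I" "\<And>i. i \<in> I \<Longrightarrow> x i \<in> carrier G"
  shows "h (lin_comb G x a I) = lin_comb H (\<lambda>i. h (x i)) a I"
proof -
  interpret G: comm_group G by fact
  interpret H: comm_group H by fact
  interpret h: group_hom G H h
    using assms(3) by unfold_locales
  show ?thesis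
    using assms(4,5)
  proof (induction I rule: finite_induct)
    case empty
    then show ?case by (simp add: lin_comb_def)
  next
    case (insert i I)
    have "lin_comb G x a (insert i I) = x i [^]\<^bsub>G\<^esub> a i \<otimes>\<^bsub>G\<^esub> lin_comb G x a I"
      unfolding lin_comb_def using insert by (subst G.finprod_insert) auto
    moreover have "lin_comb H (\<lambda>i. h (x i)) a (insert i I)
        = h (x i) [^]\<^bsub>H\<^esub> a i \<otimes>\<^bsub>H\<^esub> lin_comb H (\<lambda>i. h (x i)) a I"
      unfolding lin_comb_def using insert by (subst H.finprod_insert) auto
    moreover have "lin_comb G x a I \<in> carrier G"
      using insert by (intro G.lin_comb_closed) auto
    ultimately show ?case
      using insert by (simp add: h.hom_int_pow)
  qed
qed

text \<open>Linear algebra without division. A maximal independent subfamily of the images in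
  \<open>G3\<close> has at most c members. Each other member k gives a relation with nonzero
  coefficient at k, and the corresponding combination in \<open>G2\<close> comes from
  \<open>G1\<close>. More than a such elements satisfy a relation in \<open>G1\<close>, which is
  carried back to the original family.\<close>

lemma rank_le_exact:
  assumes G: "comm_group G1" "comm_group G2" "comm_group G3"
    and f: "f \<in> hom G1 G2" and g: "g \<in> hom G2 G3"
    and exact: "\<And>y. y \<in> carrier G2 \<Longrightarrow> g y = \<one>\<^bsub>G3\<^esub> \<Longrightarrow> y \<in> f ` carrier G1"
    and r: "rank_le G1 a" "rank_le G3 c"
  shows "rank_le G2 (a + c)"
  unfolding rank_le_def
proof (intro allI impI)
  fix I :: "nat set" and x
  assume I: "finite I" "a + c < card I" and "x \<in> I \<rightarrow> carrier G2"
  then have x: "\<And>i. i \<in> I \<Longrightarrow> x i \<in> carrier G2" by auto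
  interpret G1: comm_group G1 by fact
  interpret G2: comm_group G2 by fact
  interpret G3: comm_group G3 by fact
  have gx: "\<And>i. i \<in> I \<Longrightarrow> g (x i) \<in> carrier G3"
    using g x by (auto simp: hom_def)
  define indep where
    "indep J \<longleftrightarrow> J \<subseteq> I \<and> (\<forall>b. lin_comb G3 (\<lambda>i. g (x i)) b J = \<one>\<^bsub>G3\<^esub> \<longrightarrow> (\<forall>i\<in>J. b i = 0))" for J
  have indepD: "\<And>J b i. indep J \<Longrightarrow> lin_comb G3 (\<lambda>i. g (x i)) b J = \<one>\<^bsub>G3\<^esub> \<Longrightarrow> i \<in> J \<Longrightarrow> b i = 0"
    and indep_subset: "\<And>J. indep J \<Longrightarrow> J \<subseteq> I"
    unfolding indep_def by blast+
  \<comment> \<open>Maximal in cardinality. It exists because no subset of I has more than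
    \<open>card I\<close> elements.\<close>
  have "\<exists>J. is_arg_max card indep J"
  proof (rule ccontr)
    assume "\<nexists>J. is_arg_max card indep J"
    then have *: "\<And>J. indep J \<Longrightarrow> \<exists>K. indep K \<and> card J < card K"
      unfolding is_arg_max_def by blast
    have "\<exists>J. indep J \<and> n \<le> card J" for n
    proof (induction n)
      case 0
      then show ?case by (intro exI[of _ "{}"]) (auto simp: indep_def)
    next
      case (Suc n)
      then show ?case using * by (meson Suc_leI le_less_trans)
    qed
    then obtain J where "indep J" "Suc (card I) \<le> card J" by blast
    then show False
      using I card_mono[of I J] indep_subset[of J] by simp
  qed
  then obtain J where "is_arg_max card indep J" ..
  then have J: "indep J" and max: "\<And>K. indep K \<Longrightarrow> card K \<le> card J"
    unfolding is_arg_max_def by (auto simp: not_less)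
  have JI: "J \<subseteq> I" by (rule indep_subset[OF J])
  then have finJ: "finite J" using I finite_subset by blast
  have "card J \<le> c"
  proof (rule ccontr)
    assume "\<not> card J \<le> c"
    then have "c < card J" by simp
    moreover have "\<And>i. i \<in> J \<Longrightarrow> g (x i) \<in> carrier G3" using gx JI by blast
    ultimately obtain b where "\<exists>i\<in>J. b i \<noteq> 0" "lin_comb G3 (\<lambda>i. g (x i)) b J = \<one>\<^bsub>G3\<^esub>"
      using rank_leD[OF r(2) finJ, of "\<lambda>i. g (x i)"] by blast
    then show False using indepD[OF J] by blast
  qed
  then have big: "a < card (I - J)"
    using I JI finJ by (simp add: card_Diff_subset)
  \<comment> \<open>By maximality \<open>insert k J\<close> is dependent. Were the coefficient at k
    zero, the relation would live on J alone.\<close>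
  have "\<exists>b. b k \<noteq> 0 \<and> (\<forall>i\<in>I - J. i \<noteq> k \<longrightarrow> b i = 0) \<and> g (lin_comb G2 x b I) = \<one>\<^bsub>G3\<^esub>"
    if k: "k \<in> I - J" for k
  proof -
    have "\<not> indep (insert k J)"
      using max[of "insert k J"] k finJ by auto
    then obtain b j where b: "lin_comb G3 (\<lambda>i. g (x i)) b (insert k J) = \<one>\<^bsub>G3\<^esub>"
      and j: "j \<in> insert k J" "b j \<noteq> 0"
      using k JI unfolding indep_def by blast
    have "b k \<noteq> 0"
    proof
      assume "b k = 0"
      then have "lin_comb G3 (\<lambda>i. g (x i)) b (insert k J) = lin_comb G3 (\<lambda>i. g (x i)) b J"
        using finJ gx JI k by (intro G3.lin_comb_mono_neutral) auto
      then have "\<forall>i\<in>J. b i = 0"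
        using indepD[OF J, of b] b by simp
      then show False using j \<open>b k = 0\<close> by auto
    qed
    define b' where "b' i = (if i \<in> insert k J then b i else 0)" for i
    have "g (lin_comb G2 x b' I) = lin_comb G3 (\<lambda>i. g (x i)) b' I"
      using G I x g by (intro hom_lin_comb)
    also have "\<dots> = lin_comb G3 (\<lambda>i. g (x i)) b' (insert k J)"
      using I gx JI k by (intro G3.lin_comb_mono_neutral) (auto simp: b'_def)
    also have "\<dots> = lin_comb G3 (\<lambda>i. g (x i)) b (insert k J)"
      using gx JI k by (intro G3.lin_comb_cong) (auto simp: b'_def)
    finally show ?thesis
      using b \<open>b k \<noteq> 0\<close> k by (intro exI[of _ b']) (auto simp: b'_def)
  qed
  then obtain b where b: "\<And>k. k \<in> I - J \<Longrightarrow> b k k \<noteq> 0"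
      "\<And>k i. k \<in> I - J \<Longrightarrow> i \<in> I - J \<Longrightarrow> i \<noteq> k \<Longrightarrow> b k i = 0"
      "\<And>k. k \<in> I - J \<Longrightarrow> g (lin_comb G2 x (b k) I) = \<one>\<^bsub>G3\<^esub>"
    by metis
  have "\<exists>z. z \<in> carrier G1 \<and> f z = lin_comb G2 x (b k) I" if "k \<in> I - J" for k
    using exact[OF _ b(3)[OF that]] G2.lin_comb_closed x by force
  then have "\<forall>k\<in>I - J. \<exists>z. z \<in> carrier G1 \<and> f z = lin_comb G2 x (b k) I" by blast
  from bchoice[OF this] obtain z
    where zz: "\<forall>k\<in>I - J. z k \<in> carrier G1 \<and> f (z k) = lin_comb G2 x (b k) I" ..
  have z: "z k \<in> carrier G1" "f (z k) = lin_comb G2 x (b k) I" if "k \<in> I - J" for k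
    using bspec[OF zz that] by simp_all
  have "finite (I - J)" using I by simp
  from rank_leD[where x = z, OF r(1) this big z(1)] obtain d
    where d: "\<exists>k\<in>I - J. d k \<noteq> 0" "lin_comb G1 z d (I - J) = \<one>\<^bsub>G1\<^esub>"
    by blast
  \<comment> \<open>The coefficients of the composed relation. At an index k outside J the sum
    collapses to \<open>d k * b k k\<close>, since \<open>b j k = 0\<close> for all other j; hence e
    is not zero.\<close>
  define e where "e i = (\<Sum>k\<in>I - J. d k * b k i)" for i
  have "lin_comb G2 x e I = lin_comb G2 (\<lambda>k. lin_comb G2 x (b k) I) d (I - J)"
    unfolding e_def using I x by (intro G2.lin_comb_lin_comb[symmetric]) auto
  also have "\<dots> = lin_comb G2 (\<lambda>k. f (z k)) d (I - J)"
    using G2.lin_comb_closed x z by (intro G2.lin_comb_cong) auto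
  also have "\<dots> = f (lin_comb G1 z d (I - J))"
    using hom_lin_comb[OF G(1,2) f, of "I - J" z d] I z by simp
  also have "\<dots> = \<one>\<^bsub>G2\<^esub>"
    unfolding d(2) by (rule hom_one[OF f G1.is_group G2.is_group])
  finally have 1: "lin_comb G2 x e I = \<one>\<^bsub>G2\<^esub>" .
  from d(1) obtain k where k: "k \<in> I - J" "d k \<noteq> 0" ..
  have "e k = (\<Sum>j\<in>I - J. if j = k then d k * b k k else 0)"
    unfolding e_def using b k by (intro sum.cong) auto
  also have "\<dots> = d k * b k k"
    using k I by simp
  finally have "e k \<noteq> 0" using k b by simp
  then show "\<exists>a. (\<exists>i\<in>I. a i \<noteq> 0) \<and> lin_comb G2 x a I = \<one>\<^bsub>G2\<^esub>"
    using 1 k by (intro exI[of _ e] conjI bexI[of _ k]) auto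
qed

lemma rank_le_trivial_group:
  assumes "trivial_group G"
  shows "rank_le G 0"
  unfolding rank_le_def
proof (intro allI impI)
  fix I :: "nat set" and x
  assume I: "finite I" "0 < card I" and x: "x \<in> I \<rightarrow> carrier G"
  have G: "group G" "carrier G = {\<one>\<^bsub>G\<^esub>}" using assms by (auto simp: trivial_group_def)
  then interpret comm_group G
    by (intro group.group_comm_groupI) auto
  have "lin_comb G x (\<lambda>i. 1) I = \<one>\<^bsub>G\<^esub>"
    using lin_comb_closed[of I x "\<lambda>i. 1"] x G by blast
  then show "\<exists>a. (\<exists>i\<in>I. a i \<noteq> 0) \<and> lin_comb G x a I = \<one>\<^bsub>G\<^esub>"
    using I by (intro exI[of _ "\<lambda>i. 1"]) (auto simp: card_gt_0_iff)
qed

text \<open>Injectivity is exactness of 1 -> G -> H at G, with rank 0 on the left.\<close>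

lemma rank_le_inj_hom:
  assumes "comm_group G" "comm_group H" "h \<in> hom G H" "inj_on h (carrier G)" "rank_le H n"
  shows "rank_le G n"
proof -
  interpret G: comm_group G by fact
  interpret H: comm_group H by fact
  have "rank_le (singleton_group (\<one>\<^bsub>G\<^esub>)) 0"
    by (intro rank_le_trivial_group) simp
  moreover have "id \<in> hom (singleton_group \<one>\<^bsub>G\<^esub>) G"
    by (auto simp: hom_def singleton_group_def)
  moreover have "comm_group (singleton_group \<one>\<^bsub>G\<^esub>)"
    by (simp add: group.group_comm_groupI)
  moreover have "y = \<one>\<^bsub>G\<^esub>" if "y \<in> carrier G" "h y = \<one>\<^bsub>H\<^esub>" for y
    using that assms by (metis G.group_axioms G.one_closed H.group_axioms hom_one inj_onD)
  ultimately have "rank_le G (0 + n)"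
    using assms by (intro rank_le_exact[where f = id and g = h and ?G1.0 = "singleton_group (\<one>\<^bsub>G\<^esub>)"]) auto
  then show ?thesis by simp
qed

lemma rank_le_iso:
  assumes "comm_group G" "comm_group H" "h \<in> iso G H" "rank_le H n"
  shows "rank_le G n"
  using assms by (intro rank_le_inj_hom[of G H h]) (auto simp: iso_def bij_betw_def)

lemma rank_le_integer_group: "rank_le integer_group 1"
  unfolding rank_le_def
proof (intro allI impI)
  fix I :: "nat set" and x :: "nat \<Rightarrow> int"
  assume I: "finite I" "1 < card I"
  interpret comm_group integer_group by (rule abelian_integer_group)
  obtain i where i: "i \<in> I" using I by fastforce
  obtain j where j: "j \<in> I" "j \<noteq> i"
    using I i by (metis One_nat_def card_1_singleton_iff less_irrefl subsetI subset_singleton_iff empty_iff insert_iff)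
  \<comment> \<open>The relation x_i x_j - x_j x_i = 0. Its coefficient at j is x_i, so for x_i = 0
    the coefficient 1 at i is taken instead.\<close>
  define a where "a k = (if x i = 0 then (if k = i then 1 else 0)
      else (if k = j then x i else 0) + (if k = i then - x j else 0))" for k
  have *: "lin_comb integer_group x (\<lambda>k. if k = l then d else 0) I = d * x l" if "l \<in> I" for l d
    using lin_comb_single[OF I(1) that, of x d] by simp
  have "lin_comb integer_group x a I = 0"
  proof (cases "x i = 0")
    case True
    then show ?thesis using *[OF i, of 1] by (simp add: a_def[abs_def])
  next
    case False
    then have "lin_comb integer_group x a I
      = lin_comb integer_group x (\<lambda>k. if k = j then x i else 0) I \<otimes>\<^bsub>integer_group\<^esub>
        lin_comb integer_group x (\<lambda>k. if k = i then - x j else 0) I"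
      by (subst lin_comb_add) (auto simp: a_def[abs_def])
    then show ?thesis using * i j by simp
  qed
  moreover have "a (if x i = 0 then i else j) \<noteq> 0"
    using j by (simp add: a_def)
  then have "\<exists>k\<in>I. a k \<noteq> 0"
    using i j by metis
  ultimately show "\<exists>a. (\<exists>i\<in>I. a i \<noteq> 0) \<and> lin_comb integer_group x a I = \<one>\<^bsub>integer_group\<^esub>"
    by auto
qed

section \<open>Rank of integral homology groups\<close>

lemma rank_le_isomorphic:
  assumes "comm_group G" "comm_group H" "G \<cong> H" "rank_le H n"
  shows "rank_le G n"
proof -
  obtain h where "h \<in> iso G H" using assms(3) by (auto simp: is_iso_def)
  then show ?thesis by (rule rank_le_iso[OF assms(1,2) _ assms(4)])
qed

lemma rank_le_exact_seq:
  assumes ex: "exact_seq ([G3, G2, G1], [g, f])"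
    and G: "comm_group G1" "comm_group G2" "comm_group G3"
    and r: "rank_le G1 a" "rank_le G3 c"
  shows "rank_le G2 (a + c)"
proof (rule rank_le_exact[OF G _ _ _ r])
  show "f \<in> hom G1 G2" "g \<in> hom G2 G3"
    using ex by (auto simp: group_hom_def group_hom_axioms_def)
  show "y \<in> f ` carrier G1" if "y \<in> carrier G2" "g y = \<one>\<^bsub>G3\<^esub>" for y
    using ex that by (auto simp: kernel_def)
qed

lemma rank_le_homology_homeomorphic:
  assumes "X homeomorphic_space Y" "rank_le (homology_group p Y) n"
  shows "rank_le (homology_group p X) n"
  by (rule rank_le_isomorphic[OF abelian_homology_group abelian_homology_group
        homeomorphic_space_imp_isomorphic_homology_groups[OF assms(1)] assms(2)])

text \<open>The composite X -> A -> X of g and the inclusion is homotopic to the identity, so g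
  induces an injection into the homology of A; for an upper bound this one-sided statement is
  enough.\<close>

lemma rank_le_homology_deform:
  assumes h: "homotopic_with (\<lambda>_. True) X X id g" and g: "g ` topspace X \<subseteq> A"
    and r: "rank_le (homology_group p (subtopology X A)) n"
  shows "rank_le (homology_group p X) n"
proof (rule rank_le_inj_hom[OF _ _ _ _ r])
  have cg: "continuous_map X X g"
    using homotopic_with_imp_continuous_maps[OF h] by blast
  then have cgA: "continuous_map X (subtopology X A) g"
    using g by (auto simp: continuous_map_in_subtopology)
  let ?g = "hom_induced p X {} (subtopology X A) {} g"
  let ?i = "hom_induced p (subtopology X A) {} X {} id"
  show "?g \<in> hom (homology_group p X) (homology_group p (subtopology X A))"
    by (simp add: hom_induced_hom)
  have "?i (?g c) = c" if "c \<in> carrier (homology_group p X)" for c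
  proof -
    have "?i (?g c) = hom_induced p X {} X {} (id \<circ> g) c"
      using cgA by (intro hom_induced_compose') (auto intro: continuous_map_from_subtopology)
    also have "\<dots> = hom_induced p X {} X {} id c"
      using homology_homotopy_empty[OF h] by simp
    also have "\<dots> = c"
      using that by (rule hom_induced_id)
    finally show ?thesis .
  qed
  then show "inj_on ?g (carrier (homology_group p X))"
    by (rule inj_on_inverseI)
qed auto

lemma rank_le_homology_singleton:
  assumes "topspace X = {a}"
  shows "rank_le (homology_group p X) 1"
proof (cases "p = 0")
  case True
  then show ?thesis
    using rank_le_isomorphic[OF _ _ homology_coefficients[OF assms] rank_le_integer_group]
      abelian_integer_group by simp
next
  case False
  then show ?thesis
    by (intro rank_le_mono[OF rank_le_trivial_group[OF homology_dimension_axiom[OF assms]]]) auto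
qed

lemma rank_le_homology_empty:
  assumes "topspace X = {}"
  shows "rank_le (homology_group p X) 0"
  by (rule rank_le_trivial_group[OF trivial_homology_group_empty[OF assms]])

lemma rank_le_homology_contractible:
  assumes "contractible_space X"
  shows "rank_le (homology_group p X) 1"
proof (cases "topspace X = {}")
  case True
  then show ?thesis
    by (rule rank_le_mono[OF rank_le_homology_empty]) simp
next
  case False
  obtain a where a: "homotopic_with (\<lambda>x. True) X X id (\<lambda>x. a)"
    using assms by (auto simp: contractible_space_def)
  then have "continuous_map X X (\<lambda>x. a)"
    using homotopic_with_imp_continuous_maps by blast
  then have "a \<in> topspace X"
    using False by (auto simp: continuous_map_def)
  then have "rank_le (homology_group p (subtopology X {a})) 1"
    by (intro rank_le_homology_singleton[where a = a]) auto
  then show ?thesis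
    using a by (rule rank_le_homology_deform[rotated 2]) auto
qed

text \<open>In the sequence of the pair, the relative group sits between H_p(X) and H_(p-1)(A).
  Degrees are integers, so p - 1 makes sense for every p.\<close>

lemma rank_le_homology_relative:
  assumes "rank_le (homology_group p X) a" "rank_le (homology_group (p - 1) (subtopology X A)) b"
  shows "rank_le (relative_homology_group p X A) (a + b)"
  using homology_exactness_axiom_1[of p X A] by (rule rank_le_exact_seq) (use assms in auto)

text \<open>Takes the place of Mayer-Vietoris: X is estimated by P and the pair (X, P), which
  excision turns into the pair (Q, P \<inter> Q).\<close>

lemma rank_le_homology_open_cover:
  assumes P: "openin X P" and Q: "openin X Q" and PQ: "P \<union> Q = topspace X"
    and rP: "rank_le (homology_group p (subtopology X P)) a"
    and rQ: "rank_le (homology_group p (subtopology X Q)) b"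
    and rPQ: "rank_le (homology_group (p - 1) (subtopology X (P \<inter> Q))) c"
  shows "rank_le (homology_group p X) (a + (b + c))"
proof -
  \<comment> \<open>The set to be excised: it is closed and lies inside the open set P.\<close>
  let ?U = "topspace X - Q"
  have "Q \<subseteq> topspace X" using Q openin_subset by blast
  then have 1: "topspace X - ?U = Q" by auto
  have 2: "P - ?U = P \<inter> Q" using PQ by auto
  have "X closure_of ?U = ?U" using Q by (simp add: closure_of_eq closedin_diff)
  moreover have "X interior_of P = P" using P by (simp add: interior_of_openin)
  ultimately have "X closure_of ?U \<subseteq> X interior_of P" using PQ by auto
  from homology_excision_axiom[OF this, of "topspace X" p]
  have "hom_induced p (subtopology X Q) (P \<inter> Q) X P id
    \<in> iso (relative_homology_group p (subtopology X Q) (P \<inter> Q)) (relative_homology_group p X P)"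
    unfolding 1 2 using P openin_subset by auto
  then have iso: "relative_homology_group p X P \<cong> relative_homology_group p (subtopology X Q) (P \<inter> Q)"
    by (rule group.iso_sym[OF group_relative_homology_group is_isoI])
  have "subtopology (subtopology X Q) (P \<inter> Q) = subtopology X (P \<inter> Q)"
    by (simp add: subtopology_subtopology Int_absorb1)
  then have "rank_le (relative_homology_group p (subtopology X Q) (P \<inter> Q)) (b + c)"
    using rQ rPQ by (intro rank_le_homology_relative) (simp_all only:)
  then have "rank_le (relative_homology_group p X P) (b + c)"
    by (rule rank_le_isomorphic[OF abelian_relative_homology_group abelian_relative_homology_group iso])
  then show ?thesis
    by (rule rank_le_exact_seq[OF homology_exactness_axiom_3[of p X P] abelian_homology_group
          abelian_homology_group abelian_relative_homology_group rP])
qed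

section \<open>Convex subsets of coordinate spaces\<close>

abbreviation real_space :: "'e set \<Rightarrow> ('e \<Rightarrow> real) topology" where
  "real_space E \<equiv> product_topology (\<lambda>_. euclideanreal) E"

text \<open>Points of \<open>real_space E\<close> are extensional functions, so a segment is formed
  coordinatewise on E and cut back to E.\<close>

definition convex_in :: "'e set \<Rightarrow> ('e \<Rightarrow> real) set \<Rightarrow> bool" where
  "convex_in E K \<longleftrightarrow> K \<subseteq> extensional E \<and>
     (\<forall>x\<in>K. \<forall>y\<in>K. \<forall>t\<in>{0..1}. (\<lambda>e\<in>E. (1 - t) * x e + t * y e) \<in> K)"

lemma convex_in_Int: "convex_in E K \<Longrightarrow> convex_in E L \<Longrightarrow> convex_in E (K \<inter> L)"
  by (auto simp: convex_in_def)

lemma topspace_real_space [simp]: "topspace (real_space E) = extensional E"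
  by (simp add: PiE_UNIV_domain extensional_def PiE_def)

lemma continuous_map_real_space_component:
  "e \<in> E \<Longrightarrow> continuous_map (real_space E) euclideanreal (\<lambda>x. x e)"
  by (rule continuous_map_product_projection)

lemma continuous_map_into_real_space:
  assumes "\<And>e. e \<in> E \<Longrightarrow> continuous_map X euclideanreal (\<lambda>x. f x e)" "\<And>x. x \<in> topspace X \<Longrightarrow> f x \<in> K"
    "K \<subseteq> extensional E"
  shows "continuous_map X (subtopology (real_space E) K) f"
  using assms by (auto simp: continuous_map_in_subtopology continuous_map_componentwise)

lemma convex_in_contractible:
  assumes "convex_in E K"
  shows "contractible_space (subtopology (real_space E) K)" (is "contractible_space ?X")
proof (cases "K = {}")
  case True
  then show ?thesis by (simp add: contractible_space_empty)
next
  case False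
  then obtain a where a: "a \<in> K" by blast
  have K: "K \<subseteq> extensional E" using assms by (simp add: convex_in_def)
  then have [simp]: "topspace ?X = K" by (simp add: Int_absorb1 del: topspace_product_topology)
  have "homotopic_with (\<lambda>x. True) ?X ?X id (\<lambda>x. a)"
  proof (subst homotopic_with, simp, intro exI conjI allI ballI impI)
    let ?h = "\<lambda>(t :: real, x). \<lambda>e\<in>E. (1 - t) * x e + t * a e"
    let ?Y = "prod_topology (top_of_set {0..1::real}) ?X"
    show "continuous_map ?Y ?X ?h"
    proof (rule continuous_map_into_real_space[OF _ _ K])
      fix e assume e: "e \<in> E"
      have 1: "continuous_map ?Y euclideanreal fst"
        using continuous_map_fst[of "top_of_set {0..1::real}" ?X]
        by (metis continuous_map_into_fulltopology)
      have "continuous_map ?Y euclideanreal ((\<lambda>x. x e) \<circ> snd)"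
        by (rule continuous_map_compose[OF continuous_map_snd])
          (intro continuous_map_from_subtopology continuous_map_real_space_component e)
      then have 2: "continuous_map ?Y euclideanreal (\<lambda>z. snd z e)"
        by (simp add: o_def)
      have "continuous_map ?Y euclideanreal (\<lambda>z. (1 - fst z) * snd z e + fst z * a e)"
        by (intro continuous_intros 1 2)
      then show "continuous_map ?Y euclideanreal (\<lambda>z. ?h z e)"
        using e by (simp add: case_prod_beta)
    next
      fix z assume "z \<in> topspace ?Y"
      then show "?h z \<in> K"
        using assms a by (auto simp: convex_in_def)
    qed
    show "?h (0, x) = id x" if "x \<in> topspace ?X" for x
      using that K by (auto simp: fun_eq_iff extensional_def)
    show "?h (1, x) = a" if "x \<in> topspace ?X" for x
      using a K by (auto simp: fun_eq_iff extensional_def)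
  qed auto
  then show ?thesis by (auto simp: contractible_space_def)
qed

text \<open>Adding U_j to a union V of n sets costs V, U_j and U_j \<inter> V. The last is again a
  union of n convex pieces, but inside K \<inter> U_j, which is why a convex set K is carried
  through the induction. The recursion r(n+1) = 2 r(n) + 1 has the solution 2^n - 1.\<close>

lemma rank_le_homology_Union_convex:
  assumes "finite I" "convex_in E K"
    and "\<And>i. i \<in> I \<Longrightarrow> openin (real_space E) (U i)" "\<And>i. i \<in> I \<Longrightarrow> convex_in E (U i)"
  shows "rank_le (homology_group p (subtopology (real_space E) (K \<inter> (\<Union>i\<in>I. U i)))) (2 ^ card I - 1)"
  using assms
proof (induction I arbitrary: K p rule: finite_induct)
  case empty
  have "rank_le (homology_group p (subtopology (real_space E) {})) 0"
    by (rule rank_le_homology_empty) simp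
  then show ?case by simp
next
  case (insert j I)
  let ?T = "real_space E"
  let ?V = "\<Union>i\<in>I. U i"
  have K: "K \<subseteq> extensional E" using insert.prems by (simp add: convex_in_def)
  let ?X = "subtopology ?T (K \<inter> (\<Union>i\<in>insert j I. U i))"
  have sub: "subtopology ?X (K \<inter> W) = subtopology ?T (K \<inter> W)" if "W \<subseteq> (\<Union>i\<in>insert j I. U i)" for W
  proof -
    have "K \<inter> (\<Union>i\<in>insert j I. U i) \<inter> (K \<inter> W) = K \<inter> W" using that by blast
    then show ?thesis by (simp add: subtopology_subtopology)
  qed
  have conv: "convex_in E (K \<inter> U j)"
    using insert.prems by (intro convex_in_Int) auto
  have IH: "rank_le (homology_group p (subtopology ?T (L \<inter> ?V))) (2 ^ card I - 1)"
    if "convex_in E L" for L p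
    using insert.prems by (intro insert.IH that) simp_all
  have V: "openin ?T ?V" using insert.prems by auto
  have "rank_le (homology_group p ?X) (2 ^ card I - 1 + (1 + (2 ^ card I - 1)))"
  proof (rule rank_le_homology_open_cover)
    have op: "openin ?X (W \<inter> (K \<inter> (\<Union>i\<in>insert j I. U i)))" if "openin ?T W" for W
      using that unfolding openin_subtopology by (intro exI[of _ W] conjI refl)
    have eq: "?V \<inter> (K \<inter> (\<Union>i\<in>insert j I. U i)) = K \<inter> ?V"
      "U j \<inter> (K \<inter> (\<Union>i\<in>insert j I. U i)) = K \<inter> U j" by blast+
    show "openin ?X (K \<inter> ?V)"
      using op[OF V] unfolding eq .
    show "openin ?X (K \<inter> U j)"
      using op[OF insert.prems(2)[of j]] unfolding eq by simp
    show "K \<inter> ?V \<union> K \<inter> U j = topspace ?X"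
      using K unfolding topspace_subtopology topspace_real_space by blast
    show "rank_le (homology_group p (subtopology ?X (K \<inter> ?V))) (2 ^ card I - 1)"
    proof (subst sub)
      show "rank_le (homology_group p (subtopology ?T (K \<inter> ?V))) (2 ^ card I - 1)"
        by (rule IH[OF insert.prems(1)])
    qed simp
    show "rank_le (homology_group p (subtopology ?X (K \<inter> U j))) 1"
      using rank_le_homology_contractible[OF convex_in_contractible[OF conv], of p] sub[of "U j"] by simp
    have "rank_le (homology_group (p - 1) (subtopology ?T ((K \<inter> U j) \<inter> ?V))) (2 ^ card I - 1)"
      by (rule IH[OF conv])
    moreover have "K \<inter> ?V \<inter> (K \<inter> U j) = K \<inter> (U j \<inter> ?V)" "K \<inter> U j \<inter> ?V = K \<inter> (U j \<inter> ?V)" by auto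
    moreover have "subtopology ?X (K \<inter> (U j \<inter> ?V)) = subtopology ?T (K \<inter> (U j \<inter> ?V))"
      by (rule sub) auto
    ultimately show "rank_le (homology_group (p - 1) (subtopology ?X (K \<inter> ?V \<inter> (K \<inter> U j)))) (2 ^ card I - 1)"
      by (simp only:)
  qed
  moreover have "2 ^ card I - 1 + (1 + (2 ^ card I - 1)) = (2 ^ card (insert j I) - 1 :: nat)"
  proof -
    have "(1::nat) \<le> 2 ^ card I" by simp
    moreover have "(2::nat) ^ card (insert j I) = 2 ^ card I + 2 ^ card I"
      using insert by simp
    ultimately show ?thesis by linarith
  qed
  ultimately show ?case by simp
qed

section \<open>Attaching a cell\<close>

text \<open>Use the open cover by V = X - {f b} and U = X - A. The homotopy h, pushed down along f,
  deforms V into A. Over U the map f is a homeomorphism, so U is the open cell and U \<inter> V is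
  the open cell without b. Properness enters because it makes the product of f with the identity of
  [0,1] a closed map, so that continuity of the pushed homotopy can be tested on D.\<close>

lemma rank_le_homology_attach_cell:
  fixes h :: "real \<Rightarrow> 'b \<Rightarrow> 'b"
  assumes A: "closedin X A"
    and contf: "continuous_map D X f" and proper: "proper_map D X f"
    and cover: "topspace X \<subseteq> A \<union> f ` topspace D"
    and inj: "inj_on f {x \<in> topspace D. f x \<notin> A}"
    and b: "b \<in> topspace D" "f b \<notin> A" and t1: "t1_space D"
    and conth: "continuous_map (prod_topology (top_of_set {0..1}) (subtopology D (topspace D - {b})))
                  (subtopology D (topspace D - {b})) (\<lambda>(t, x). h t x)"
    and h0: "\<And>x. x \<in> topspace D \<Longrightarrow> x \<noteq> b \<Longrightarrow> h 0 x = x"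
    and h1: "\<And>x. x \<in> topspace D \<Longrightarrow> x \<noteq> b \<Longrightarrow> f (h 1 x) \<in> A"
    and hA: "\<And>x t. x \<in> topspace D \<Longrightarrow> f x \<in> A \<Longrightarrow> 0 \<le> t \<Longrightarrow> t \<le> 1 \<Longrightarrow> h t x = x"
    and rA: "rank_le (homology_group p (subtopology X A)) n"
    and rU: "rank_le (homology_group p (subtopology D {x \<in> topspace D. f x \<notin> A})) k"
    and rUb: "rank_le (homology_group (p - 1) (subtopology D ({x \<in> topspace D. f x \<notin> A} - {b}))) l"
  shows "rank_le (homology_group p X) (n + (k + l))"
proof -
  define V where "V = topspace X - {f b}"
  define U where "U = topspace X - A"
  have fD: "\<And>x. x \<in> topspace D \<Longrightarrow> f x \<in> topspace X"
    using contf by (auto simp: continuous_map_def)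
  have f_eq: "x = y" if "f x = f y" "f y \<notin> A" "x \<in> topspace D" "y \<in> topspace D" for x y
    using inj_onD[OF inj, of x y] that by simp
  have AX: "A \<subseteq> topspace X" using A by (rule closedin_subset)
  have closed: "closed_map D X f" using proper by (rule proper_imp_closed_map)
  have "closedin D {b}" using t1 b by (simp add: closedin_t1_singleton)
  then have "closedin X (f ` {b})" using closed unfolding closed_map_def by blast
  then have Vo: "openin X V" unfolding V_def by (simp add: openin_diff)
  have Uo: "openin X U" unfolding U_def using A by (simp add: openin_diff)
  have rV: "rank_le (homology_group p (subtopology X V)) n"
  proof -
    let ?XV = "subtopology X V" and ?D0 = "subtopology D (topspace D - {b})"
    let ?I = "top_of_set {0..1::real}"
    have topV: "topspace ?XV = V" by (auto simp: V_def)
    have D0: "{x \<in> topspace D. f x \<in> V} = topspace D - {b}"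
      using fD f_eq[of _ b] b by (auto simp: V_def)
    \<comment> \<open>The image of the punctured model. It is closed in V, and together with A it
      covers V.\<close>
    define B where "B = f ` (topspace D - {b})"
    have BV: "B \<subseteq> V" using D0 by (auto simp: B_def)
    have propV: "proper_map ?D0 ?XV f"
      using proper D0 by (rule proper_map_restriction)
    have clB: "closedin ?XV B"
    proof -
      have "closedin ?XV (f ` topspace ?D0)"
        using proper_imp_closed_map[OF propV] unfolding closed_map_def by blast
      then show ?thesis by (simp add: B_def Int_absorb1)
    qed
    have clA: "closedin ?XV A"
      using A b AX by (intro closedin_subset_topspace) (auto simp: V_def)
    \<comment> \<open>Some preimage away from b. Over A there may be many, but there H is the
      identity and does not consult q.\<close>
    define q where "q y = (SOME x. x \<in> topspace D - {b} \<and> f x = y)" for y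
    have q: "q y \<in> topspace D - {b}" "f (q y) = y" if "y \<in> B" for y
      using that someI_ex[of "\<lambda>x. x \<in> topspace D - {b} \<and> f x = y"] unfolding B_def q_def by blast+
    define H where "H = (\<lambda>(t, y). if y \<in> A then y else f (h t (q y)))"
    have hin: "h t x \<in> topspace D - {b}" if "x \<in> topspace D - {b}" "0 \<le> t" "t \<le> 1" for t x
    proof -
      have "(t, x) \<in> topspace (prod_topology ?I ?D0)" using that by simp
      from imageI[OF this, of "\<lambda>(t, x). h t x"] show ?thesis
        using continuous_map_image_subset_topspace[OF conth] by auto
    qed
    \<comment> \<open>The choice of preimage does not matter: off A it is unique by injectivity,
      over A the homotopy is stationary.\<close>
    have Hf: "H (t, f x) = f (h t x)" if "x \<in> topspace D - {b}" "0 \<le> t" "t \<le> 1" for t x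
    proof (cases "f x \<in> A")
      case True
      then show ?thesis using hA[of x t] that by (simp add: H_def)
    next
      case False
      have "f x \<in> B" using that by (auto simp: B_def)
      then have "q (f x) = x" using f_eq[of "q (f x)" x] q[of "f x"] False that by auto
      then show ?thesis using False by (simp add: H_def)
    qed
    have contA: "continuous_map (subtopology (prod_topology ?I ?XV) (UNIV \<times> A)) ?XV H"
    proof (rule continuous_map_eq)
      show "continuous_map (subtopology (prod_topology ?I ?XV) (UNIV \<times> A)) ?XV snd"
        by (intro continuous_map_from_subtopology continuous_map_snd)
    qed (auto simp: H_def)
    \<comment> \<open>\<open>?F\<close> is continuous, closed and onto, hence a quotient map, and H
      after \<open>?F\<close> is f after h.\<close>
    have contB: "continuous_map (subtopology (prod_topology ?I ?XV) (UNIV \<times> B)) ?XV H"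
    proof -
      let ?F = "\<lambda>(t :: real, x). (id t, f x)"
      have eqB: "subtopology (prod_topology ?I ?XV) (UNIV \<times> B) = prod_topology ?I (subtopology X B)"
        using BV by (simp add: subtopology_Times subtopology_subtopology Int_absorb1)
      have propB: "proper_map ?D0 (subtopology X B) f"
        using proper_map_into_subtopology[OF propV, of B] BV
        by (auto simp: B_def subtopology_subtopology Int_absorb1)
      have pF: "proper_map (prod_topology ?I ?D0) (prod_topology ?I (subtopology X B)) ?F"
        using propB by (simp only: proper_map_prod proper_map_id) simp
      have cB: "continuous_map ?D0 (subtopology X B) f"
        using contf by (auto simp: continuous_map_in_subtopology B_def intro: continuous_map_from_subtopology)
      have cF: "continuous_map (prod_topology ?I ?D0) (prod_topology ?I (subtopology X B)) ?F"
        unfolding continuous_map_prod_top using cB by simp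
      have sF: "?F ` topspace (prod_topology ?I ?D0) = topspace (prod_topology ?I (subtopology X B))"
        using fD by (force simp: B_def)
      have "quotient_map (prod_topology ?I ?D0) (prod_topology ?I (subtopology X B)) ?F"
        by (rule continuous_closed_imp_quotient_map[OF cF proper_imp_closed_map[OF pF] sF])
      moreover have "continuous_map (prod_topology ?I ?D0) ?XV (H \<circ> ?F)"
      proof (rule continuous_map_eq)
        have "continuous_map ?D0 ?XV f"
          using contf D0 by (auto simp: continuous_map_in_subtopology intro: continuous_map_from_subtopology)
        then show "continuous_map (prod_topology ?I ?D0) ?XV (f \<circ> (\<lambda>(t, x). h t x))"
          using conth by (intro continuous_map_compose)
        show "(f \<circ> (\<lambda>(t, x). h t x)) z = (H \<circ> ?F) z" if "z \<in> topspace (prod_topology ?I ?D0)" for z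
          using that Hf[of "snd z" "fst z"] by (simp add: split_beta mem_Times_iff)
      qed
      ultimately show ?thesis
        unfolding eqB by (rule continuous_compose_quotient_map)
    qed
    have contH: "continuous_map (prod_topology ?I ?XV) ?XV H"
    proof (rule pasting_lemma_closed[where I = "{True, False}" and f = "\<lambda>_. H"
            and T = "\<lambda>i. if i then {0..1} \<times> A else {0..1} \<times> B"])
      have cl: "closedin ?I {0..1}" using closedin_topspace[of ?I] by (simp only: topspace_euclidean_subtopology)
      show "closedin (prod_topology ?I ?XV) (if i then {0..1} \<times> A else {0..1} \<times> B)" for i
        using cl clA clB by (simp only: closedin_prod_Times_iff split: if_split) simp
      have sub: "subtopology (prod_topology ?I ?XV) ({0..1} \<times> C) = subtopology (prod_topology ?I ?XV) (UNIV \<times> C)" for C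
        by (simp add: subtopology_Times subtopology_subtopology)
      show "continuous_map (subtopology (prod_topology ?I ?XV) (if i then {0..1} \<times> A else {0..1} \<times> B)) ?XV H" for i
        using contA contB sub by (cases i) simp_all
      show "\<exists>j. j \<in> {True, False} \<and> z \<in> (if j then {0..1} \<times> A else {0..1} \<times> B) \<and> H z = H z"
        if "z \<in> topspace (prod_topology ?I ?XV)" for z
      proof -
        obtain t y where z: "z = (t, y)" "t \<in> {0..1}" "y \<in> V" using \<open>z \<in> _\<close> topV by auto
        then have "y \<in> A \<or> y \<in> B" using cover by (auto simp: V_def B_def)
        then show ?thesis using z by (intro exI[of _ "y \<in> A"]) auto
      qed
    qed auto
    show ?thesis
    proof (rule rank_le_homology_deform)
      show "homotopic_with (\<lambda>_. True) ?XV ?XV id (\<lambda>y. H (1, y))"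
      proof (subst homotopic_with, simp, intro exI conjI allI ballI impI)
        show "continuous_map (prod_topology ?I ?XV) ?XV H" by (rule contH)
        show "H (0, y) = id y" if "y \<in> topspace ?XV" for y
        proof (cases "y \<in> A")
          case False
          then have "y \<in> B" using cover that unfolding topV by (auto simp: V_def B_def)
          then show ?thesis using h0[of "q y"] q[of y] False by (auto simp: H_def)
        qed (simp add: H_def)
      qed auto
      show "(\<lambda>y. H (1, y)) ` topspace ?XV \<subseteq> A"
      proof (rule image_subsetI)
        fix y assume y: "y \<in> topspace ?XV"
        show "H (1, y) \<in> A"
        proof (cases "y \<in> A")
          case False
          then have "y \<in> B" using cover y unfolding topV by (auto simp: V_def B_def)
          then show ?thesis using h1[of "q y"] q[of y] False by (auto simp: H_def)
        qed (simp add: H_def)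
      qed
      have "subtopology ?XV A = subtopology X A"
        using b AX by (auto simp: subtopology_subtopology V_def intro!: arg_cong[where f = "subtopology X"])
      then show "rank_le (homology_group p (subtopology ?XV A)) n" using rA by simp
    qed
  qed
  \<comment> \<open>A closed map restricts to a closed map over any subset W; inside U it is also
    bijective.\<close>
  have homeo: "subtopology X W homeomorphic_space subtopology D {x \<in> topspace D. f x \<in> W}"
    if "W \<subseteq> U" for W
  proof -
    let ?W = "{x \<in> topspace D. f x \<in> W}"
    have W: "W \<subseteq> topspace X" "?W \<subseteq> topspace D" using that by (auto simp: U_def)
    have "homeomorphic_map (subtopology D ?W) (subtopology X W) f"
    proof (rule bijective_closed_imp_homeomorphic_map)
      show "continuous_map (subtopology D ?W) (subtopology X W) f"
        using contf by (auto simp: continuous_map_in_subtopology intro: continuous_map_from_subtopology)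
      show "closed_map (subtopology D ?W) (subtopology X W) f"
        by (rule closed_map_restriction[OF closed]) simp
      have "f ` ?W = W" using that cover by (auto simp: U_def)
      then show "f ` topspace (subtopology D ?W) = topspace (subtopology X W)"
        using W by (simp add: Int_absorb1)
      have "?W \<subseteq> {x \<in> topspace D. f x \<notin> A}" using that by (auto simp: U_def)
      then show "inj_on f (topspace (subtopology D ?W))"
        using inj_on_subset[OF inj] by (simp add: Int_absorb1)
    qed
    then show ?thesis
      by (intro homeomorphic_map_imp_homeomorphic_space[THEN homeomorphic_space_sym[THEN iffD1]])
  qed
  have "V \<union> U = topspace X" using b fD[of b] by (auto simp: U_def V_def)
  moreover have "rank_le (homology_group p (subtopology X U)) k"
  proof (rule rank_le_homology_homeomorphic[OF homeo])
    have "{x \<in> topspace D. f x \<in> U} = {x \<in> topspace D. f x \<notin> A}" using fD by (auto simp: U_def)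
    then show "rank_le (homology_group p (subtopology D {x \<in> topspace D. f x \<in> U})) k"
      using rU by simp
  qed simp
  moreover have "rank_le (homology_group (p - 1) (subtopology X (V \<inter> U))) l"
  proof (rule rank_le_homology_homeomorphic[OF homeo])
    have "{x \<in> topspace D. f x \<in> V \<inter> U} = {x \<in> topspace D. f x \<notin> A} - {b}"
      using fD f_eq[of _ b] b by (auto simp: U_def V_def)
    then show "rank_le (homology_group (p - 1) (subtopology D {x \<in> topspace D. f x \<in> V \<inter> U})) l"
      using rUb by simp
  qed simp
  ultimately show ?thesis
    by (rule rank_le_homology_open_cover[OF Vo Uo _ rV])
qed

section \<open>Simplices glued along faces\<close>

definition simplex :: "'e set \<Rightarrow> ('e \<Rightarrow> real) set" where
  "simplex E = {x \<in> extensional E. (\<forall>e\<in>E. 0 \<le> x e) \<and> (\<Sum>e\<in>E. x e) = 1}"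

definition supp :: "'e set \<Rightarrow> ('e \<Rightarrow> real) \<Rightarrow> 'e set" where
  "supp E x = {e \<in> E. x e \<noteq> 0}"

lemma closedin_real_space_le:
  assumes "continuous_map (real_space E) euclideanreal f" "continuous_map (real_space E) euclideanreal g"
  shows "closedin (real_space E) {x \<in> extensional E. f x \<le> g x}"
proof -
  have "continuous_map (real_space E) euclideanreal (\<lambda>x. g x - f x)"
    by (intro continuous_intros assms)
  moreover have "closedin euclideanreal {0..}" by simp
  ultimately have "closedin (real_space E) {x \<in> topspace (real_space E). g x - f x \<in> {0..}}"
    by (rule closedin_continuous_map_preimage)
  then show ?thesis unfolding topspace_real_space by simp
qed

lemma closedin_real_space_eq:
  assumes "continuous_map (real_space E) euclideanreal f"
  shows "closedin (real_space E) {x \<in> extensional E. f x = c}"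
proof -
  have "closedin euclideanreal {c}" by simp
  with assms have "closedin (real_space E) {x \<in> topspace (real_space E). f x \<in> {c}}"
    by (rule closedin_continuous_map_preimage)
  then show ?thesis unfolding topspace_real_space by simp
qed

lemma openin_real_space_less:
  assumes "continuous_map (real_space E) euclideanreal f"
  shows "openin (real_space E) {x \<in> extensional E. f x < c}"
proof -
  have "openin euclideanreal {..<c}" by simp
  with assms have "openin (real_space E) {x \<in> topspace (real_space E). f x \<in> {..<c}}"
    by (rule openin_continuous_map_preimage)
  then show ?thesis unfolding topspace_real_space by simp
qed

text \<open>Coordinates of points of a simplex lie in [0,1], so F is a closed subset of a compact
  cube.\<close>

lemma compact_space_subset_simplex:
  assumes E: "finite E" and F: "closedin (real_space E) F" "F \<subseteq> simplex E"
  shows "compact_space (subtopology (real_space E) F)"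
proof -
  have "compactin (real_space E) (PiE E (\<lambda>_. {0..1}))"
    by (simp add: compactin_PiE)
  moreover have "F \<subseteq> PiE E (\<lambda>_. {0..1})"
  proof
    fix x assume "x \<in> F"
    then have x: "x \<in> extensional E" "\<And>e. e \<in> E \<Longrightarrow> 0 \<le> x e" "(\<Sum>e\<in>E. x e) = 1"
      using F by (auto simp: simplex_def)
    have "x e \<le> 1" if "e \<in> E" for e
      using member_le_sum[of e E x] x E that by simp
    then show "x \<in> PiE E (\<lambda>_. {0..1})"
      using x by (auto simp: PiE_def)
  qed
  ultimately have "compactin (real_space E) F"
    using F(1) closed_compactin by blast
  then show ?thesis by (simp add: compact_space_subtopology)
qed

lemma closedin_simplex: "closedin (real_space E) (simplex E)"
proof (cases "finite E")
  case True
  have "closedin (real_space E) {x \<in> extensional E. 0 \<le> x e}" if "e \<in> E" for e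
    using that by (intro closedin_real_space_le continuous_map_real_space_component) auto
  moreover have "continuous_map (real_space E) euclideanreal (\<lambda>x. \<Sum>e\<in>E. x e)"
    using True by (intro continuous_map_sum continuous_map_real_space_component)
  then have 1: "closedin (real_space E) {x \<in> extensional E. (\<Sum>e\<in>E. x e) = 1}"
    by (rule closedin_real_space_eq)
  ultimately have "closedin (real_space E) (\<Inter>(insert {x \<in> extensional E. (\<Sum>e\<in>E. x e) = 1}
      ((\<lambda>e. {x \<in> extensional E. 0 \<le> x e}) ` E)))"
    by (intro closedin_Inter) auto
  also have "\<Inter>(insert {x \<in> extensional E. (\<Sum>e\<in>E. x e) = 1}
      ((\<lambda>e. {x \<in> extensional E. 0 \<le> x e}) ` E)) = simplex E"
    by (auto simp: simplex_def)
  finally show ?thesis .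
next
  \<comment> \<open>The sum over an infinite set is 0 by convention, so the simplex is
    empty.\<close>
  case False
  then show ?thesis by (simp add: simplex_def)
qed

lemma closedin_vanish:
  assumes "S \<subseteq> E"
  shows "closedin (real_space E) {x \<in> extensional E. \<forall>e\<in>S. x e = 0}"
proof -
  \<comment> \<open>The whole space is put into the family so that the intersection is right also
    for empty S.\<close>
  have "{x \<in> extensional E. \<forall>e\<in>S. x e = 0} = \<Inter>(insert (topspace (real_space E)) ((\<lambda>e. {x \<in> extensional E. x e = 0}) ` S))"
    unfolding topspace_real_space by auto
  moreover have "closedin (real_space E) {x \<in> extensional E. x e = 0}" if "e \<in> S" for e
    using that assms by (intro closedin_real_space_eq continuous_map_real_space_component) auto
  ultimately show ?thesis
    by (simp only:) (intro closedin_Inter, auto simp del: topspace_product_topology topspace_real_space)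
qed

lemma supp_nonempty: "x \<in> simplex E \<Longrightarrow> supp E x \<noteq> {}"
proof
  assume "x \<in> simplex E" "supp E x = {}"
  then have "(\<Sum>e\<in>E. x e) = 1" "\<And>e. e \<in> E \<Longrightarrow> x e = 0" by (auto simp: simplex_def supp_def)
  then show False by simp
qed

lemma continuous_map_Min:
  fixes f :: "'a \<Rightarrow> 'e \<Rightarrow> real"
  assumes "finite S" "S \<noteq> {}" "\<And>e. e \<in> S \<Longrightarrow> continuous_map X euclideanreal (\<lambda>x. f x e)"
  shows "continuous_map X euclideanreal (\<lambda>x. Min (f x ` S))"
  using assms
proof (induction S rule: finite_ne_induct)
  case (insert e S)
  then have "continuous_map X euclideanreal (\<lambda>x. min (f x e) (Min (f x ` S)))"
    by (intro continuous_map_real_min) auto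
  moreover have "Min (f x ` insert e S) = min (f x e) (Min (f x ` S))" for x
    using insert by simp
  ultimately show ?case by simp
qed simp

text \<open>Collects what the moduli space contributes to the topological argument.
  \<open>glue i j \<psi> S\<close> says that \<psi> identifies the face of simplex i with vertex set
  S with a face of simplex j. Whether two points are identified depends only on their supports and
  the coordinates there. By \<open>glue_subset\<close> gluings pass to smaller faces; by
  \<open>glue_self\<close> a face can be glued to itself in a nontrivial way only if it has two
  vertices. \<open>closedin_X\<close> is the quotient topology.\<close>

locale glued_simplices =
  fixes X :: "'x topology" and I :: "'i set" and E :: "'i \<Rightarrow> 'e set"
    and pt :: "'i \<Rightarrow> ('e \<Rightarrow> real) \<Rightarrow> 'x"
    and glue :: "'i \<Rightarrow> 'i \<Rightarrow> ('e \<Rightarrow> 'e) \<Rightarrow> 'e set \<Rightarrow> bool"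
  assumes finI: "finite I" and finE: "\<And>i. i \<in> I \<Longrightarrow> finite (E i)"
    and topspace_X: "topspace X = (\<Union>i\<in>I. pt i ` simplex (E i))"
    and closedin_X: "\<And>C. closedin X C \<longleftrightarrow> C \<subseteq> topspace X \<and>
          (\<forall>i\<in>I. closedin (subtopology (real_space (E i)) (simplex (E i))) {x \<in> simplex (E i). pt i x \<in> C})"
    and pt_eq_iff: "\<And>i j x y. i \<in> I \<Longrightarrow> j \<in> I \<Longrightarrow> x \<in> simplex (E i) \<Longrightarrow> y \<in> simplex (E j) \<Longrightarrow>
          pt i x = pt j y \<longleftrightarrow>
          (\<exists>\<psi>. glue i j \<psi> (supp (E i) x) \<and> \<psi> ` supp (E i) x = supp (E j) y \<and> (\<forall>e\<in>supp (E i) x. y (\<psi> e) = x e))"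
    and glue_subset: "\<And>i j \<psi> S T. glue i j \<psi> S \<Longrightarrow> T \<subseteq> S \<Longrightarrow> T \<noteq> {} \<Longrightarrow> glue i j \<psi> T"
    and glue_bij: "\<And>i j \<psi> S. glue i j \<psi> S \<Longrightarrow> S \<subseteq> E i \<and> \<psi> ` S \<subseteq> E j \<and> inj_on \<psi> S"
    and glue_self: "\<And>i \<psi> S e. glue i i \<psi> S \<Longrightarrow> \<psi> ` S = S \<Longrightarrow> card S \<noteq> 2 \<Longrightarrow> e \<in> S \<Longrightarrow> \<psi> e = e"
begin

abbreviation "\<Delta> i \<equiv> simplex (E i)"
abbreviation "face_top i \<equiv> subtopology (real_space (E i))"

lemma ext: "x \<in> \<Delta> i \<Longrightarrow> x \<in> extensional (E i)"
  by (simp add: simplex_def)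

lemma pt_in: "i \<in> I \<Longrightarrow> x \<in> \<Delta> i \<Longrightarrow> pt i x \<in> topspace X"
  using topspace_X by blast

lemma continuous_pt:
  assumes i: "i \<in> I" and F: "F \<subseteq> \<Delta> i"
  shows "continuous_map (face_top i F) X (pt i)"
proof -
  have top: "topspace (face_top i (\<Delta> i)) = \<Delta> i"
    unfolding topspace_subtopology topspace_real_space using ext by blast
  have "continuous_map (face_top i (\<Delta> i)) X (pt i)"
    unfolding continuous_map_closedin top using i closedin_X pt_in by auto
  then show ?thesis
    using F by (rule continuous_map_from_subtopology_mono)
qed

text \<open>In simplex j, the points identified with a point of C form a finite union of closed
  sets, one for each gluing (S, \<psi>): points supported on the image of S whose transport back to
  simplex i lies in C.\<close>

lemma closedin_pt_image:
  assumes i: "i \<in> I" and C: "closedin (real_space (E i)) C" "C \<subseteq> \<Delta> i"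
  shows "closedin X (pt i ` C)"
  unfolding closedin_X
proof (intro conjI ballI)
  show "pt i ` C \<subseteq> topspace X" using C pt_in[OF i] by blast
  fix j assume j: "j \<in> I"
  define W where "W S \<psi> = {y \<in> extensional (E j). (\<forall>e\<in>E j - \<psi> ` S. y e = 0) \<and>
      (\<lambda>e\<in>E i. if e \<in> S then y (\<psi> e) else 0) \<in> C}" for S \<psi>
  have W: "closedin (real_space (E j)) (W S \<psi>)" if "glue i j \<psi> S" for S \<psi>
  proof -
    have \<psi>: "S \<subseteq> E i" "\<psi> ` S \<subseteq> E j" using glue_bij[OF that] by auto
    have "continuous_map (real_space (E j)) (subtopology (real_space (E i)) (extensional (E i)))
       (\<lambda>y. \<lambda>e\<in>E i. if e \<in> S then y (\<psi> e) else 0)"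
    proof (rule continuous_map_into_real_space)
      fix e assume e: "e \<in> E i"
      show "continuous_map (real_space (E j)) euclideanreal (\<lambda>y. (\<lambda>e\<in>E i. if e \<in> S then y (\<psi> e) else 0) e)"
      proof (cases "e \<in> S")
        case True
        then have "continuous_map (real_space (E j)) euclideanreal (\<lambda>y. y (\<psi> e))"
          using \<psi> by (intro continuous_map_real_space_component) auto
        then show ?thesis using True e by simp
      next
        case False
        then show ?thesis using e by simp
      qed
    qed auto
    then have "continuous_map (real_space (E j)) (real_space (E i)) (\<lambda>y. \<lambda>e\<in>E i. if e \<in> S then y (\<psi> e) else 0)"
      by (rule continuous_map_into_fulltopology)
    from closedin_continuous_map_preimage[OF this C(1)]
    have "closedin (real_space (E j)) {y \<in> extensional (E j). (\<lambda>e\<in>E i. if e \<in> S then y (\<psi> e) else 0) \<in> C}"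
      unfolding topspace_real_space .
    moreover have "closedin (real_space (E j)) {y \<in> extensional (E j). \<forall>e\<in>E j - \<psi> ` S. y e = 0}"
      by (rule closedin_vanish) auto
    ultimately have "closedin (real_space (E j)) ({y \<in> extensional (E j). (\<lambda>e\<in>E i. if e \<in> S then y (\<psi> e) else 0) \<in> C}
        \<inter> {y \<in> extensional (E j). \<forall>e\<in>E j - \<psi> ` S. y e = 0})"
      by (rule closedin_Int)
    also have "\<dots> = W S \<psi>" by (auto simp: W_def)
    finally show ?thesis .
  qed
  define \<W> where "\<W> = {W S \<psi> |S \<psi>. glue i j \<psi> S}"
  \<comment> \<open>Finiteness: \<open>W S \<psi>\<close> sees \<psi> only on S, and there are
    finitely many maps from subsets of \<open>E i\<close> to \<open>E j\<close>.\<close>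
  have "\<W> \<subseteq> (\<lambda>(S, \<psi>). W S \<psi>) ` (SIGMA S:Pow (E i). S \<rightarrow>\<^sub>E E j)"
  proof
    fix w assume "w \<in> \<W>"
    then obtain S \<psi> where w: "w = W S \<psi>" "glue i j \<psi> S" by (auto simp: \<W>_def)
    have "W S \<psi> = W S (restrict \<psi> S)"
      unfolding W_def by (simp cong: if_cong)
    moreover have "S \<subseteq> E i" "restrict \<psi> S \<in> S \<rightarrow>\<^sub>E E j"
      using glue_bij[OF w(2)] by auto
    ultimately show "w \<in> (\<lambda>(S, \<psi>). W S \<psi>) ` (SIGMA S:Pow (E i). S \<rightarrow>\<^sub>E E j)"
      using w(1) by (intro image_eqI[of _ _ "(S, restrict \<psi> S)"]) auto
  qed
  moreover have "finite (SIGMA S:Pow (E i). S \<rightarrow>\<^sub>E E j)"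
    using finE[OF i] finE[OF j] by (intro finite_SigmaI finite_PiE) (auto intro: finite_subset)
  ultimately have "finite \<W>" by (rule finite_surj[rotated])
  then have 1: "closedin (real_space (E j)) (\<Union>\<W>)"
    using W by (intro closedin_Union) (auto simp: \<W>_def)
  have 2: "{y \<in> \<Delta> j. pt j y \<in> pt i ` C} = \<Delta> j \<inter> \<Union>\<W>"
  proof (intro equalityI subsetI)
    fix y assume "y \<in> {y \<in> \<Delta> j. pt j y \<in> pt i ` C}"
    then obtain x where y: "y \<in> \<Delta> j" and x: "x \<in> C" "pt i x = pt j y" by auto
    then obtain \<psi> where \<psi>: "glue i j \<psi> (supp (E i) x)" "\<psi> ` supp (E i) x = supp (E j) y"
       "\<And>e. e \<in> supp (E i) x \<Longrightarrow> y (\<psi> e) = x e"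
      using pt_eq_iff[OF i j, of x y] C(2) by blast
    have "(\<lambda>e\<in>E i. if e \<in> supp (E i) x then y (\<psi> e) else 0) = x"
      using \<psi>(3) ext[of x i] x C by (auto simp: fun_eq_iff supp_def extensional_def)
    then have "y \<in> W (supp (E i) x) \<psi>"
      using x y ext \<psi>(2) by (auto simp: W_def supp_def)
    then show "y \<in> \<Delta> j \<inter> \<Union>\<W>" using y \<psi>(1) by (auto simp: \<W>_def)
  next
    fix y assume "y \<in> \<Delta> j \<inter> \<Union>\<W>"
    then obtain S \<psi> where y: "y \<in> \<Delta> j" "y \<in> W S \<psi>" and \<psi>: "glue i j \<psi> S" by (auto simp: \<W>_def)
    define x where "x = (\<lambda>e\<in>E i. if e \<in> S then y (\<psi> e) else 0)"
    have x: "x \<in> C" using y by (simp add: W_def x_def)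
    then have x\<Delta>: "x \<in> \<Delta> i" using C by auto
    have S: "S \<subseteq> E i" "\<psi> ` S \<subseteq> E j" using glue_bij[OF \<psi>] by auto
    have sx: "supp (E i) x = {e \<in> S. y (\<psi> e) \<noteq> 0}"
      using S by (auto simp: supp_def x_def)
    have "pt i x = pt j y"
      unfolding pt_eq_iff[OF i j x\<Delta> y(1)]
    proof (intro exI conjI ballI)
      \<comment> \<open>A point of \<open>W S \<psi>\<close> may have a support smaller than S, to
        which the gluing restricts.\<close>
      show "glue i j \<psi> (supp (E i) x)"
        using \<psi> by (rule glue_subset) (use sx supp_nonempty[OF x\<Delta>] in auto)
      have "y e = 0" if "e \<in> E j" "e \<notin> \<psi> ` S" for e
        using y(2) that by (simp add: W_def)
      then show "\<psi> ` supp (E i) x = supp (E j) y"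
        unfolding sx using S by (auto simp: supp_def)
      show "y (\<psi> e) = x e" if "e \<in> supp (E i) x" for e
        using that S unfolding sx by (auto simp: x_def)
    qed
    then have "pt j y \<in> pt i ` C" using x by (metis imageI)
    then show "y \<in> {y \<in> \<Delta> j. pt j y \<in> pt i ` C}" using y by simp
  qed
  show "closedin (face_top j (\<Delta> j)) {y \<in> \<Delta> j. pt j y \<in> pt i ` C}"
    unfolding 2 by (rule closedin_subtopology_Int_closed[OF 1])
qed

end

section \<open>Half faces and the push away from the barycentre\<close>

definition barycentre :: "'e set \<Rightarrow> 'e set \<Rightarrow> 'e \<Rightarrow> real" where
  "barycentre E S = (\<lambda>e\<in>E. if e \<in> S then 1 / real (card S) else 0)"

text \<open>For p = q the inequality is void and this is the whole closed face S; for S = {p, q}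
  with p and q distinct it is one half of an edge.\<close>

definition half_face :: "'e set \<Rightarrow> 'e set \<Rightarrow> 'e \<Rightarrow> 'e \<Rightarrow> ('e \<Rightarrow> real) set" where
  "half_face E S p q = {x \<in> simplex E. supp E x \<subseteq> S \<and> x p \<le> x q}"

text \<open>Radial projection from the barycentre as a homotopy: subtract t times the smallest
  coordinate of S and rescale to sum 1. At t = 1 some coordinate in S has become 0. The order of the
  coordinates in S is kept, so a half face is mapped to itself.\<close>

definition push_out :: "'e set \<Rightarrow> 'e set \<Rightarrow> real \<Rightarrow> ('e \<Rightarrow> real) \<Rightarrow> 'e \<Rightarrow> real" where
  "push_out E S t x =
     (\<lambda>e\<in>E. if e \<in> S then (x e - t * Min (x ` S)) / (1 - real (card S) * (t * Min (x ` S))) else 0)"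

context
  fixes E S :: "'e set"
  assumes E: "finite E" and S: "S \<subseteq> E" "S \<noteq> {}"
begin

lemma finS: "finite S" using S E finite_subset by blast

lemma card_S_pos: "0 < card S" using finS S by (simp add: card_gt_0_iff)

lemma sum_vanishing_outside:
  assumes "\<And>e. e \<in> E - S \<Longrightarrow> x e = (0::real)"
  shows "(\<Sum>e\<in>E. x e) = (\<Sum>e\<in>S. x e)"
  using assms E S by (intro sum.mono_neutral_right) auto

lemma barycentre_in_simplex: "barycentre E S \<in> simplex E"
proof -
  have "(\<Sum>e\<in>E. barycentre E S e) = (\<Sum>e\<in>S. barycentre E S e)"
    by (rule sum_vanishing_outside) (auto simp: barycentre_def)
  also have "\<dots> = (\<Sum>e\<in>S. 1 / real (card S))"
    using S by (intro sum.cong) (auto simp: barycentre_def)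
  also have "\<dots> = 1" using card_S_pos by simp
  finally show ?thesis by (simp add: simplex_def) (auto simp: barycentre_def)
qed

lemma supp_barycentre: "supp E (barycentre E S) = S"
  using S card_S_pos by (auto simp: supp_def barycentre_def)

lemma barycentre_in_half_face: "p \<in> S \<Longrightarrow> q \<in> S \<Longrightarrow> barycentre E S \<in> half_face E S p q"
  using S barycentre_in_simplex supp_barycentre by (auto simp: half_face_def barycentre_def)

lemma half_faceD:
  assumes "x \<in> half_face E S p q"
  shows "x \<in> extensional E" "\<And>e. e \<in> E \<Longrightarrow> 0 \<le> x e" "\<And>e. e \<in> E - S \<Longrightarrow> x e = 0" "(\<Sum>e\<in>S. x e) = 1"
    "x p \<le> x q"
proof -
  show *: "x e = 0" if "e \<in> E - S" for e
    using assms that by (auto simp: half_face_def supp_def)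
  show "(\<Sum>e\<in>S. x e) = 1"
    using assms sum_vanishing_outside[of x, OF *] by (simp add: half_face_def simplex_def)
qed (use assms in \<open>auto simp: half_face_def simplex_def\<close>)

lemma half_faceI:
  assumes "x \<in> extensional E" "\<And>e. e \<in> S \<Longrightarrow> 0 \<le> x e" "\<And>e. e \<in> E - S \<Longrightarrow> x e = 0" "(\<Sum>e\<in>S. x e) = 1"
    "x p \<le> x q"
  shows "x \<in> half_face E S p q"
proof -
  have "0 \<le> x e" if "e \<in> E" for e using assms(2,3) that by (cases "e \<in> S") auto
  then show ?thesis
    using assms sum_vanishing_outside[of x] by (auto simp: half_face_def simplex_def supp_def)
qed

lemma min_le: "e \<in> S \<Longrightarrow> Min (x ` S) \<le> (x e :: real)"
  using finS by simp

lemma min_attained: "\<exists>e\<in>S. x e = (Min (x ` S) :: real)"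
proof -
  have "Min (x ` S) \<in> x ` S" using finS S by (intro Min_in) auto
  then show ?thesis by auto
qed

lemma min_nonneg: "x \<in> half_face E S p q \<Longrightarrow> 0 \<le> Min (x ` S)"
  using min_attained[of x] half_faceD(2)[of x p q] S by (metis subsetD)

lemma constant_imp_barycentre:
  assumes x: "x \<in> half_face E S p q" and c: "\<And>e. e \<in> S \<Longrightarrow> x e = c"
  shows "x = barycentre E S"
proof
  fix e
  have "real (card S) * c = 1" using half_faceD(4)[OF x] c by simp
  then have "c = 1 / real (card S)" using card_S_pos by (simp add: field_simps)
  then show "x e = barycentre E S e"
    using half_faceD(1,3)[OF x] c S by (auto simp: barycentre_def extensional_def)
qed

text \<open>The minimum of the coordinates is at most their mean 1 / card S, with equality only if
  they all agree.\<close>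

lemma card_mult_min_less:
  assumes x: "x \<in> half_face E S p q" "x \<noteq> barycentre E S"
  shows "real (card S) * Min (x ` S) < 1"
proof (rule ccontr)
  assume "\<not> real (card S) * Min (x ` S) < 1"
  then have "(\<Sum>e\<in>S. x e - Min (x ` S)) \<le> 0"
    using half_faceD(4)[OF x(1)] by (simp add: sum_subtractf)
  moreover have nn: "\<And>e. e \<in> S \<Longrightarrow> 0 \<le> x e - Min (x ` S)" using min_le[of _ x] by simp
  ultimately have "(\<Sum>e\<in>S. x e - Min (x ` S)) = 0" by (meson antisym sum_nonneg)
  then have "\<forall>e\<in>S. x e - Min (x ` S) = 0"
    using nn finS by (subst (asm) sum_nonneg_eq_0_iff) auto
  then have "x = barycentre E S"
    using x(1) by (intro constant_imp_barycentre[of x p q "Min (x ` S)"]) auto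
  then show False using x(2) by simp
qed

lemma push_out_denominator:
  assumes x: "x \<in> half_face E S p q" "x \<noteq> barycentre E S" and t: "0 \<le> t" "t \<le> 1"
  shows "0 < 1 - real (card S) * (t * Min (x ` S))"
proof -
  have "real (card S) * (t * Min (x ` S)) \<le> real (card S) * (1 * Min (x ` S))"
    using t min_nonneg[OF x(1)] by (intro mult_left_mono mult_right_mono) auto
  also have "\<dots> < 1" using card_mult_min_less[OF x] by simp
  finally show ?thesis by simp
qed

lemma push_out_in_half_face:
  assumes x: "x \<in> half_face E S p q" "x \<noteq> barycentre E S" and t: "0 \<le> t" "t \<le> 1"
    and pq: "p \<in> S" "q \<in> S"
  shows "push_out E S t x \<in> half_face E S p q" "push_out E S t x \<noteq> barycentre E S"
proof -
  let ?m = "t * Min (x ` S)" and ?d = "1 - real (card S) * (t * Min (x ` S))"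
  have d: "0 < ?d" by (rule push_out_denominator[OF x t])
  have eq: "push_out E S t x e = (x e - ?m) / ?d" if "e \<in> S" for e
    using that S by (auto simp: push_out_def)
  have tm: "?m \<le> x e" if "e \<in> S" for e
  proof -
    have "?m \<le> 1 * Min (x ` S)" using t min_nonneg[OF x(1)] by (intro mult_right_mono) auto
    then show ?thesis using min_le[OF that, of x] by simp
  qed
  show in_face: "push_out E S t x \<in> half_face E S p q"
  proof (rule half_faceI)
    show "0 \<le> push_out E S t x e" if "e \<in> S" for e
      using eq[OF that] tm[OF that] d by simp
    have "(\<Sum>e\<in>S. push_out E S t x e) = (\<Sum>e\<in>S. x e - ?m) / ?d"
      using eq by (simp add: sum_divide_distrib)
    also have "(\<Sum>e\<in>S. x e - ?m) = ?d"
      using half_faceD(4)[OF x(1)] by (simp add: sum_subtractf)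
    finally show "(\<Sum>e\<in>S. push_out E S t x e) = 1" using d by simp
    show "push_out E S t x p \<le> push_out E S t x q"
      using eq pq half_faceD(5)[OF x(1)] d by (simp add: divide_right_mono)
  qed (auto simp: push_out_def)
  show "push_out E S t x \<noteq> barycentre E S"
  proof
    assume eqb: "push_out E S t x = barycentre E S"
    \<comment> \<open>Undoing the rescaling: a point sent to the barycentre has equal coordinates on
      S and so was the barycentre already.\<close>
    have "x e = ?d / card S + ?m" if "e \<in> S" for e
    proof -
      have "(x e - ?m) / ?d = 1 / real (card S)"
        using eq[OF that] fun_cong[OF eqb, of e] that S by (auto simp: barycentre_def)
      then have "x e - ?m = ?d * (1 / real (card S))"
        using d by (metis less_irrefl mult.commute nonzero_eq_divide_eq)
      then show ?thesis by simp
    qed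
    then show False using constant_imp_barycentre[OF x(1)] x(2) by blast
  qed
qed

lemma push_out_0: "x \<in> half_face E S p q \<Longrightarrow> push_out E S 0 x = x"
  using half_faceD(1,3)[of x p q] by (auto simp: push_out_def fun_eq_iff extensional_def)

lemma supp_push_out_1: "supp E (push_out E S 1 x) \<noteq> S"
proof -
  obtain e where e: "e \<in> S" "x e = Min (x ` S)" using min_attained[of x] by blast
  then have "push_out E S 1 x e = 0" using S by (auto simp: push_out_def)
  then have "e \<notin> supp E (push_out E S 1 x)" by (simp add: supp_def)
  then show ?thesis using e(1) by blast
qed

text \<open>On the boundary of the face the minimum over S is 0, so nothing is subtracted.\<close>

lemma push_out_boundary:
  assumes x: "x \<in> half_face E S p q" and s: "supp E x \<noteq> S"
  shows "push_out E S t x = x"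
proof -
  have "supp E x \<subseteq> S" using x by (simp add: half_face_def)
  then obtain e where "e \<in> S" "e \<notin> supp E x" using s by blast
  then have "e \<in> S" "x e = 0" using S by (auto simp: supp_def)
  then have "Min (x ` S) = 0"
    using min_le[of e x] min_nonneg[OF x] by simp
  then show ?thesis
    using half_faceD(1,3)[OF x] by (auto simp: push_out_def fun_eq_iff extensional_def)
qed

lemma closedin_half_face:
  assumes "p \<in> S" "q \<in> S"
  shows "closedin (real_space E) (half_face E S p q)"
proof -
  have "half_face E S p q = simplex E \<inter> ({x \<in> extensional E. \<forall>e\<in>E - S. x e = 0} \<inter> {x \<in> extensional E. x p \<le> x q})"
    by (auto simp: half_face_def simplex_def supp_def)
  moreover have "closedin (real_space E) {x \<in> extensional E. x p \<le> x q}"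
    using assms S by (intro closedin_real_space_le continuous_map_real_space_component) auto
  ultimately show ?thesis
    using closedin_simplex closedin_vanish[of "E - S" E] by auto
qed

text \<open>The formula is a quotient whose denominator can vanish only at the barycentre, and that
  point has been removed.\<close>

lemma continuous_push_out:
  assumes pq: "p \<in> S" "q \<in> S"
  defines "D \<equiv> subtopology (real_space E) (half_face E S p q)"
  defines "D0 \<equiv> subtopology D (topspace D - {barycentre E S})"
  shows "continuous_map (prod_topology (top_of_set {0..1::real}) D0) D0 (\<lambda>(t, x). push_out E S t x)"
proof -
  let ?F = "half_face E S p q - {barycentre E S}"
  let ?Y = "prod_topology (top_of_set {0..1::real}) D0"
  have ext: "half_face E S p q \<subseteq> extensional E" using half_faceD(1) by blast
  then have topD: "topspace D = half_face E S p q"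
    unfolding D_def topspace_subtopology topspace_real_space by blast
  have D0: "D0 = subtopology (real_space E) ?F"
    unfolding D0_def topD unfolding D_def by (simp add: subtopology_subtopology Int_absorb1)
  have topY: "topspace ?Y = {0..1} \<times> ?F"
    unfolding D0 topspace_prod_topology topspace_subtopology topspace_real_space using ext by auto
  have cfst: "continuous_map ?Y euclideanreal fst"
    by (rule continuous_map_into_fulltopology[OF continuous_map_fst])
  have csnd: "continuous_map ?Y (real_space E) snd"
    using continuous_map_snd[of "top_of_set {0..1::real}" D0] unfolding D0
    by (rule continuous_map_into_fulltopology)
  have comp: "continuous_map ?Y euclideanreal (\<lambda>z. snd z e)" if "e \<in> E" for e
    using continuous_map_compose[OF csnd continuous_map_real_space_component[OF that]] by (simp add: o_def)
  have cmin: "continuous_map ?Y euclideanreal (\<lambda>z. Min (snd z ` S))"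
    using S by (intro continuous_map_Min finS comp) auto
  show ?thesis
    unfolding D0
  proof (rule continuous_map_into_real_space, unfold D0[symmetric])
    show "?F \<subseteq> extensional E" using ext by blast
    show "(case z of (t, x) \<Rightarrow> push_out E S t x) \<in> ?F" if "z \<in> topspace ?Y" for z
      using that push_out_in_half_face[OF _ _ _ _ pq] unfolding topY by auto
    fix e assume e: "e \<in> E"
    show "continuous_map ?Y euclideanreal (\<lambda>z. (case z of (t, x) \<Rightarrow> push_out E S t x) e)"
    proof (cases "e \<in> S")
      case True
      have "continuous_map ?Y euclideanreal
          (\<lambda>z. (snd z e - fst z * Min (snd z ` S)) / (1 - real (card S) * (fst z * Min (snd z ` S))))"
      proof (intro continuous_map_real_divide continuous_intros cfst cmin comp e)
        fix z assume "z \<in> topspace ?Y"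
        then show "1 - real (card S) * (fst z * Min (snd z ` S)) \<noteq> 0"
          using push_out_denominator[of "snd z" p q "fst z"] unfolding topY by auto
      qed simp_all
      then show ?thesis using True e by (simp add: push_out_def split_beta)
    next
      case False
      then show ?thesis using e by (simp add: push_out_def split_beta)
    qed
  qed
qed

text \<open>On a half face, having support S means that all coordinates in S are positive, which is
  a convex condition.\<close>

lemma convex_in_open_half_face:
  assumes pq: "p \<in> S" "q \<in> S"
  shows "convex_in E {x \<in> half_face E S p q. supp E x = S}"
  unfolding convex_in_def
proof (intro conjI ballI)
  show "{x \<in> half_face E S p q. supp E x = S} \<subseteq> extensional E" using half_faceD(1) by blast
  fix x y and t :: real
  assume "x \<in> {x \<in> half_face E S p q. supp E x = S}" "y \<in> {x \<in> half_face E S p q. supp E x = S}"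
    and t: "t \<in> {0..1}"
  then have x: "x \<in> half_face E S p q" "supp E x = S" and y: "y \<in> half_face E S p q" "supp E y = S" by auto
  let ?z = "\<lambda>e\<in>E. (1 - t) * x e + t * y e"
  have pos: "0 < x e" "0 < y e" if "e \<in> S" for e
    using that S half_faceD(2)[OF x(1), of e] half_faceD(2)[OF y(1), of e] x(2) y(2)
    by (auto simp: supp_def less_le)
  have z: "0 < ?z e" if "e \<in> S" for e
  proof (cases "t = 0")
    case True
    then show ?thesis using that S pos by auto
  next
    case False
    then have "0 \<le> (1 - t) * x e" "0 < t * y e" using t pos[OF that] by auto
    then have "0 < (1 - t) * x e + t * y e" by linarith
    then show ?thesis using that S by auto
  qed
  have z0: "?z e = 0" if "e \<in> E - S" for e
    using that half_faceD(3)[OF x(1)] half_faceD(3)[OF y(1)] by simp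
  have "?z \<in> half_face E S p q"
  proof (rule half_faceI[OF _ _ z0])
    show "0 \<le> ?z e" if "e \<in> S" for e using z[OF that] by simp
    have "(\<Sum>e\<in>S. ?z e) = (\<Sum>e\<in>S. (1 - t) * x e + t * y e)" using S by (intro sum.cong) auto
    also have "\<dots> = (1 - t) * (\<Sum>e\<in>S. x e) + t * (\<Sum>e\<in>S. y e)"
      by (simp only: sum.distrib sum_distrib_left)
    finally show "(\<Sum>e\<in>S. ?z e) = 1"
      using half_faceD(4)[OF x(1)] half_faceD(4)[OF y(1)] by simp
    have "(1 - t) * x p + t * y p \<le> (1 - t) * x q + t * y q"
      using half_faceD(5)[OF x(1)] half_faceD(5)[OF y(1)] t by (intro add_mono mult_left_mono) auto
    then show "?z p \<le> ?z q" using pq S by auto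
  qed (rule restrict_extensional)
  moreover have "supp E ?z = S"
    using z z0 S by (force simp: supp_def)
  ultimately show "?z \<in> {x \<in> half_face E S p q. supp E x = S}" by simp
qed

text \<open>Since the coordinates sum to 1, a point differs from the barycentre exactly if some
  coordinate in S is below 1 / card S. These half spaces form the open convex cover behind the
  second bound.\<close>

lemma rank_le_homology_open_half_face:
  assumes pq: "p \<in> S" "q \<in> S"
  shows "rank_le (homology_group r (subtopology (real_space E) {x \<in> half_face E S p q. supp E x = S})) 1"
    and "rank_le (homology_group r (subtopology (real_space E)
            ({x \<in> half_face E S p q. supp E x = S} - {barycentre E S}))) (2 ^ card S - 1)"
proof -
  let ?K = "{x \<in> half_face E S p q. supp E x = S}"
  let ?U = "\<lambda>e. {x \<in> extensional E. x e < 1 / real (card S)}"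
  have K: "convex_in E ?K" by (rule convex_in_open_half_face[OF pq])
  then show "rank_le (homology_group r (subtopology (real_space E) ?K)) 1"
    by (rule rank_le_homology_contractible[OF convex_in_contractible])
  have op: "openin (real_space E) (?U e)" if "e \<in> S" for e
    using that S by (intro openin_real_space_less continuous_map_real_space_component) auto
  have conv: "convex_in E (?U e)" if "e \<in> S" for e
    unfolding convex_in_def
  proof (intro conjI ballI)
    fix x y and t :: real assume x: "x \<in> ?U e" and y: "y \<in> ?U e" and t: "t \<in> {0..1}"
    have "(1 - t) * x e + t * y e < 1 / real (card S)"
      using convex_bound_lt[of "x e" "1 / real (card S)" "y e" "1 - t" t] x y t by simp
    then show "(\<lambda>e\<in>E. (1 - t) * x e + t * y e) \<in> ?U e" using that S by auto
  qed blast
  have "?K \<inter> (\<Union>e\<in>S. ?U e) = ?K - {barycentre E S}"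
  proof (intro equalityI subsetI)
    fix x assume x: "x \<in> ?K - {barycentre E S}"
    then have "real (card S) * Min (x ` S) < 1" using card_mult_min_less by blast
    then have "Min (x ` S) < 1 / real (card S)" using card_S_pos by (simp add: field_simps)
    moreover obtain e where "e \<in> S" "x e = Min (x ` S)" using min_attained[of x] by blast
    ultimately have "x e < 1 / real (card S)" "e \<in> S" by simp_all
    then show "x \<in> ?K \<inter> (\<Union>e\<in>S. ?U e)" using x half_faceD(1) by blast
  next
    fix x assume "x \<in> ?K \<inter> (\<Union>e\<in>S. ?U e)"
    then obtain e where x: "x \<in> ?K" "e \<in> S" "x e < 1 / real (card S)" by blast
    then have "x e \<noteq> barycentre E S e" using S by (auto simp: barycentre_def)
    then show "x \<in> ?K - {barycentre E S}" using x(1) by auto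
  qed
  then show "rank_le (homology_group r (subtopology (real_space E) (?K - {barycentre E S}))) (2 ^ card S - 1)"
    using rank_le_homology_Union_convex[OF finS K, of ?U r] op conv by simp
qed

end

lemma t1_space_real_space: "t1_space (real_space E)"
  by (simp add: t1_space_product_topology Hausdorff_imp_t1_space)

section \<open>Cells of a glued complex\<close>

context glued_simplices
begin

text \<open>The image of an open face. Different pairs (i, S) may have the same image; the pairs are
  only names of cells.\<close>

definition cell :: "'i \<times> 'e set \<Rightarrow> 'x set" where
  "cell = (\<lambda>(i, S). pt i ` {x \<in> \<Delta> i. supp (E i) x = S})"

definition faces :: "('i \<times> 'e set) set" where
  "faces = (SIGMA i:I. Pow (E i) - {{}})"

lemma facesD: "(i, S) \<in> faces \<Longrightarrow> i \<in> I \<and> S \<subseteq> E i \<and> S \<noteq> {}"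
  by (simp add: faces_def)

lemma in_cell: "x \<in> \<Delta> i \<Longrightarrow> pt i x \<in> cell (i, supp (E i) x)"
  by (auto simp: cell_def)

lemma supp_face: "i \<in> I \<Longrightarrow> x \<in> \<Delta> i \<Longrightarrow> (i, supp (E i) x) \<in> faces"
  using supp_nonempty[of x "E i"] by (auto simp: faces_def supp_def)

lemma cell_nonempty: "(i, S) \<in> faces \<Longrightarrow> \<exists>x\<in>\<Delta> i. supp (E i) x = S"
  using barycentre_in_simplex[of "E i" S] supp_barycentre[of "E i" S] facesD finE by blast

text \<open>A single common point yields a gluing of the two supports, and the same gluing
  transports every point of the open face. Hence cells that meet coincide.\<close>

lemma cell_subset_of_pt_eq:
  assumes i: "i \<in> I" and j: "j \<in> I" and x: "x \<in> \<Delta> i" and y: "y \<in> \<Delta> j" and eq: "pt i x = pt j y"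
  shows "cell (i, supp (E i) x) \<subseteq> cell (j, supp (E j) y)" "card (supp (E i) x) = card (supp (E j) y)"
proof -
  let ?S = "supp (E i) x" and ?T = "supp (E j) y"
  obtain \<psi> where \<psi>: "glue i j \<psi> ?S" "\<psi> ` ?S = ?T"
    using pt_eq_iff[OF i j x y] eq by blast
  have bij: "inj_on \<psi> ?S" and T: "?T \<subseteq> E j" "?S \<subseteq> E i"
    using glue_bij[OF \<psi>(1)] by (auto simp: supp_def)
  then show "card ?S = card ?T" using \<psi>(2) card_image by metis
  show "cell (i, ?S) \<subseteq> cell (j, ?T)"
  proof
    fix w assume "w \<in> cell (i, ?S)"
    then obtain z where z: "z \<in> \<Delta> i" "supp (E i) z = ?S" and w: "w = pt i z"
      unfolding cell_def by auto
    \<comment> \<open>The coordinates of z moved along \<psi>, with 0 elsewhere.\<close>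
    define u where "u = (\<lambda>e\<in>E j. if e \<in> ?T then z (inv_into ?S \<psi> e) else 0)"
    have u\<psi>: "u (\<psi> e) = z e" if "e \<in> ?S" for e
    proof -
      have "\<psi> e \<in> ?T" using \<psi>(2) that by blast
      then show ?thesis using T that bij by (auto simp: u_def inv_into_f_f)
    qed
    have "(\<Sum>e\<in>E j. u e) = (\<Sum>e\<in>?T. u e)"
      using T finE[OF j] by (intro sum.mono_neutral_right) (auto simp: u_def)
    also have "\<dots> = (\<Sum>e\<in>?S. u (\<psi> e))"
      unfolding \<psi>(2)[symmetric] using bij by (simp add: sum.reindex)
    also have "\<dots> = (\<Sum>e\<in>?S. z e)" using u\<psi> by simp
    also have "\<dots> = (\<Sum>e\<in>E i. z e)"
      using T finE[OF i] z(2) by (intro sum.mono_neutral_left) (auto simp: supp_def)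
    finally have 1: "(\<Sum>e\<in>E j. u e) = 1" using z(1) by (simp add: simplex_def)
    have "0 \<le> u e \<and> (u e \<noteq> 0 \<longleftrightarrow> e \<in> ?T)" if "e \<in> E j" for e
    proof (cases "e \<in> ?T")
      case True
      then obtain e' where e': "e = \<psi> e'" "e' \<in> ?S" using \<psi>(2) by (metis imageE)
      then have "e' \<in> supp (E i) z" using z(2) by simp
      then have "z e' \<noteq> 0" "0 \<le> z e'" using z(1) by (auto simp: supp_def simplex_def)
      then show ?thesis using u\<psi>[OF e'(2)] e'(1) True by simp
    next
      case False
      then show ?thesis using that by (simp add: u_def)
    qed
    then have u: "u \<in> \<Delta> j" "supp (E j) u = ?T"
      using 1 T by (auto simp: simplex_def supp_def u_def)
    have "pt i z = pt j u"
      unfolding pt_eq_iff[OF i j z(1) u(1)] z(2) u(2)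
      using \<psi> u\<psi> by (intro exI[of _ \<psi>]) simp
    then show "w \<in> cell (j, ?T)"
      unfolding w using in_cell[OF u(1)] u(2) by simp
  qed
qed

lemma cell_eq_of_pt_in:
  assumes f: "f \<in> faces" and g: "g \<in> faces" and z: "z \<in> cell f" "z \<in> cell g"
  shows "cell f = cell g" "card (snd f) = card (snd g)"
proof -
  obtain i S j T where fg: "f = (i, S)" "g = (j, T)" by (cases f, cases g)
  obtain x y where "x \<in> \<Delta> i" "supp (E i) x = S" "z = pt i x" "y \<in> \<Delta> j" "supp (E j) y = T" "z = pt j y"
    using z unfolding fg cell_def by auto
  then show "cell f = cell g" "card (snd f) = card (snd g)"
    using cell_subset_of_pt_eq[of i j x y] cell_subset_of_pt_eq[of j i y x] facesD f g
    unfolding fg by auto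
qed

lemma card_eq_of_cell_eq:
  assumes "f \<in> faces" "g \<in> faces" "cell f = cell g"
  shows "card (snd f) = card (snd g)"
proof -
  obtain i S where f: "f = (i, S)" by (cases f)
  obtain x where "x \<in> \<Delta> i" "supp (E i) x = S" using cell_nonempty[of i S] assms(1) f by blast
  then have "pt i x \<in> cell f" using in_cell[of x i] f by simp
  then show ?thesis using cell_eq_of_pt_in(2)[OF assms(1,2)] assms(3) by simp
qed

definition closed_face :: "'i \<times> 'e set \<Rightarrow> ('e \<Rightarrow> real) set" where
  "closed_face = (\<lambda>(i, S). {x \<in> \<Delta> i. supp (E i) x \<subseteq> S})"

lemma closedin_closed_face:
  assumes "i \<in> I"
  shows "closedin X (pt i ` closed_face (i, S))"
proof (rule closedin_pt_image[OF assms])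
  have "closed_face (i, S) = \<Delta> i \<inter> {x \<in> extensional (E i). \<forall>e\<in>E i - S. x e = 0}"
    by (auto simp: closed_face_def supp_def simplex_def)
  then show "closedin (real_space (E i)) (closed_face (i, S))"
    using closedin_simplex closedin_vanish[of "E i - S" "E i"] by auto
qed (auto simp: closed_face_def)

text \<open>Identification of a one-dimensional cell with itself may reverse it; hence in dimension one
  the cell is parametrized by one half of an edge.\<close>

lemma half_parametrization:
  assumes i: "i \<in> I" and S: "S \<subseteq> E i" "S \<noteq> {}"
  shows "\<exists>p\<in>S. \<exists>q\<in>S. inj_on (pt i) {x \<in> half_face (E i) S p q. supp (E i) x = S} \<and>
     cell (i, S) \<subseteq> pt i ` half_face (E i) S p q"
proof (cases "inj_on (pt i) {x \<in> \<Delta> i. supp (E i) x = S}")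
  case True
  obtain p where "p \<in> S" using S by blast
  moreover have "cell (i, S) \<subseteq> pt i ` half_face (E i) S p p"
    by (auto simp: cell_def half_face_def)
  moreover have "inj_on (pt i) {x \<in> half_face (E i) S p p. supp (E i) x = S}"
    using True by (rule inj_on_subset) (auto simp: half_face_def)
  ultimately show ?thesis by (intro bexI[of _ p] conjI)
next
  case False
  then obtain x y where x: "x \<in> \<Delta> i" "supp (E i) x = S" and y: "y \<in> \<Delta> i" "supp (E i) y = S"
    and xy: "pt i x = pt i y" "x \<noteq> y"
    unfolding inj_on_def by blast
  obtain \<psi> where \<psi>: "glue i i \<psi> S" "\<psi> ` S = S" "\<And>e. e \<in> S \<Longrightarrow> y (\<psi> e) = x e"
    using pt_eq_iff[OF i i x(1) y(1)] xy(1) x(2) y(2) by auto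
  have off: "z e = 0" if "z \<in> \<Delta> i" "supp (E i) z = S" "e \<in> E i - S" for z e
    using that by (auto simp: supp_def)
  have eqI: "z = w" if "z \<in> \<Delta> i" "supp (E i) z = S" "w \<in> \<Delta> i" "supp (E i) w = S" "\<And>e. e \<in> S \<Longrightarrow> z e = w e" for z w :: "'e \<Rightarrow> real"
  proof (rule extensionalityI)
    show "z \<in> extensional (E i)" "w \<in> extensional (E i)" using that ext by auto
    show "z e = w e" if "e \<in> E i" for e
    proof (cases "e \<in> S")
      case True
      then show ?thesis by (rule \<open>\<And>e. e \<in> S \<Longrightarrow> z e = w e\<close>)
    next
      case False
      then have "e \<in> E i - S" using that by blast
      then show ?thesis
        using off[OF \<open>z \<in> \<Delta> i\<close> \<open>supp (E i) z = S\<close>] off[OF \<open>w \<in> \<Delta> i\<close> \<open>supp (E i) w = S\<close>] by simp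
    qed
  qed
  \<comment> \<open>If \<psi> fixed S pointwise, x and y would have the same coordinates.\<close>
  have "\<exists>p\<in>S. \<psi> p \<noteq> p"
  proof (rule ccontr)
    assume "\<not> ?thesis"
    then have "x = y" using \<psi>(3) x y by (intro eqI) auto
    then show False using xy by simp
  qed
  then obtain p where p: "p \<in> S" "\<psi> p \<noteq> p" by blast
  define q where "q = \<psi> p"
  have q: "q \<in> S" "q \<noteq> p" using p \<psi>(2) by (auto simp: q_def)
  \<comment> \<open>A nontrivial gluing of S to itself forces S = {p, q}, and then \<psi> swaps p
    and q.\<close>
  have "card S = 2" using glue_self[OF \<psi>(1,2)] p by blast
  then have Spq: "S = {p, q}"
    using p q by (auto simp: card_2_iff)
  have "inj_on \<psi> S" using glue_bij[OF \<psi>(1)] by blast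
  then have "\<psi> q \<noteq> q"
    using inj_onD[of \<psi> S q p] p q unfolding q_def by blast
  moreover have "\<psi> q \<in> {p, q}" using \<psi>(2) q(1) Spq by blast
  ultimately have \<psi>q: "\<psi> q = p" by blast
  have inS: "half_face (E i) S p q \<subseteq> \<Delta> i" by (auto simp: half_face_def)
  have "inj_on (pt i) {x \<in> half_face (E i) S p q. supp (E i) x = S}"
  proof (rule inj_onI)
    fix z w assume "z \<in> {x \<in> half_face (E i) S p q. supp (E i) x = S}"
      and "w \<in> {x \<in> half_face (E i) S p q. supp (E i) x = S}" and eq: "pt i z = pt i w"
    then have z: "z \<in> \<Delta> i" "supp (E i) z = S" "z p \<le> z q" and w: "w \<in> \<Delta> i" "supp (E i) w = S" "w p \<le> w q"
      by (auto simp: half_face_def)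
    obtain \<theta> where \<theta>: "glue i i \<theta> S" "\<theta> ` S = S" "\<And>e. e \<in> S \<Longrightarrow> w (\<theta> e) = z e"
      using pt_eq_iff[OF i i z(1) w(1)] eq z(2) w(2) by auto
    have "inj_on \<theta> S" using glue_bij[OF \<theta>(1)] by blast
    then have "\<theta> p \<noteq> \<theta> q" using inj_onD[of \<theta> S p q] p(1) q by blast
    moreover have "\<theta> p \<in> {p, q}" "\<theta> q \<in> {p, q}" using \<theta>(2) unfolding Spq by auto
    \<comment> \<open>Either \<theta> fixes p and q, or it swaps them; in the second case z p = w q
      >= w p = z q >= z p, so all four numbers are equal.\<close>
    ultimately have "z p = w p \<and> z q = w q"
      using \<theta>(3)[OF p(1)] \<theta>(3)[OF q(1)] z(3) w(3) by auto
    then show "z = w" using z w by (intro eqI) (auto simp: Spq)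
  qed
  moreover have "cell (i, S) \<subseteq> pt i ` half_face (E i) S p q"
  proof
    fix u assume "u \<in> cell (i, S)"
    then obtain z where z: "z \<in> \<Delta> i" "supp (E i) z = S" "u = pt i z" by (auto simp: cell_def)
    show "u \<in> pt i ` half_face (E i) S p q"
    proof (cases "z p \<le> z q")
      case True
      then show ?thesis using z by (auto simp: half_face_def)
    next
      case False
      \<comment> \<open>A point in the wrong half is identified by \<psi> with its mirror image,
        which lies in the right one.\<close>
      define w where "w = z(p := z q, q := z p)"
      have pqE: "p \<in> E i" "q \<in> E i" using Spq S by auto
      have "(\<Sum>e\<in>E i. w e) = (\<Sum>e\<in>S. w e)"
        using S finE[OF i] off[OF z(1,2)] Spq by (intro sum.mono_neutral_right) (auto simp: w_def)
      also have "\<dots> = (\<Sum>e\<in>S. z e)" using q by (simp add: Spq w_def)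
      also have "\<dots> = (\<Sum>e\<in>E i. z e)"
        using S finE[OF i] off[OF z(1,2)] by (intro sum.mono_neutral_left) auto
      finally have w: "w \<in> \<Delta> i"
        using z(1) pqE by (auto simp: simplex_def w_def extensional_def)
      have "z p \<noteq> 0" "z q \<noteq> 0" using z(2) Spq by (auto simp: supp_def)
      then have sw: "supp (E i) w = S"
        using z(2) q pqE by (auto simp: supp_def w_def Spq)
      have "pt i z = pt i w"
        unfolding pt_eq_iff[OF i i z(1) w] z(2) sw
        using \<psi>(1,2) \<psi>q q by (intro exI[of _ \<psi>]) (auto simp: Spq w_def simp flip: q_def)
      then show ?thesis
        using z(3) w sw False q by (intro image_eqI[of _ _ w]) (auto simp: half_face_def w_def)
    qed
  qed
  ultimately show ?thesis using p(1) q(1) by (intro bexI[of _ p] bexI[of _ q] conjI)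
qed

text \<open>A point of X is the image of a closed point of a simplex. The T1 property is what makes
  closed maps from compact spaces to X proper.\<close>

lemma t1_space_X: "t1_space X"
proof -
  have "closedin X {z}" if "z \<in> topspace X" for z
  proof -
    obtain i x where z: "i \<in> I" "x \<in> \<Delta> i" "z = pt i x" using \<open>z \<in> topspace X\<close> topspace_X by auto
    have "x \<in> topspace (real_space (E i))"
      unfolding topspace_real_space using z(2) by (rule ext)
    then have "closedin (real_space (E i)) {x}"
      by (rule closedin_t1_singleton[OF t1_space_real_space])
    then have "closedin X (pt i ` {x})" using z by (intro closedin_pt_image) auto
    then show ?thesis using z by simp
  qed
  then show ?thesis by (simp add: t1_space_closedin_singleton)
qed

text \<open>The model of the cell is a closed half face with the push away from its barycentre as
  homotopy. With k = card S the cost is 1 for the open half face plus 2^k - 1 for it without the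
  barycentre.\<close>

lemma rank_le_homology_remove_cell:
  assumes A: "closedin X A" and f: "(i, S) \<in> faces" and disj: "cell (i, S) \<inter> A = {}"
    and boundary: "\<And>x. x \<in> \<Delta> i \<Longrightarrow> supp (E i) x \<subset> S \<Longrightarrow> pt i x \<in> A"
    and r: "rank_le (homology_group p (subtopology X A)) n"
  shows "rank_le (homology_group p (subtopology X (A \<union> cell (i, S)))) (n + 2 ^ card S)"
proof -
  have i: "i \<in> I" and S: "S \<subseteq> E i" "S \<noteq> {}" using facesD[OF f] by auto
  note finEi = finE[OF i]
  obtain e e' where e: "e \<in> S" "e' \<in> S"
    and inj: "inj_on (pt i) {x \<in> half_face (E i) S e e'. supp (E i) x = S}"
    and cover: "cell (i, S) \<subseteq> pt i ` half_face (E i) S e e'"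
    using half_parametrization[OF i S] by blast
  let ?F = "half_face (E i) S e e'"
  let ?Y = "A \<union> cell (i, S)"
  let ?D = "face_top i ?F"
  have F\<Delta>: "?F \<subseteq> \<Delta> i" by (auto simp: half_face_def)
  have topD: "topspace ?D = ?F"
    unfolding topspace_subtopology topspace_real_space using F\<Delta> ext by blast
  have FY: "pt i x \<in> ?Y" if "x \<in> ?F" for x
  proof (cases "supp (E i) x = S")
    case True
    then show ?thesis using in_cell[of x i] that F\<Delta> by auto
  next
    case False
    then show ?thesis using boundary[of x] that by (auto simp: half_face_def)
  qed
  \<comment> \<open>What lies over A is the part where a coordinate in S vanishes. The cut along
    equal coordinates e and e' does not count as boundary, so the barycentre stays in the open cell
    even if it is an end of the half edge.\<close>
  have notA: "{x \<in> ?F. pt i x \<notin> A} = {x \<in> ?F. supp (E i) x = S}"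
  proof -
    have "pt i x \<notin> A \<longleftrightarrow> supp (E i) x = S" if "x \<in> ?F" for x
    proof
      assume "supp (E i) x = S"
      then show "pt i x \<notin> A" using in_cell[of x i] that F\<Delta> disj by auto
    next
      assume "pt i x \<notin> A"
      then show "supp (E i) x = S" using boundary[of x] that by (auto simp: half_face_def)
    qed
    then show ?thesis by blast
  qed
  have clF: "closedin (real_space (E i)) ?F" by (rule closedin_half_face[OF finEi S e])
  have closed_map: "closed_map ?D X (pt i)"
    unfolding closed_map_def
  proof (intro allI impI)
    fix C assume "closedin ?D C"
    then have "closedin (real_space (E i)) C" "C \<subseteq> ?F"
      using closedin_subset[of ?D C] closedin_trans_full[OF _ clF, of C] unfolding topD by blast+
    then show "closedin X (pt i ` C)" using F\<Delta> by (intro closedin_pt_image[OF i]) auto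
  qed
  have cont: "continuous_map ?D X (pt i)" by (rule continuous_pt[OF i F\<Delta>])
  \<comment> \<open>The fibres over the T1 space X are closed in a compact space, hence compact, so
    the closed map is proper.\<close>
  have "compact_space ?D" by (rule compact_space_subset_simplex[OF finEi clF F\<Delta>])
  then have proper: "proper_map ?D X (pt i)"
    by (rule continuous_closed_imp_proper_map[OF _ t1_space_X cont closed_map])
  have AX: "A \<subseteq> topspace X" using A by (rule closedin_subset)
  have YX: "?Y \<subseteq> topspace X"
    using AX pt_in[OF i] by (auto simp: cell_def)
  let ?b = "barycentre (E i) S"
  have bF: "?b \<in> ?F" by (rule barycentre_in_half_face[OF finEi S e])
  have bA: "pt i ?b \<notin> A" using notA bF supp_barycentre[OF finEi S] by blast
  have sub: "subtopology (subtopology X ?Y) A = subtopology X A"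
    by (simp add: subtopology_subtopology Int_absorb1)
  have "rank_le (homology_group p (subtopology X ?Y)) (n + (1 + (2 ^ card S - 1)))"
  proof (rule rank_le_homology_attach_cell[where D = ?D and f = "pt i" and A = A and b = ?b
        and h = "push_out (E i) S"])
    show "closedin (subtopology X ?Y) A"
      using A by (rule closedin_subset_topspace) simp
    show "continuous_map ?D (subtopology X ?Y) (pt i)"
      unfolding continuous_map_in_subtopology topD using cont FY by blast
    show "proper_map ?D (subtopology X ?Y) (pt i)"
      using proper by (rule proper_map_into_subtopology) (use FY topD in blast)
    show "topspace (subtopology X ?Y) \<subseteq> A \<union> pt i ` topspace ?D"
      unfolding topD using cover by auto
    show "inj_on (pt i) {x \<in> topspace ?D. pt i x \<notin> A}"
      unfolding topD notA by (rule inj)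
    show "?b \<in> topspace ?D" unfolding topD by (rule bF)
    show "pt i ?b \<notin> A" by (rule bA)
    show "t1_space ?D" by (rule t1_space_subtopology[OF t1_space_real_space])
    show "continuous_map (prod_topology (top_of_set {0..1}) (subtopology ?D (topspace ?D - {?b})))
       (subtopology ?D (topspace ?D - {?b})) (\<lambda>(t, x). push_out (E i) S t x)"
      by (rule continuous_push_out[OF finEi S e])
    show "push_out (E i) S 0 x = x" if "x \<in> topspace ?D" for x
      using that unfolding topD by (rule push_out_0[OF finEi S])
    show "pt i (push_out (E i) S 1 x) \<in> A" if "x \<in> topspace ?D" "x \<noteq> ?b" for x
    proof -
      have "push_out (E i) S 1 x \<in> ?F"
        using that unfolding topD by (intro push_out_in_half_face[OF finEi S _ _ _ _ e]) auto
      moreover have "supp (E i) (push_out (E i) S 1 x) \<noteq> S" by (rule supp_push_out_1[OF finEi S])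
      ultimately show ?thesis using notA by blast
    qed
    show "push_out (E i) S t x = x" if "x \<in> topspace ?D" "pt i x \<in> A" for x t
      using that notA unfolding topD by (intro push_out_boundary[OF finEi S]) auto
    show "rank_le (homology_group p (subtopology (subtopology X ?Y) A)) n"
      unfolding sub by (rule r)
    have sub2: "subtopology ?D W = face_top i W" if "W \<subseteq> ?F" for W
      using that by (simp add: subtopology_subtopology Int_absorb1)
    show "rank_le (homology_group p (subtopology ?D {x \<in> topspace ?D. pt i x \<notin> A})) 1"
      unfolding topD notA
      using rank_le_homology_open_half_face(1)[OF finEi S e] by (subst sub2) auto
    show "rank_le (homology_group (p - 1) (subtopology ?D ({x \<in> topspace ?D. pt i x \<notin> A} - {?b}))) (2 ^ card S - 1)"
      unfolding topD notA
      using rank_le_homology_open_half_face(2)[OF finEi S e] by (subst sub2) auto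
  qed
  moreover have "n + (1 + (2 ^ card S - 1)) = n + 2 ^ card S" by simp
  ultimately show ?thesis by (simp only:)
qed

text \<open>Induction on the number of cells, splitting off one of largest dimension: the others are
  then still closed under faces, so their union is a closed set. As P holds just one name for each
  cell, a face of a member need only have its cell among the cells of P.\<close>

lemma rank_le_homology_cells:
  assumes "finite P" "P \<subseteq> faces" "inj_on cell P" "\<And>f. f \<in> P \<Longrightarrow> card (snd f) \<le> s"
    and "\<And>i S T. (i, S) \<in> P \<Longrightarrow> T \<subseteq> S \<Longrightarrow> T \<noteq> {} \<Longrightarrow> cell (i, T) \<in> cell ` P"
  shows "rank_le (homology_group p (subtopology X (\<Union>(cell ` P)))) (card P * 2 ^ s)"
  using assms
proof (induction "card P" arbitrary: P)
  case 0
  then have "P = {}" by simp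
  then show ?case
    using rank_le_homology_empty[of "subtopology X {}" p] by simp
next
  case (Suc n P)
  have "P \<noteq> {}" using Suc.hyps by auto
  then have "Max ((\<lambda>f. card (snd f)) ` P) \<in> (\<lambda>f. card (snd f)) ` P"
    using Suc.prems(1) by (intro Max_in) auto
  then obtain f where f: "f \<in> P" and "card (snd f) = Max ((\<lambda>f. card (snd f)) ` P)" by auto
  then have max: "\<And>g. g \<in> P \<Longrightarrow> card (snd g) \<le> card (snd f)" using Suc.prems(1) by simp
  obtain i S where fiS: "f = (i, S)" by (cases f)
  define P' where "P' = P - {f}"
  define A where "A = \<Union>(cell ` P')"
  have P': "finite P'" "P' \<subseteq> faces" "inj_on cell P'" "card P' = n"
    using Suc.prems(1-3) Suc.hyps(2) f by (auto simp: P'_def inj_on_diff)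
  have face: "(i, S) \<in> faces" using f fiS Suc.prems(2) by auto
  have facesub: "(j, T') \<in> faces" if "(j, T) \<in> faces" "T' \<subseteq> T" "T' \<noteq> {}" for j T T'
    using that by (auto simp: faces_def)
  \<comment> \<open>A face with the same cell as f has the greatest number of vertices in P, so it
    is all of T; injectivity of \<open>cell\<close> on P then gives (j, T) = f.\<close>
  have down: "cell (j, T') \<in> cell ` P'" if jT: "(j, T) \<in> P" "T' \<subseteq> T" "T' \<noteq> {}" and ne: "(j, T) \<noteq> f \<or> T' \<noteq> T" for j T T'
  proof -
    obtain g where g: "g \<in> P" "cell (j, T') = cell g"
      using Suc.prems(5)[OF jT] by auto
    have jT': "(j, T) \<in> faces" using jT(1) Suc.prems(2) by auto
    have "g \<noteq> f"
    proof
      assume "g = f"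
      have "card T' = card (snd f)"
        using card_eq_of_cell_eq[of "(j, T')" g] g facesub[OF jT' jT(2,3)] Suc.prems(2) \<open>g = f\<close> by auto
      moreover have "finite T" using facesD[OF jT'] finE finite_subset by blast
      moreover have "card T \<le> card (snd f)" using max[OF jT(1)] by simp
      ultimately have "T' = T" using jT(2) by (metis card_seteq)
      then have "(j, T) = f" using Suc.prems(3) g jT(1) f \<open>g = f\<close> by (auto dest: inj_onD)
      then show False using ne \<open>T' = T\<close> by blast
    qed
    then show ?thesis using g by (auto simp: P'_def)
  qed
  have "rank_le (homology_group p (subtopology X A)) (card P' * 2 ^ s)"
    unfolding A_def
  proof (rule Suc.hyps(1))
    show "n = card P'" using P' by simp
    show "cell (j, T') \<in> cell ` P'" if "(j, T) \<in> P'" "T' \<subseteq> T" "T' \<noteq> {}" for j T T'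
      using that by (intro down[of j T]) (auto simp: P'_def)
  qed (use P' Suc.prems(4) in \<open>auto simp: P'_def\<close>)
  moreover have "closedin X A"
  proof -
    \<comment> \<open>Closure under faces allows open faces to be replaced by closed ones, whose
      images are closed.\<close>
    have "A = (\<Union>(j, T)\<in>P'. pt j ` closed_face (j, T))"
    proof (intro equalityI subsetI)
      fix z assume "z \<in> A"
      then show "z \<in> (\<Union>(j, T)\<in>P'. pt j ` closed_face (j, T))"
        unfolding A_def cell_def closed_face_def by fastforce
    next
      fix z assume "z \<in> (\<Union>(j, T)\<in>P'. pt j ` closed_face (j, T))"
      then obtain j T x where jT: "(j, T) \<in> P'" and x: "x \<in> \<Delta> j" "supp (E j) x \<subseteq> T" "z = pt j x"
        unfolding closed_face_def by auto
      have "cell (j, supp (E j) x) \<in> cell ` P'"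
        using jT x(2) supp_nonempty[OF x(1)] by (intro down[of j T]) (auto simp: P'_def)
      then show "z \<in> A" using in_cell[OF x(1)] x(3) unfolding A_def by auto
    qed
    moreover have "closedin X (case g of (j, T) \<Rightarrow> pt j ` closed_face (j, T))" if "g \<in> P'" for g
      using that P'(2) facesD closedin_closed_face by (cases g) auto
    ultimately show ?thesis using P'(1) by (auto intro!: closedin_Union)
  qed
  moreover have "cell (i, S) \<inter> A = {}"
  proof (rule ccontr)
    assume "cell (i, S) \<inter> A \<noteq> {}"
    then obtain z g where g: "g \<in> P'" "z \<in> cell g" "z \<in> cell f" unfolding A_def fiS by auto
    then have "cell g = cell f"
      using P'(2) face unfolding fiS by (intro cell_eq_of_pt_in(1)) auto
    then have "g = f" using Suc.prems(3) f g(1) by (auto simp: P'_def dest: inj_onD)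
    then show False using g(1) by (simp add: P'_def)
  qed
  moreover have "pt i x \<in> A" if x: "x \<in> \<Delta> i" "supp (E i) x \<subset> S" for x
  proof -
    have "cell (i, supp (E i) x) \<in> cell ` P'"
      using f x(2) supp_nonempty[OF x(1)] unfolding fiS by (intro down[of i S]) auto
    then show ?thesis using in_cell[OF x(1)] unfolding A_def by auto
  qed
  ultimately have "rank_le (homology_group p (subtopology X (A \<union> cell (i, S)))) (card P' * 2 ^ s + 2 ^ card S)"
    using face by (intro rank_le_homology_remove_cell)
  moreover have "A \<union> cell (i, S) = \<Union>(cell ` P)"
    using f unfolding A_def P'_def fiS by auto
  moreover have "card P' * 2 ^ s + 2 ^ card S \<le> card P * 2 ^ s"
  proof -
    have "card P = Suc (card P')" using P'(4) Suc.hyps(2) by simp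
    moreover have "(2::nat) ^ card S \<le> 2 ^ s"
      using Suc.prems(4)[OF f] unfolding fiS by (intro power_increasing) auto
    ultimately show ?thesis by simp
  qed
  ultimately show ?case
    using rank_le_mono[of "homology_group p (subtopology X (A \<union> cell (i, S)))"] by simp
qed

text \<open>One factor 2^s bounds the number of faces of a simplex, the other the cost of a
  cell.\<close>

theorem rank_le_homology_glued:
  assumes s: "\<And>i. i \<in> I \<Longrightarrow> card (E i) \<le> s"
  shows "rank_le (homology_group p X) (card I * 2 ^ s * 2 ^ s)"
proof -
  have fin: "finite faces"
    unfolding faces_def using finI finE by (intro finite_SigmaI) auto
  \<comment> \<open>Choose one face for each cell.\<close>
  from iffD1[OF subset_image_inj[of "cell ` faces" cell faces] order_refl]
  obtain P where P0: "P \<subseteq> faces \<and> inj_on cell P \<and> cell ` faces = cell ` P" ..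
  then have P: "P \<subseteq> faces" "inj_on cell P" "cell ` P = cell ` faces" by simp_all
  have finP: "finite P" using P(1) fin finite_subset by blast
  have "rank_le (homology_group p (subtopology X (\<Union>(cell ` P)))) (card P * 2 ^ s)"
  proof (rule rank_le_homology_cells[OF finP P(1,2)])
    show "card (snd f) \<le> s" if f: "f \<in> P" for f
    proof -
      obtain i S where "f = (i, S)" by (cases f)
      then have iS: "i \<in> I" "S \<subseteq> E i" using f P(1) facesD[of i S] by blast+
      have "card S \<le> s"
        using card_mono[OF finE[OF iS(1)] iS(2)] s[OF iS(1)] by (rule le_trans)
      then show ?thesis using \<open>f = (i, S)\<close> by simp
    qed
    show "cell (i, T) \<in> cell ` P" if "(i, S) \<in> P" "T \<subseteq> S" "T \<noteq> {}" for i S T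
      unfolding P(3) using that P(1) by (intro imageI) (auto simp: faces_def)
  qed
  moreover have "\<Union>(cell ` P) = topspace X"
  proof -
    have "z \<in> \<Union>(cell ` faces)" if "z \<in> topspace X" for z
    proof -
      obtain i x where x: "i \<in> I" "x \<in> \<Delta> i" "z = pt i x"
        using \<open>z \<in> topspace X\<close> unfolding topspace_X by blast
      show ?thesis using in_cell[OF x(2)] supp_face[OF x(1,2)] unfolding x(3) by (rule UN_I[rotated])
    qed
    moreover have "cell f \<subseteq> topspace X" if "f \<in> faces" for f
    proof -
      obtain i S where "f = (i, S)" by (cases f)
      then show ?thesis using pt_in facesD[of i S] that unfolding cell_def by auto
    qed
    then have "\<Union>(cell ` faces) \<subseteq> topspace X" by (rule UN_least)
    ultimately show ?thesis unfolding P(3) by blast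
  qed
  moreover have "card P \<le> card I * 2 ^ s"
  proof -
    have "card P \<le> card faces" using P(1) fin by (rule card_mono[rotated])
    also have "\<dots> = (\<Sum>i\<in>I. card (Pow (E i) - {{}}))"
      unfolding faces_def using finI finE by (intro card_SigmaI) auto
    also have "\<dots> \<le> (\<Sum>i\<in>I. 2 ^ s)"
    proof (rule sum_mono)
      fix i assume i: "i \<in> I"
      have "card (Pow (E i) - {{}}) \<le> card (Pow (E i))" using finE[OF i] by (intro card_mono) auto
      also have "\<dots> = 2 ^ card (E i)" using finE[OF i] by (simp add: card_Pow)
      also have "\<dots> \<le> 2 ^ s" using s[OF i] by (intro power_increasing) auto
      finally show "card (Pow (E i) - {{}}) \<le> 2 ^ s" .
    qed
    finally show ?thesis by simp
  qed
  ultimately show ?thesis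
    using rank_le_mono[of "homology_group p X" "card P * 2 ^ s" "card I * 2 ^ s * 2 ^ s"] by simp
qed

end

section \<open>Rational homology\<close>

text \<open>The record of \<open>rat_homology\<close> for arbitrary sets Z and B, so that homology
  is an instance by mere unfolding.\<close>

definition quotient_module :: "(rat \<Rightarrow> 'c \<Rightarrow> 'c) \<Rightarrow> 'c::ab_group_add set \<Rightarrow> 'c set \<Rightarrow> (rat, 'c set) module" where
  "quotient_module sc Z B =
     \<lparr>carrier = (\<lambda>z. {z + b |b. b \<in> B}) ` Z,
      mult = undefined,
      one = undefined,
      zero = B,
      add = (\<lambda>C D. {x + y |x y. x \<in> C \<and> y \<in> D}),
      smult = (\<lambda>q C. {sc q x + b |x b. x \<in> C \<and> b \<in> B})\<rparr>"

locale rational_subquotient = vector_space sc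
  for sc :: "rat \<Rightarrow> 'c::ab_group_add \<Rightarrow> 'c" +
  fixes Z B :: "'c set"
  assumes Z: "subspace Z" and B: "subspace B" and BZ: "B \<subseteq> Z"
begin

abbreviation "Q \<equiv> quotient_module sc Z B"

definition cls :: "'c \<Rightarrow> 'c set" where
  "cls z = {z + b |b. b \<in> B}"

lemma cls_eq_iff: "cls z = cls w \<longleftrightarrow> z - w \<in> B"
proof
  assume "cls z = cls w"
  moreover have "z \<in> cls z" using subspace_0[OF B] by (force simp: cls_def)
  ultimately obtain b where "z = w + b" "b \<in> B" by (auto simp: cls_def)
  then show "z - w \<in> B" by simp
next
  assume zw: "z - w \<in> B"
  have "x \<in> cls z \<longleftrightarrow> x \<in> cls w" for x
  proof -
    have "x \<in> cls u \<longleftrightarrow> x - u \<in> B" for u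
      by (auto simp: cls_def intro: exI[of _ "x - u"])
    moreover have "x - w = (x - z) + (z - w)" "x - z = (x - w) - (z - w)" by simp_all
    ultimately show ?thesis
      using subspace_add[OF B _ zw, of "x - z"] subspace_diff[OF B _ zw, of "x - w"] by metis
  qed
  then show "cls z = cls w" by blast
qed

lemma carrier_Q: "carrier Q = cls ` Z"
  by (simp add: quotient_module_def cls_def[abs_def])

lemma zero_Q: "\<zero>\<^bsub>Q\<^esub> = cls 0"
  by (simp add: quotient_module_def cls_def)

lemma add_Q: "cls z \<oplus>\<^bsub>Q\<^esub> cls w = cls (z + w)"
proof -
  have "cls z \<oplus>\<^bsub>Q\<^esub> cls w = {x + y |x y. x \<in> cls z \<and> y \<in> cls w}"
    by (simp add: quotient_module_def)
  also have "\<dots> = cls (z + w)"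
  proof (intro equalityI subsetI)
    fix u assume "u \<in> {x + y |x y. x \<in> cls z \<and> y \<in> cls w}"
    then obtain b c where "u = (z + b) + (w + c)" "b \<in> B" "c \<in> B" by (auto simp: cls_def)
    then show "u \<in> cls (z + w)"
      using subspace_add[OF B, of b c] by (auto simp: cls_def algebra_simps intro!: exI[of _ "b + c"])
  next
    fix u assume "u \<in> cls (z + w)"
    then obtain b where "u = (z + b) + (w + 0)" "b \<in> B" by (auto simp: cls_def algebra_simps)
    then show "u \<in> {x + y |x y. x \<in> cls z \<and> y \<in> cls w}"
      using subspace_0[OF B] unfolding cls_def by blast
  qed
  finally show ?thesis .
qed

lemma smult_Q: "q \<odot>\<^bsub>Q\<^esub> cls z = cls (sc q z)"
proof -
  have "q \<odot>\<^bsub>Q\<^esub> cls z = {sc q x + b |x b. x \<in> cls z \<and> b \<in> B}"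
    by (simp add: quotient_module_def)
  also have "\<dots> = cls (sc q z)"
  proof (intro equalityI subsetI)
    fix u assume "u \<in> {sc q x + b |x b. x \<in> cls z \<and> b \<in> B}"
    then obtain b c where u: "u = sc q (z + c) + b" "b \<in> B" "c \<in> B" by (auto simp: cls_def)
    have "sc q c + b \<in> B" using subspace_add[OF B subspace_scale[OF B u(3)] u(2)] .
    then show "u \<in> cls (sc q z)"
      using u(1) by (auto simp: cls_def scale_right_distrib algebra_simps intro!: exI[of _ "sc q c + b"])
  next
    fix u assume "u \<in> cls (sc q z)"
    then obtain b where b: "u = sc q z + b" "b \<in> B" by (auto simp: cls_def)
    have "z \<in> cls z" using subspace_0[OF B] by (force simp: cls_def)
    then show "u \<in> {sc q x + b |x b. x \<in> cls z \<and> b \<in> B}"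
      using b by blast
  qed
  finally show ?thesis .
qed

lemma vectorspace_Q: "vectorspace class_ring Q"
proof -
  have in_Q: "\<exists>z\<in>Z. C = cls z" if "C \<in> carrier Q" for C using that by (auto simp: carrier_Q)
  have "abelian_group Q"
  proof (rule abelian_groupI)
    show "C \<oplus>\<^bsub>Q\<^esub> D \<in> carrier Q" if "C \<in> carrier Q" "D \<in> carrier Q" for C D
      using in_Q[OF that(1)] in_Q[OF that(2)] subspace_add[OF Z] by (auto simp: add_Q carrier_Q)
    show "\<zero>\<^bsub>Q\<^esub> \<in> carrier Q" using subspace_0[OF Z] by (auto simp: carrier_Q zero_Q)
    show "(C \<oplus>\<^bsub>Q\<^esub> D) \<oplus>\<^bsub>Q\<^esub> F = C \<oplus>\<^bsub>Q\<^esub> (D \<oplus>\<^bsub>Q\<^esub> F)"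
      if "C \<in> carrier Q" "D \<in> carrier Q" "F \<in> carrier Q" for C D F
      using in_Q[OF that(1)] in_Q[OF that(2)] in_Q[OF that(3)] by (auto simp: add_Q add.assoc)
    show "C \<oplus>\<^bsub>Q\<^esub> D = D \<oplus>\<^bsub>Q\<^esub> C" if "C \<in> carrier Q" "D \<in> carrier Q" for C D
      using in_Q[OF that(1)] in_Q[OF that(2)] by (auto simp: add_Q add.commute)
    show "\<zero>\<^bsub>Q\<^esub> \<oplus>\<^bsub>Q\<^esub> C = C" if "C \<in> carrier Q" for C
      using in_Q[OF that] by (auto simp: add_Q zero_Q)
    show "\<exists>D\<in>carrier Q. D \<oplus>\<^bsub>Q\<^esub> C = \<zero>\<^bsub>Q\<^esub>" if "C \<in> carrier Q" for C
    proof -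
      have "\<exists>z\<in>Z. C = cls z" using that by (rule in_Q)
      then obtain z where z: "z \<in> Z" "C = cls z" ..
      then have "cls (- z) \<oplus>\<^bsub>Q\<^esub> C = \<zero>\<^bsub>Q\<^esub>" "cls (- z) \<in> carrier Q"
        using subspace_neg[OF Z] by (simp_all add: add_Q zero_Q carrier_Q)
      then show ?thesis by blast
    qed
  qed
  then have "Module.module (class_ring :: rat ring) Q"
  proof (rule moduleI[rotated])
    show "cring (class_ring :: rat ring)" by (rule class_cring.cring_axioms)
    fix q r :: rat and C assume "C \<in> carrier Q"
    then have "\<exists>z\<in>Z. C = cls z" by (rule in_Q)
    then obtain z where z: "z \<in> Z" "C = cls z" by (rule bexE)
    show "q \<odot>\<^bsub>Q\<^esub> C \<in> carrier Q"
      using z subspace_scale[OF Z] by (simp add: smult_Q carrier_Q)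
    show "(q \<oplus>\<^bsub>class_ring\<^esub> r) \<odot>\<^bsub>Q\<^esub> C = q \<odot>\<^bsub>Q\<^esub> C \<oplus>\<^bsub>Q\<^esub> r \<odot>\<^bsub>Q\<^esub> C"
      using z by (simp add: smult_Q add_Q scale_left_distrib)
    show "(q \<otimes>\<^bsub>class_ring\<^esub> r) \<odot>\<^bsub>Q\<^esub> C = q \<odot>\<^bsub>Q\<^esub> (r \<odot>\<^bsub>Q\<^esub> C)"
      using z by (simp add: smult_Q)
    show "\<one>\<^bsub>class_ring\<^esub> \<odot>\<^bsub>Q\<^esub> C = C"
      using z by (simp add: smult_Q)
  next
    fix q :: rat and C D assume "C \<in> carrier Q" "D \<in> carrier Q"
    then have "\<exists>z\<in>Z. C = cls z" "\<exists>w\<in>Z. D = cls w" by (simp_all only: in_Q)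
    then obtain z w where z: "C = cls z" "D = cls w" by (elim bexE)
    show "q \<odot>\<^bsub>Q\<^esub> (C \<oplus>\<^bsub>Q\<^esub> D) = q \<odot>\<^bsub>Q\<^esub> C \<oplus>\<^bsub>Q\<^esub> q \<odot>\<^bsub>Q\<^esub> D"
      using z by (simp add: smult_Q add_Q scale_right_distrib)
  qed
  then show ?thesis
    by (intro vectorspace.intro class_field)
qed

interpretation Q: vectorspace class_ring Q
  by (rule vectorspace_Q)

lemma lincomb_Q:
  assumes "finite A" "\<And>v. v \<in> A \<Longrightarrow> z v \<in> Z \<and> v = cls (z v)"
  shows "Q.lincomb a A = cls (\<Sum>v\<in>A. sc (a v) (z v))"
  using assms
proof (induction A rule: finite_induct)
  case empty
  then show ?case by (simp add: Q.lincomb_def zero_Q)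
next
  case (insert v A)
  have c: "a w \<odot>\<^bsub>Q\<^esub> w \<in> carrier Q" if "w \<in> insert v A" for w
    using insert.prems[OF that] subspace_scale[OF Z] by (metis smult_Q carrier_Q imageI)
  have v: "v = cls (z v)" using insert.prems by blast
  have "Q.lincomb a (insert v A) = a v \<odot>\<^bsub>Q\<^esub> v \<oplus>\<^bsub>Q\<^esub> Q.lincomb a A"
    unfolding Q.lincomb_def using insert.hyps c by (intro Q.finsum_insert) auto
  also have "Q.lincomb a A = cls (\<Sum>v\<in>A. sc (a v) (z v))"
    using insert.prems by (intro insert.IH) auto
  also have "a v \<odot>\<^bsub>Q\<^esub> v = cls (sc (a v) (z v))"
    by (subst v, rule smult_Q)
  finally show ?case using insert.hyps by (simp add: add_Q)
qed

text \<open>The hypothesis has the shape of \<open>rank_le\<close>, read modulo B. It bounds the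
  size of finite independent sets of cosets, and an independent set of greatest size spans, because
  adding any further coset makes it dependent.\<close>

lemma fin_dim_dim_le:
  assumes dep: "\<And>(I :: nat set) z. finite I \<Longrightarrow> n < card I \<Longrightarrow> (\<And>i. i \<in> I \<Longrightarrow> z i \<in> Z) \<Longrightarrow>
      \<exists>q. (\<exists>i\<in>I. q i \<noteq> 0) \<and> (\<Sum>i\<in>I. sc (q i) (z i)) \<in> B"
  shows "Q.fin_dim \<and> Q.dim \<le> n"
proof -
  have small: "card A \<le> n" if A: "finite A" "A \<subseteq> carrier Q" "Q.lin_indpt A" for A
  proof (rule ccontr)
    assume big: "\<not> card A \<le> n"
    \<comment> \<open>The cosets are numbered to obtain a family indexed by natural numbers, as in
      \<open>dep\<close>.\<close>
    obtain f where f: "bij_betw f {0..<card A} A" using ex_bij_betw_nat_finite[OF A(1)] by blast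
    define rep where "rep v = (SOME z. z \<in> Z \<and> v = cls z)" for v
    have rep: "rep v \<in> Z \<and> v = cls (rep v)" if "v \<in> A" for v
    proof -
      have "\<exists>z. z \<in> Z \<and> v = cls z" using that A(2) by (auto simp: carrier_Q)
      then show ?thesis unfolding rep_def by (rule someI_ex)
    qed
    have fA: "f i \<in> A" if "i < card A" for i using f that by (auto simp: bij_betw_def)
    obtain q where q: "\<exists>i\<in>{0..<card A}. q i \<noteq> 0"
        "(\<Sum>i\<in>{0..<card A}. sc (q i) (rep (f i))) \<in> B"
      using dep[of "{0..<card A}" "\<lambda>i. rep (f i)"] big rep fA by auto
    define g where "g = inv_into {0..<card A} f"
    have gf: "g (f i) = i" if "i < card A" for i
      unfolding g_def using f that by (simp add: bij_betw_def inv_into_f_f)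
    define a where "a v = q (g v)" for v
    have "(\<Sum>v\<in>A. sc (a v) (rep v)) = (\<Sum>i\<in>{0..<card A}. sc (a (f i)) (rep (f i)))"
      using sum.reindex_bij_betw[OF f, of "\<lambda>v. sc (a v) (rep v)"] by simp
    also have "\<dots> = (\<Sum>i\<in>{0..<card A}. sc (q i) (rep (f i)))"
      using gf by (intro sum.cong) (auto simp: a_def)
    finally have "(\<Sum>v\<in>A. sc (a v) (rep v)) \<in> B" using q(2) by simp
    then have "Q.lincomb a A = \<zero>\<^bsub>Q\<^esub>"
      using lincomb_Q[OF A(1) rep] by (simp add: zero_Q cls_eq_iff)
    moreover obtain i where "i < card A" "q i \<noteq> 0" using q(1) by auto
    then have "f i \<in> A" "a (f i) \<noteq> 0" using gf fA by (auto simp: a_def)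
    ultimately have "Q.lin_dep A"
      unfolding Q.lin_dep_def using A(1)
      by (intro exI[of _ A] exI[of _ a] exI[of _ "f i"]) auto
    then show False using A(3) by simp
  qed
  let ?P = "\<lambda>A. finite A \<and> A \<subseteq> carrier Q \<and> Q.lin_indpt A"
  have "?P {}" by (auto simp: Q.lin_dep_def)
  \<comment> \<open>A greatest size exists because \<open>small\<close> bounds all sizes by
    n.\<close>
  then obtain A where A: "?P A" and max: "\<And>A'. ?P A' \<Longrightarrow> card A' \<le> card A"
    using ex_has_greatest_nat[of ?P "{}" card "Suc n"] small by (metis less_Suc_eq_le)
  have "v \<in> Q.span A" if v: "v \<in> carrier Q" for v
  proof (cases "v \<in> A")
    case True
    then show ?thesis using A Q.in_own_span by blast
  next
    case False
    then have "\<not> ?P (insert v A)" using max[of "insert v A"] A by auto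
    then have "Q.lin_dep (insert v A)" using A v by blast
    then show ?thesis using Q.lin_dep_iff_in_span[of A v] A v False by simp
  qed
  moreover have "Q.span A \<subseteq> carrier Q" using A Q.span_is_subset2 by blast
  ultimately have gen: "Q.span A = carrier Q" by blast
  have "Q.fin_dim" unfolding Q.fin_dim_def using A gen by blast
  moreover have "Q.dim \<le> card A" using A gen by (intro Q.gen_ge_dim) auto
  ultimately show ?thesis using small A by (meson le_trans)
qed

end

section \<open>The vector space of rational chains\<close>

lemma lookup_rat_scale [simp]: "Poly_Mapping.lookup (rat_scale q c) f = q * Poly_Mapping.lookup c f"
  by (simp add: rat_scale_def Poly_Mapping.map.rep_eq when_def)

lemma rat_chain_eqI: "(\<And>f. Poly_Mapping.lookup c f = Poly_Mapping.lookup d f) \<Longrightarrow> c = (d :: 'a rat_chain)"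
  by (rule poly_mapping_eqI)

interpretation rat_chain: vector_space rat_scale
  by unfold_locales (auto intro!: rat_chain_eqI simp: lookup_add algebra_simps)

lemma rat_scale_single: "rat_scale q (Poly_Mapping.single f r) = Poly_Mapping.single f (q * r)"
  by (rule rat_chain_eqI) (simp add: lookup_single when_def)

definition face_sum :: "nat \<Rightarrow> ((nat \<Rightarrow> real) \<Rightarrow> 'a) \<Rightarrow> 'a rat_chain" where
  "face_sum p f = (\<Sum>k\<le>p. Poly_Mapping.single (singular_face p k f) ((- 1) ^ k))"

text \<open>The keys of a sum are only contained in the union of the keys. Summing over a common
  finite superset makes linearity of the boundary a termwise matter.\<close>

lemma rat_boundary_eq_sum:
  assumes "finite K" "Poly_Mapping.keys c \<subseteq> K" "p \<noteq> 0"
  shows "rat_boundary p c = (\<Sum>f\<in>K. rat_scale (Poly_Mapping.lookup c f) (face_sum p f))"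
proof -
  have "rat_boundary p c = (\<Sum>f\<in>Poly_Mapping.keys c. rat_scale (Poly_Mapping.lookup c f) (face_sum p f))"
    using assms(3)
    by (simp add: rat_boundary_def face_sum_def rat_chain.scale_sum_right rat_scale_single mult.commute)
  also have "\<dots> = (\<Sum>f\<in>K. rat_scale (Poly_Mapping.lookup c f) (face_sum p f))"
    using assms by (intro sum.mono_neutral_left) (auto simp: in_keys_iff)
  finally show ?thesis .
qed

lemma rat_boundary_add: "rat_boundary p (c + d) = rat_boundary p c + rat_boundary p d"
proof (cases "p = 0")
  case False
  have K: "finite (Poly_Mapping.keys c \<union> Poly_Mapping.keys d)" by simp
  show ?thesis
    using rat_boundary_eq_sum[OF K _ False, of "c + d"] rat_boundary_eq_sum[OF K _ False, of c]
      rat_boundary_eq_sum[OF K _ False, of d] keys_add[of c d]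
    by (simp add: lookup_add rat_chain.scale_left_distrib sum.distrib)
qed (simp add: rat_boundary_def)

lemma keys_rat_scale: "Poly_Mapping.keys (rat_scale q c) \<subseteq> Poly_Mapping.keys c"
  by (auto simp: in_keys_iff)

lemma rat_boundary_scale: "rat_boundary p (rat_scale q c) = rat_scale q (rat_boundary p c)"
proof (cases "p = 0")
  case False
  then show ?thesis
    using rat_boundary_eq_sum[OF finite_keys keys_rat_scale False, of q c]
      rat_boundary_eq_sum[OF finite_keys order_refl False, of c]
    by (simp add: rat_chain.scale_sum_right)
qed (simp add: rat_boundary_def)

lemma rat_boundary_0 [simp]: "rat_boundary p 0 = 0"
  using rat_boundary_scale[of p 0 0] by simp

lemma subspace_rat_chains: "rat_chain.subspace (rat_chains p X)"
proof (rule rat_chain.subspaceI)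
  show "0 \<in> rat_chains p X" by (simp add: rat_chains_def)
  show "c + d \<in> rat_chains p X" if "c \<in> rat_chains p X" "d \<in> rat_chains p X" for c d
    using that keys_add[of c d] unfolding rat_chains_def by blast
  show "rat_scale q c \<in> rat_chains p X" if "c \<in> rat_chains p X" for q c
    using that keys_rat_scale[of q c] unfolding rat_chains_def by blast
qed

lemma subspace_rat_cycles: "rat_chain.subspace (rat_cycles p X)"
  unfolding rat_cycles_def
  using rat_chain.subspace_0[OF subspace_rat_chains, of p X]
    rat_chain.subspace_add[OF subspace_rat_chains, of _ p X]
    rat_chain.subspace_scale[OF subspace_rat_chains, of _ p X]
  by (intro rat_chain.subspaceI) (simp_all add: rat_boundary_add rat_boundary_scale)

lemma subspace_rat_boundaries: "rat_chain.subspace (rat_boundaries p X)"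
  unfolding rat_boundaries_def
proof (rule rat_chain.subspaceI)
  note S = subspace_rat_chains[of "Suc p" X]
  show "0 \<in> rat_boundary (Suc p) ` rat_chains (Suc p) X"
    using rat_chain.subspace_0[OF S] by (intro image_eqI[of _ _ 0]) simp_all
  show "x + y \<in> rat_boundary (Suc p) ` rat_chains (Suc p) X"
    if "x \<in> rat_boundary (Suc p) ` rat_chains (Suc p) X" "y \<in> rat_boundary (Suc p) ` rat_chains (Suc p) X" for x y
    using that rat_chain.subspace_add[OF S] by (auto simp flip: rat_boundary_add)
  show "rat_scale q x \<in> rat_boundary (Suc p) ` rat_chains (Suc p) X"
    if "x \<in> rat_boundary (Suc p) ` rat_chains (Suc p) X" for q x
    using that rat_chain.subspace_scale[OF S] by (auto simp flip: rat_boundary_scale)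
qed

section \<open>Integral chains inside rational chains\<close>

definition rat_of_int_chain :: "'a chain \<Rightarrow> 'a rat_chain" where
  "rat_of_int_chain c = Poly_Mapping.map of_int c"

lemma lookup_rat_of_int_chain [simp]: "Poly_Mapping.lookup (rat_of_int_chain c) f = of_int (Poly_Mapping.lookup c f)"
  by (simp add: rat_of_int_chain_def Poly_Mapping.map.rep_eq when_def)

lemma keys_rat_of_int_chain [simp]: "Poly_Mapping.keys (rat_of_int_chain c) = Poly_Mapping.keys c"
  by (auto simp: in_keys_iff)

lemma rat_of_int_chain_add: "rat_of_int_chain (c + d) = rat_of_int_chain c + rat_of_int_chain d"
  by (rule rat_chain_eqI) (simp add: lookup_add)

lemma rat_of_int_chain_cmul: "rat_of_int_chain (frag_cmul n c) = rat_scale (of_int n) (rat_of_int_chain c)"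
  by (rule rat_chain_eqI) simp

lemma rat_of_int_chain_0 [simp]: "rat_of_int_chain 0 = 0"
  by (rule rat_chain_eqI) simp

lemma rat_of_int_chain_sum: "rat_of_int_chain (\<Sum>i\<in>I. c i) = (\<Sum>i\<in>I. rat_of_int_chain (c i))"
  by (induction I rule: infinite_finite_induct) (simp_all add: rat_of_int_chain_add)

lemma rat_of_int_chain_inject: "rat_of_int_chain c = rat_of_int_chain d \<Longrightarrow> c = d"
proof (rule poly_mapping_eqI)
  fix f assume "rat_of_int_chain c = rat_of_int_chain d"
  then have "Poly_Mapping.lookup (rat_of_int_chain c) f = Poly_Mapping.lookup (rat_of_int_chain d) f" by simp
  then show "Poly_Mapping.lookup c f = Poly_Mapping.lookup d f" by simp
qed

lemma rat_boundary_of_int_chain: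
  "rat_boundary p (rat_of_int_chain c) = rat_of_int_chain (chain_boundary p c)"
proof (cases "p = 0")
  case True
  then show ?thesis by (simp add: rat_boundary_def chain_boundary_def)
next
  case False
  have "rat_of_int_chain (frag_cmul ((- 1) ^ k) (frag_of g)) = Poly_Mapping.single g ((- 1) ^ k)" for k and g :: "(nat \<Rightarrow> real) \<Rightarrow> 'a"
    by (rule rat_chain_eqI) (simp add: lookup_single when_def)
  then have "rat_of_int_chain (\<Sum>k\<le>p. frag_cmul ((- 1) ^ k) (frag_of (singular_face p k f))) = face_sum p f" for f :: "(nat \<Rightarrow> real) \<Rightarrow> 'a"
    by (simp add: rat_of_int_chain_sum face_sum_def)
  then show ?thesis
    using rat_boundary_eq_sum[OF finite_keys order_refl False, of "rat_of_int_chain c"] False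
    by (simp add: chain_boundary_def frag_extend_def rat_of_int_chain_sum rat_of_int_chain_cmul)
qed

text \<open>The product of the denominators of all coefficients is a common denominator.\<close>

lemma clear_denominators:
  fixes x :: "'a rat_chain"
  shows "\<exists>d c. d \<noteq> 0 \<and> rat_scale (of_int d) x = rat_of_int_chain c"
proof -
  define d :: int where "d = (\<Prod>f\<in>Poly_Mapping.keys x. snd (quotient_of (Poly_Mapping.lookup x f)))"
  have "d \<noteq> 0"
    unfolding d_def using quotient_of_denom_pos' by (simp add: less_imp_neq[symmetric] dual_order.strict_implies_not_eq)
  have int: "\<exists>n. of_int d * Poly_Mapping.lookup x f = of_int n" for f
  proof (cases "f \<in> Poly_Mapping.keys x")
    case True
    define a b where ab: "a = fst (quotient_of (Poly_Mapping.lookup x f))" "b = snd (quotient_of (Poly_Mapping.lookup x f))"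
    have "b > 0" unfolding ab by (rule quotient_of_denom_pos')
    have x: "Poly_Mapping.lookup x f = of_int a / of_int b"
      unfolding ab by (rule quotient_of_div) simp
    have "d = b * (\<Prod>f\<in>Poly_Mapping.keys x - {f}. snd (quotient_of (Poly_Mapping.lookup x f)))"
      unfolding d_def ab using True by (simp add: prod.remove)
    then have "of_int d * Poly_Mapping.lookup x f = of_int (a * (\<Prod>f\<in>Poly_Mapping.keys x - {f}. snd (quotient_of (Poly_Mapping.lookup x f))))"
      unfolding x using \<open>b > 0\<close> by simp
    then show ?thesis ..
  next
    case False
    then show ?thesis by (intro exI[of _ 0]) (simp add: in_keys_iff)
  qed
  \<comment> \<open>The scaled coefficients are integers, so the floor is exact; it serves only to
    return to the type of integers.\<close>
  define c where "c = Poly_Mapping.map (\<lambda>q. \<lfloor>of_int d * q\<rfloor>) x"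
  have "Poly_Mapping.lookup c f = \<lfloor>of_int d * Poly_Mapping.lookup x f\<rfloor>" for f
    by (simp add: c_def Poly_Mapping.map.rep_eq when_def)
  then have "rat_scale (of_int d) x = rat_of_int_chain c"
    using int by (intro rat_chain_eqI) (metis floor_of_int lookup_rat_of_int_chain lookup_rat_scale)
  then show ?thesis using \<open>d \<noteq> 0\<close> by blast
qed

lemma int_pow_relcycle_group:
  assumes "c \<in> carrier (relcycle_group p X S)"
  shows "c [^]\<^bsub>relcycle_group p X S\<^esub> (n :: int) = frag_cmul n c"
proof -
  have "c [^]\<^bsub>relcycle_group p X S\<^esub> n = c [^]\<^bsub>chain_group p X\<^esub> n"
    using assms unfolding relcycle_group_def
    by (rule group.int_pow_subgroup_generated[OF group_chain_group])
  also have "\<dots> = frag_cmul n c"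
    using assms unfolding chain_group_def
    by (intro int_pow_free_Abelian_group) (auto simp: singular_relcycle singular_chain_def)
  finally show ?thesis .
qed

text \<open>Translates the multiplicative notation of \<open>lin_comb\<close> into a sum of
  chains.\<close>

lemma lin_comb_relcycle_group:
  assumes "finite I" "\<And>i. i \<in> I \<Longrightarrow> c i \<in> carrier (relcycle_group p X S)"
  shows "lin_comb (relcycle_group p X S) c a I = (\<Sum>i\<in>I. frag_cmul (a i) (c i))"
proof -
  let ?G = "relcycle_group p X S"
  interpret comm_group ?G by simp
  show ?thesis
    using assms
  proof (induction I rule: finite_induct)
    case empty
    have "lin_comb ?G c a {} = \<one>\<^bsub>?G\<^esub>" unfolding lin_comb_def by (rule finprod_empty)
    then show ?case by simp
  next
    case (insert i I)
    have "c j [^]\<^bsub>?G\<^esub> a j \<in> carrier ?G" if "j \<in> insert i I" for j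
      using insert.prems[OF that] by (rule int_pow_closed)
    then have "lin_comb ?G c a (insert i I) = c i [^]\<^bsub>?G\<^esub> a i \<otimes>\<^bsub>?G\<^esub> lin_comb ?G c a I"
      unfolding lin_comb_def using insert.hyps by (intro finprod_insert) auto
    moreover have "lin_comb ?G c a I = (\<Sum>i\<in>I. frag_cmul (a i) (c i))"
      using insert.prems by (intro insert.IH) blast
    moreover have "c i [^]\<^bsub>?G\<^esub> a i = frag_cmul (a i) (c i)"
      by (rule int_pow_relcycle_group[OF insert.prems]) simp
    ultimately show ?case using insert.hyps by simp
  qed
qed

lemma rat_homology_eq: "rat_homology p X = quotient_module rat_scale (rat_cycles p X) (rat_boundaries p X)"
  by (simp add: rat_homology_def quotient_module_def rat_class_def[abs_def])

text \<open>Scaled by suitable d_i, more than n rational cycles become integral. Their integral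
  homology classes satisfy a relation with coefficients a_i, and a_i d_i is then a relation between
  the original cycles modulo rational boundaries.\<close>

lemma fin_dim_rat_homology:
  assumes r: "rank_le (homology_group (int p) X) n"
  shows "vectorspace.fin_dim class_ring (rat_homology p X) \<and>
         vectorspace.dim class_ring (rat_homology p X) \<le> n"
proof -
  \<comment> \<open>Clearing denominators reduces this to the integral fact that a boundary has
    boundary 0.\<close>
  have "rat_boundaries p X \<subseteq> rat_cycles p X"
  proof
    fix x assume "x \<in> rat_boundaries p X"
    then obtain w where w: "w \<in> rat_chains (Suc p) X" "x = rat_boundary (Suc p) w"
      unfolding rat_boundaries_def by blast
    obtain d c where dc: "d \<noteq> 0" "rat_scale (of_int d) w = rat_of_int_chain c"
      using clear_denominators by blast
    have wc: "w = rat_scale (1 / of_int d) (rat_of_int_chain c)"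
      using dc(1) by (simp flip: dc(2))
    have "Poly_Mapping.keys c \<subseteq> Poly_Mapping.keys w"
      using keys_rat_scale[of "of_int d" w] unfolding dc(2) by simp
    then have c: "singular_chain (Suc p) X c"
      using w(1) by (auto simp: rat_chains_def singular_chain_def)
    have x: "x = rat_scale (1 / of_int d) (rat_of_int_chain (chain_boundary (Suc p) c))"
      unfolding w(2) wc rat_boundary_scale rat_boundary_of_int_chain ..
    have "singular_chain p X (chain_boundary (Suc p) c)"
      using singular_chain_boundary[OF c] by simp
    then have "x \<in> rat_chains p X"
      using keys_rat_scale[of "1 / of_int d" "rat_of_int_chain (chain_boundary (Suc p) c)"]
      unfolding x by (auto simp: rat_chains_def singular_chain_def)
    moreover have "rat_boundary p x = 0"
      unfolding x rat_boundary_scale rat_boundary_of_int_chain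
      using chain_boundary_boundary[OF c] by simp
    ultimately show "x \<in> rat_cycles p X" by (simp add: rat_cycles_def)
  qed
  then interpret S: rational_subquotient rat_scale "rat_cycles p X" "rat_boundaries p X"
    using subspace_rat_cycles subspace_rat_boundaries by unfold_locales
  show ?thesis
    unfolding rat_homology_eq
  proof (rule S.fin_dim_dim_le)
    fix I :: "nat set" and z :: "nat \<Rightarrow> 'a rat_chain"
    assume I: "finite I" "n < card I" and z: "\<And>i. i \<in> I \<Longrightarrow> z i \<in> rat_cycles p X"
    let ?C = "relcycle_group p X {}" and ?H = "homology_group (int p) X"
    have "\<forall>i. \<exists>dc. fst dc \<noteq> 0 \<and> rat_scale (of_int (fst dc)) (z i) = rat_of_int_chain (snd dc)"
    proof
      fix i
      obtain d c where "d \<noteq> 0 \<and> rat_scale (of_int d) (z i) = rat_of_int_chain c"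
        using clear_denominators by blast
      then show "\<exists>dc. fst dc \<noteq> 0 \<and> rat_scale (of_int (fst dc)) (z i) = rat_of_int_chain (snd dc)"
        by (intro exI[of _ "(d, c)"]) simp
    qed
    from choice[OF this] obtain dc
      where "\<forall>i. fst (dc i) \<noteq> 0 \<and> rat_scale (of_int (fst (dc i))) (z i) = rat_of_int_chain (snd (dc i))" ..
    moreover define d c where "d = (\<lambda>i. fst (dc i))" and "c = (\<lambda>i. snd (dc i))"
    ultimately have d: "\<And>i. d i \<noteq> 0" and dc: "\<And>i. rat_scale (of_int (d i)) (z i) = rat_of_int_chain (c i)"
      by simp_all
    \<comment> \<open>A multiple of a cycle is a cycle, and an integral chain with vanishing
      rational boundary has vanishing integral boundary.\<close>
    have c: "c i \<in> carrier ?C" if i: "i \<in> I" for i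
    proof -
      have "rat_scale (of_int (d i)) (z i) \<in> rat_cycles p X"
        by (rule rat_chain.subspace_scale[OF subspace_rat_cycles z[OF i]])
      then have 1: "rat_of_int_chain (c i) \<in> rat_chains p X" "rat_boundary p (rat_of_int_chain (c i)) = 0"
        unfolding dc by (simp_all add: rat_cycles_def)
      then have "chain_boundary p (c i) = 0"
        unfolding rat_boundary_of_int_chain by (intro rat_of_int_chain_inject) simp
      then show ?thesis
        using 1(1) by (simp add: singular_cycle singular_chain_def rat_chains_def)
    qed
    let ?h = "homologous_rel_set p X {}"
    have h: "?h \<in> hom ?C ?H"
    proof (rule homI)
      show "?h x \<in> carrier ?H" if "x \<in> carrier ?C" for x
        using that by (simp add: carrier_relative_homology_group)
      have "normal (singular_relboundary_set p X {}) ?C"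
        by (rule normal_subgroup_singular_relboundary_relcycle)
      from normal.r_coset_hom_Mod[OF this]
      have "(\<lambda>a. {b. homologous_rel p X {} a b}) \<in> hom ?C ?H"
        unfolding right_coset_singular_relboundary nontrivial_relative_homology_group .
      then show "?h (x \<otimes>\<^bsub>?C\<^esub> y) = ?h x \<otimes>\<^bsub>?H\<^esub> ?h y" if "x \<in> carrier ?C" "y \<in> carrier ?C" for x y
        using that by (rule hom_mult)
    qed
    have "?h (c i) \<in> carrier ?H" if "i \<in> I" for i
      using h c[OF that] by (rule hom_in_carrier)
    from rank_leD[where x = "\<lambda>i. ?h (c i)", OF r I this]
    obtain a where a: "\<exists>i\<in>I. a i \<noteq> 0" "lin_comb ?H (\<lambda>i. ?h (c i)) a I = \<one>\<^bsub>?H\<^esub>" by blast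
    have "?h (lin_comb ?C c a I) = lin_comb ?H (\<lambda>i. ?h (c i)) a I"
      using h I(1) c by (intro hom_lin_comb) auto
    then have "?h (lin_comb ?C c a I) = singular_relboundary_set p X {}"
      unfolding a(2) by simp
    then have "singular_relboundary p X {} (\<Sum>i\<in>I. frag_cmul (a i) (c i))"
      using lin_comb_relcycle_group[OF I(1) c, of "\<lambda>i. i" a]
      unfolding homologous_rel_set_eq_relboundary by simp
    then obtain w where w: "singular_chain (Suc p) X w" "chain_boundary (Suc p) w = (\<Sum>i\<in>I. frag_cmul (a i) (c i))"
      unfolding singular_boundary by blast
    have "(\<Sum>i\<in>I. rat_scale (of_int (a i * d i)) (z i)) = (\<Sum>i\<in>I. rat_scale (of_int (a i)) (rat_of_int_chain (c i)))"
      by (intro sum.cong) (simp_all flip: dc)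
    also have "\<dots> = rat_of_int_chain (\<Sum>i\<in>I. frag_cmul (a i) (c i))"
      by (simp add: rat_of_int_chain_sum rat_of_int_chain_cmul)
    also have "\<dots> = rat_boundary (Suc p) (rat_of_int_chain w)"
      unfolding w(2)[symmetric] rat_boundary_of_int_chain ..
    also have "\<dots> \<in> rat_boundaries p X"
      unfolding rat_boundaries_def using w(1) by (intro imageI) (simp add: rat_chains_def singular_chain_def)
    finally have "(\<Sum>i\<in>I. rat_scale (of_int (a i * d i)) (z i)) \<in> rat_boundaries p X" .
    moreover have "\<exists>i\<in>I. (of_int (a i * d i) :: rat) \<noteq> 0" using a(1) d by simp
    ultimately show "\<exists>q. (\<exists>i\<in>I. q i \<noteq> 0) \<and> (\<Sum>i\<in>I. rat_scale (q i) (z i)) \<in> rat_boundaries p X"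
      by (intro exI[of _ "\<lambda>i. of_int (a i * d i)"] conjI)
  qed
qed

section \<open>One-loop graphs\<close>

abbreviation linked :: "('v, 'e) legged_graph \<Rightarrow> 'e set \<Rightarrow> 'v \<Rightarrow> 'v \<Rightarrow> bool" where
  "linked G F u v \<equiv> (u, v) \<in> (adjacent G F)\<^sup>*"

lemma in_component_iff: "v \<in> component G F u \<longleftrightarrow> linked G F u v"
  by (simp add: component_def)

lemma adjacent_sym: "(u, v) \<in> adjacent G F \<Longrightarrow> (v, u) \<in> adjacent G F"
  by (auto simp: adjacent_def add_mset_commute)

lemma adjacentI: "e \<in> F \<Longrightarrow> ends G e = {#u, v#} \<Longrightarrow> (u, v) \<in> adjacent G F"
  by (auto simp: adjacent_def)

lemma linked_sym: "linked G F u v \<Longrightarrow> linked G F v u"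
proof (induction rule: rtrancl_induct)
  case (step y z)
  then show ?case using adjacent_sym[of y z] by (meson converse_rtrancl_into_rtrancl)
qed simp

lemma linked_mono: "F \<subseteq> F' \<Longrightarrow> linked G F u v \<Longrightarrow> linked G F' u v"
  by (rule rtrancl_mono[THEN subsetD]) (auto simp: adjacent_def)

lemma component_eq_iff: "component G F u = component G F v \<longleftrightarrow> linked G F u v"
proof
  assume "component G F u = component G F v"
  moreover have "v \<in> component G F v" by (simp add: in_component_iff)
  ultimately show "linked G F u v" by (simp add: in_component_iff[symmetric])
next
  assume uv: "linked G F u v"
  show "component G F u = component G F v"
  proof (intro equalityI subsetI)
    fix x assume "x \<in> component G F u"
    then show "x \<in> component G F v"
      unfolding in_component_iff using linked_sym[OF uv] by (meson rtrancl_trans)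
  next
    fix x assume "x \<in> component G F v"
    then show "x \<in> component G F u"
      unfolding in_component_iff using uv by (meson rtrancl_trans)
  qed
qed

locale legged =
  fixes s :: nat and G :: "('v, 'e) legged_graph"
  assumes legged: "legged_graph s G"
begin

lemma finite_verts: "finite (verts G)" and verts_nonempty: "verts G \<noteq> {}"
  and finite_edges: "finite (edges G)"
  and size_ends: "e \<in> edges G \<Longrightarrow> size (ends G e) = 2"
  and ends_subset: "e \<in> edges G \<Longrightarrow> set_mset (ends G e) \<subseteq> verts G"
  and leg_in_verts: "i \<in> {1..s} \<Longrightarrow> leg G i \<in> verts G"
  using legged by (auto simp: legged_graph_def)

lemma ends_pair:
  assumes "e \<in> edges G"
  obtains u v where "ends G e = {#u, v#}" "u \<in> verts G" "v \<in> verts G"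
proof -
  obtain u M where M: "ends G e = add_mset u M"
    using size_ends[OF assms] size_eq_Suc_imp_eq_union[of "ends G e" 1] by auto
  then have "size M = Suc 0" using size_ends[OF assms] by simp
  then obtain v where "M = {#v#}" using size_eq_Suc_imp_eq_union[of M 0] by auto
  with M have "ends G e = {#u, v#}" by simp
  then show ?thesis using that ends_subset[OF assms] by auto
qed

lemma adjacent_in_verts: "F \<subseteq> edges G \<Longrightarrow> (u, v) \<in> adjacent G F \<Longrightarrow> u \<in> verts G \<and> v \<in> verts G"
  using ends_subset by (fastforce simp: adjacent_def)

lemma linked_in_verts: "F \<subseteq> edges G \<Longrightarrow> linked G F u v \<Longrightarrow> u \<in> verts G \<Longrightarrow> v \<in> verts G"
  by (erule rtrancl_induct) (auto dest: adjacent_in_verts)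

lemma connected_byD: "connected_by G F \<Longrightarrow> u \<in> verts G \<Longrightarrow> v \<in> verts G \<Longrightarrow> linked G F u v"
  by (simp add: connected_by_def in_component_iff)

lemma crossing_edge:
  assumes "linked G F u w" "u \<in> U" "w \<notin> U"
  shows "\<exists>x y. (x, y) \<in> adjacent G F \<and> x \<in> U \<and> y \<notin> U"
  using assms by (induction rule: rtrancl_induct) blast+

lemma card_verts_le_of_connected:
  assumes F: "F \<subseteq> edges G" and conn: "connected_by G F"
  shows "card (verts G) \<le> card F + 1"
proof -
  have finF: "finite F" using F finite_edges finite_subset by blast
  have "\<exists>U F'. U \<subseteq> verts G \<and> card U = Suc k \<and> F' \<subseteq> F \<and> card F' = k \<and> (\<forall>e\<in>F'. set_mset (ends G e) \<subseteq> U)"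
    if "k < card (verts G)" for k
    using that
  proof (induction k)
    case 0
    obtain v where "v \<in> verts G" using verts_nonempty by blast
    then show ?case by (intro exI[of _ "{v}"] exI[of _ "{}"]) auto
  next
    case (Suc k)
    then obtain U F' where U: "U \<subseteq> verts G" "card U = Suc k" "F' \<subseteq> F" "card F' = k"
      "\<forall>e\<in>F'. set_mset (ends G e) \<subseteq> U" by auto
    have finU: "finite U" using U(1) finite_verts finite_subset by blast
    obtain u where u: "u \<in> U" using U(2) by fastforce
    have "\<not> verts G \<subseteq> U" using card_mono[OF finU, of "verts G"] U(2) Suc.prems by linarith
    then obtain w where w: "w \<in> verts G" "w \<notin> U" by blast
    obtain x y where xy: "(x, y) \<in> adjacent G F" "x \<in> U" "y \<notin> U"
      using crossing_edge[OF connected_byD[OF conn _ w(1)], of u U] u U(1) w(2) by blast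
    obtain e where e: "e \<in> F" "ends G e = {#x, y#}" using xy(1) by (auto simp: adjacent_def)
    have "e \<notin> F'" using U(5) e(2) xy(3) by auto
    moreover have "y \<in> verts G" using adjacent_in_verts[OF F xy(1)] by simp
    moreover have "finite F'" using U(3) finF finite_subset by blast
    ultimately show ?case
      using U e xy finU by (intro exI[of _ "insert y U"] exI[of _ "insert e F'"]) auto
  qed
  moreover have "card (verts G) - 1 < card (verts G)"
    using finite_verts verts_nonempty by (simp add: card_gt_0_iff)
  ultimately obtain F' where "F' \<subseteq> F" "card F' = card (verts G) - 1" by blast
  then show ?thesis using card_mono[OF finF, of F'] by linarith
qed

text \<open>Every passage through e can be rerouted along the given link between its ends.\<close>

lemma connected_by_remove:
  assumes conn: "connected_by G F" and e: "ends G e = {#u, v#}" and uv: "linked G (F - {e}) u v"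
  shows "connected_by G (F - {e})"
  unfolding connected_by_def in_component_iff
proof (intro ballI)
  have step: "linked G (F - {e}) x y" if xy: "(x, y) \<in> adjacent G F" for x y
  proof -
    obtain f where f: "f \<in> F" "ends G f = {#x, y#}" using xy by (auto simp: adjacent_def)
    show ?thesis
    proof (cases "f = e")
      case True
      then have "x = u \<and> y = v \<or> x = v \<and> y = u"
        using f(2) e by (auto simp: add_eq_conv_ex)
      then show ?thesis using uv linked_sym[OF uv] by auto
    next
      case False
      then show ?thesis using f adjacentI[of f "F - {e}" G x y] by blast
    qed
  qed
  fix a b assume "a \<in> verts G" "b \<in> verts G"
  then have "linked G F a b" by (rule connected_byD[OF conn])
  then show "linked G (F - {e}) a b"
    by (induction rule: rtrancl_induct) (auto intro: step rtrancl_trans)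
qed

lemma simple_path:
  assumes "linked G F u v"
  shows "\<exists>vs es. length vs = Suc (length es) \<and> distinct vs \<and> distinct es \<and> set es \<subseteq> F \<and>
    vs ! 0 = u \<and> vs ! length es = v \<and> (\<forall>i<length es. ends G (es ! i) = {#vs ! i, vs ! Suc i#})"
  using assms
proof (induction rule: converse_rtrancl_induct)
  case base
  show ?case by (intro exI[of _ "[v]"] exI[of _ "[]"]) auto
next
  case (step x y)
  then obtain vs es where p: "length vs = Suc (length es)" "distinct vs" "distinct es" "set es \<subseteq> F"
    "vs ! 0 = y" "vs ! length es = v" "\<And>i. i < length es \<Longrightarrow> ends G (es ! i) = {#vs ! i, vs ! Suc i#}"
    by blast
  show ?case
  proof (cases "x \<in> set vs")
    \<comment> \<open>The new starting vertex already lies on the path; the part of the path from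
      there on is simple.\<close>
    case True
    then obtain i where i: "i < length vs" "vs ! i = x" by (auto simp: in_set_conv_nth)
    show ?thesis
    proof (intro exI[of _ "drop i vs"] exI[of _ "drop i es"] conjI allI impI)
      show "length (drop i vs) = Suc (length (drop i es))" using i(1) p(1) by auto
      show "set (drop i es) \<subseteq> F" using p(4) set_drop_subset by fastforce
      show "drop i vs ! 0 = x" using i by simp
      show "drop i vs ! length (drop i es) = v" using i p(1,6) by simp
      show "ends G (drop i es ! j) = {#drop i vs ! j, drop i vs ! Suc j#}" if "j < length (drop i es)" for j
        using p(7)[of "i + j"] that i p(1) by simp
    qed (use p in auto)
  next
    case False
    obtain f where f: "f \<in> F" "ends G f = {#x, y#}" using step.hyps(1) by (auto simp: adjacent_def)
    \<comment> \<open>The edges of the path have both ends on it, whereas x is not on it.\<close>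
    have "f \<notin> set es"
    proof
      assume "f \<in> set es"
      then obtain i where i: "i < length es" "es ! i = f" by (auto simp: in_set_conv_nth)
      have "x \<in># ends G (es ! i)" unfolding i(2) f(2) by simp
      then have "x = vs ! i \<or> x = vs ! Suc i" unfolding p(7)[OF i(1)] by auto
      then have "x \<in> set vs" using i(1) p(1) by auto
      then show False using False by simp
    qed
    show ?thesis
    proof (intro exI[of _ "x # vs"] exI[of _ "f # es"] conjI allI impI)
      show "ends G ((f # es) ! i) = {#(x # vs) ! i, (x # vs) ! Suc i#}" if "i < length (f # es)" for i
        using that p(7)[of "i - 1"] p(5) f(2) by (cases i) auto
    qed (use p f False \<open>f \<notin> set es\<close> in auto)
  qed
qed

end

locale one_loop = legged s G for s :: nat and G :: "('v, 'e) legged_graph" +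
  assumes admissible: "admissible s G" and betti1: "betti1 G = 1"
begin

lemma connected: "connected_by G (edges G)"
  and bridgeless: "e \<in> edges G \<Longrightarrow> connected_by G (edges G - {e})"
  and valency_ge: "v \<in> verts G \<Longrightarrow> 3 \<le> valency s G v"
  using admissible by (auto simp: admissible_def)

lemma card_edges: "card (edges G) = card (verts G)"
proof -
  have "component G (edges G) v = verts G" if "v \<in> verts G" for v
    using connected_byD[OF connected that] linked_in_verts[OF order_refl _ that]
    by (auto simp: in_component_iff)
  then have "component G (edges G) ` verts G = {verts G}"
    using verts_nonempty by auto
  then show ?thesis using betti1 by (simp add: betti1_def)
qed

lemma edges_nonempty: "edges G \<noteq> {}"
  using card_edges finite_verts verts_nonempty by auto

text \<open>Otherwise e' and then e could be removed without disconnecting the graph. As there are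
  as many edges as vertices, this would leave two edges fewer than vertices, one too few for
  connectedness.\<close>

lemma not_linked_remove_two:
  assumes e: "e \<in> edges G" "ends G e = {#u, v#}" and e': "e' \<in> edges G" "e' \<noteq> e"
  shows "\<not> linked G (edges G - {e, e'}) u v"
proof
  assume uv: "linked G (edges G - {e, e'}) u v"
  have eq: "edges G - {e'} - {e} = edges G - {e, e'}" by blast
  then have "connected_by G (edges G - {e, e'})"
    using connected_by_remove[OF bridgeless[OF e'(1)] e(2)] uv by simp
  then have "card (verts G) \<le> card (edges G - {e, e'}) + 1"
    by (rule card_verts_le_of_connected[rotated]) blast
  moreover have "card (edges G - {e, e'}) = card (edges G) - 2"
    using e e' finite_edges by (simp add: card_Diff_subset)
  moreover have "card {e, e'} \<le> card (edges G)"
    using e e' finite_edges by (intro card_mono) auto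
  \<comment> \<open>Excludes truncation in the subtraction of naturals above.\<close>
  then have "2 \<le> card (edges G)" using e'(2) by simp
  ultimately show False using card_edges by linarith
qed

text \<open>An edge and a simple path between its ends that avoids it form a cycle, so the set of
  all edges is no forest. Conversely, a cycle missing an edge e0 would link the ends of its first
  edge without using that edge or e0.\<close>

lemma forest_iff:
  assumes Z: "Z \<subseteq> edges G"
  shows "forest G Z \<longleftrightarrow> Z \<noteq> edges G"
proof
  assume "forest G Z"
  show "Z \<noteq> edges G"
  proof
    assume "Z = edges G"
    obtain e where e: "e \<in> edges G" using edges_nonempty by blast
    obtain u v where uv: "ends G e = {#u, v#}" "u \<in> verts G" "v \<in> verts G" using ends_pair[OF e] .
    obtain vs es where p: "length vs = Suc (length es)" "distinct vs" "distinct es" "set es \<subseteq> edges G - {e}"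
      "vs ! 0 = u" "vs ! length es = v" "\<And>i. i < length es \<Longrightarrow> ends G (es ! i) = {#vs ! i, vs ! Suc i#}"
      using simple_path[OF connected_byD[OF bridgeless[OF e] uv(2,3)]] by blast
    have "is_cycle G vs (es @ [e])"
      unfolding is_cycle_def
    proof (intro conjI allI impI)
      fix i assume i: "i < length (es @ [e])"
      show "ends G ((es @ [e]) ! i) = {#vs ! i, vs ! (Suc i mod length (es @ [e]))#}"
      proof (cases "i < length es")
        case True
        then show ?thesis using p(7)[OF True] by (simp add: nth_append)
      next
        case False
        then have "i = length es" using i by simp
        then show ?thesis using p(5,6) uv(1) by (simp add: add_mset_commute)
      qed
    qed (use p in auto)
    moreover have "set (es @ [e]) \<subseteq> Z" using p(4) e \<open>Z = edges G\<close> by auto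
    ultimately show False using \<open>forest G Z\<close> unfolding forest_def by blast
  qed
next
  assume "Z \<noteq> edges G"
  then obtain e0 where e0: "e0 \<in> edges G" "e0 \<notin> Z" using Z by blast
  show "forest G Z"
    unfolding forest_def
  proof (intro notI, elim exE conjE)
    fix vs es assume es: "set es \<subseteq> Z" and c: "is_cycle G vs es"
    define n where "n = length es"
    have n: "0 < n" "length vs = n" "distinct es"
      and ends: "\<And>i. i < n \<Longrightarrow> ends G (es ! i) = {#vs ! i, vs ! (Suc i mod n)#}"
      using c by (auto simp: is_cycle_def n_def)
    let ?e = "es ! 0" and ?F = "edges G - {es ! 0, e0}"
    have inZ: "es ! i \<in> Z" if "i < n" for i using es that unfolding n_def by (meson nth_mem subsetD)
    have e: "?e \<in> edges G" "e0 \<noteq> ?e" using inZ[OF n(1)] Z e0 by auto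
    have inF: "es ! i \<in> ?F" if "0 < i" "i < n" for i
      using inZ[OF that(2)] Z e0 that n(1,3) nth_eq_iff_index_eq[of es i 0] by (auto simp: n_def)
    \<comment> \<open>Walk along the cycle from its second vertex back to the first. The index mod n
      also covers a self-loop, where n = 1 and the two coincide.\<close>
    have path: "linked G ?F (vs ! (1 mod n)) (vs ! (Suc j mod n))" if "j < n" for j
      using that
    proof (induction j)
      case (Suc j)
      have "linked G ?F (vs ! (1 mod n)) (vs ! (Suc j mod n))" using Suc by simp
      moreover have "(vs ! (Suc j mod n), vs ! (Suc (Suc j) mod n)) \<in> adjacent G ?F"
        using inF[of "Suc j"] ends[of "Suc j"] Suc.prems by (intro adjacentI[of "es ! Suc j"]) auto
      ultimately show ?case by (rule rtrancl_into_rtrancl)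
    qed simp
    have "linked G ?F (vs ! (1 mod n)) (vs ! 0)" using path[of "n - 1"] n(1) by simp
    then have "linked G ?F (vs ! 0) (vs ! (1 mod n))" by (rule linked_sym)
    moreover have "ends G ?e = {#vs ! 0, vs ! (1 mod n)#}" using ends[of 0] n(1) by simp
    ultimately show False using not_linked_remove_two[OF e(1) _ e0(1) e(2)] by blast
  qed
qed

definition degree :: "'v \<Rightarrow> nat" where
  "degree v = (\<Sum>e\<in>edges G. count (ends G e) v)"

text \<open>Each edge has two ends, and there are as many edges as vertices.\<close>

lemma sum_degree: "(\<Sum>v\<in>verts G. degree v) = 2 * card (verts G)"
proof -
  have "(\<Sum>v\<in>verts G. degree v) = (\<Sum>e\<in>edges G. \<Sum>v\<in>verts G. count (ends G e) v)"
    unfolding degree_def by (rule sum.swap)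
  also have "\<dots> = (\<Sum>e\<in>edges G. 2)"
  proof (rule sum.cong[OF refl])
    fix e assume e: "e \<in> edges G"
    have "(\<Sum>v\<in>verts G. count (ends G e) v) = (\<Sum>v\<in>set_mset (ends G e). count (ends G e) v)"
      using ends_subset[OF e] finite_verts by (intro sum.mono_neutral_right) (auto simp: not_in_iff)
    also have "\<dots> = size (ends G e)" by (simp add: size_multiset_overloaded_eq)
    finally show "(\<Sum>v\<in>verts G. count (ends G e) v) = 2" using size_ends[OF e] by simp
  qed
  finally show ?thesis using card_edges by simp
qed

text \<open>If at most one edge end lies at v, removing that edge isolates v. Hence v is the only
  vertex, but then both ends of the edge lie at v.\<close>

lemma degree_ge_2:
  assumes v: "v \<in> verts G"
  shows "2 \<le> degree v"
proof (rule ccontr)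
  assume "\<not> 2 \<le> degree v"
  then have small: "(\<Sum>e\<in>edges G. count (ends G e) v) \<le> 1" by (simp add: degree_def)
  obtain e where e: "e \<in> edges G" and rest: "\<And>f. f \<in> edges G - {e} \<Longrightarrow> v \<notin># ends G f"
  proof (cases "\<exists>e\<in>edges G. v \<in># ends G e")
    case True
    then obtain e where e: "e \<in> edges G" "v \<in># ends G e" by blast
    have "v \<notin># ends G f" if f: "f \<in> edges G - {e}" for f
    proof
      assume vf: "v \<in># ends G f"
      have "(\<Sum>e\<in>{e, f}. count (ends G e) v) \<le> (\<Sum>e\<in>edges G. count (ends G e) v)"
        using e f finite_edges by (intro sum_mono2) auto
      then have "count (ends G e) v + count (ends G f) v \<le> 1" using small f by auto
      moreover have "0 < count (ends G e) v" "0 < count (ends G f) v" using e vf by auto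
      ultimately show False by linarith
    qed
    then show ?thesis using that e by blast
  next
    case False
    then show ?thesis using that edges_nonempty by blast
  qed
  have "verts G \<subseteq> {v}"
  proof
    fix w assume w: "w \<in> verts G"
    have "linked G (edges G - {e}) v w" by (rule connected_byD[OF bridgeless[OF e] v w])
    then show "w \<in> {v}"
    proof (cases rule: converse_rtranclE)
      case (step y)
      then show ?thesis using rest by (force simp: adjacent_def)
    qed simp
  qed
  then have "set_mset (ends G e) \<subseteq> {v}" using ends_subset[OF e] by blast
  then have "size (ends G e) = (\<Sum>w\<in>{v}. count (ends G e) w)"
    unfolding size_multiset_overloaded_eq by (intro sum.mono_neutral_left) (auto simp: not_in_iff)
  then have "count (ends G e) v = 2" using size_ends[OF e] by simp
  moreover have "count (ends G e) v \<le> (\<Sum>e\<in>edges G. count (ends G e) v)"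
    using e finite_edges by (intro member_le_sum) auto
  ultimately show False using small by linarith
qed

text \<open>The average degree is 2 and no degree is smaller.\<close>

lemma degree_eq_2:
  assumes v: "v \<in> verts G"
  shows "degree v = 2"
proof -
  have "(\<Sum>w\<in>verts G. degree w) = degree v + (\<Sum>w\<in>verts G - {v}. degree w)"
    using v finite_verts by (simp add: sum.remove)
  moreover have "(\<Sum>w\<in>verts G - {v}. 2) \<le> (\<Sum>w\<in>verts G - {v}. degree w)"
    by (intro sum_mono degree_ge_2) auto
  moreover have "card (verts G - {v}) = card (verts G) - 1" using v finite_verts by simp
  moreover have "0 < card (verts G)" using v finite_verts card_gt_0_iff by blast
  ultimately have "degree v \<le> 2" using sum_degree by simp
  then show ?thesis using degree_ge_2[OF v] by simp
qed

text \<open>Internal edges contribute only 2 to a valency of at least 3.\<close>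

lemma leg_surj:
  assumes v: "v \<in> verts G"
  shows "\<exists>i\<in>{1..s}. leg G i = v"
proof (rule ccontr)
  assume "\<not> ?thesis"
  then have "{i \<in> {1..s}. leg G i = v} = {}" by blast
  then have "valency s G v = degree v" by (simp only: valency_def degree_def card.empty add_0_right)
  then show False using valency_ge[OF v] degree_eq_2[OF v] by simp
qed

lemma card_verts_le: "card (verts G) \<le> s"
proof -
  have "verts G \<subseteq> leg G ` {1..s}" using leg_surj by force
  then have "card (verts G) \<le> card (leg G ` {1..s})" by (intro card_mono) auto
  also have "\<dots> \<le> s" using card_image_le[of "{1..s}" "leg G"] by simp
  finally show ?thesis .
qed

end

section \<open>Collapsed graphs\<close>

lemma add_mset_pair_eq: "{#a, b#} = {#c, d#} \<longleftrightarrow> a = c \<and> b = d \<or> a = d \<and> b = c"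
  by (auto simp: add_eq_conv_ex)

text \<open>Encodes an isomorphism from G/Z to G'/Z' by a correspondence T between the vertices
  before collapsing. When further edges are collapsed, Z and Z' grow but T stays the same; this
  avoids vertices that are sets of sets of vertices.\<close>

definition collapse_rel ::
  "nat \<Rightarrow> ('v, 'e) legged_graph \<Rightarrow> 'e set \<Rightarrow> ('w, 'f) legged_graph \<Rightarrow> 'f set \<Rightarrow>
   ('v \<Rightarrow> 'w \<Rightarrow> bool) \<Rightarrow> ('e \<Rightarrow> 'f) \<Rightarrow> bool" where
  "collapse_rel s G Z G' Z' T \<psi> \<longleftrightarrow>
     bij_betw \<psi> (edges G - Z) (edges G' - Z') \<and>
     (\<forall>u u'. T u u' \<longrightarrow> u \<in> verts G \<and> u' \<in> verts G') \<and>
     (\<forall>u\<in>verts G. \<exists>u'. T u u') \<and> (\<forall>u'\<in>verts G'. \<exists>u. T u u') \<and>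
     (\<forall>i\<in>{1..s}. T (leg G i) (leg G' i)) \<and>
     (\<forall>u u' v v'. T u u' \<longrightarrow> T v v' \<longrightarrow> (linked G Z u v \<longleftrightarrow> linked G' Z' u' v')) \<and>
     (\<forall>e\<in>edges G - Z. \<forall>u v. ends G e = {#u, v#} \<longrightarrow>
        (\<exists>u' v'. ends G' (\<psi> e) = {#u', v'#} \<and> T u u' \<and> T v v'))"

lemma collapse_relI:
  assumes "bij_betw \<psi> (edges G - Z) (edges G' - Z')"
    and "\<And>u u'. T u u' \<Longrightarrow> u \<in> verts G \<and> u' \<in> verts G'"
    and "\<And>u. u \<in> verts G \<Longrightarrow> \<exists>u'. T u u'" "\<And>u'. u' \<in> verts G' \<Longrightarrow> \<exists>u. T u u'"
    and "\<And>i. i \<in> {1..s} \<Longrightarrow> T (leg G i) (leg G' i)"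
    and "\<And>u u' v v'. T u u' \<Longrightarrow> T v v' \<Longrightarrow> linked G Z u v \<longleftrightarrow> linked G' Z' u' v'"
    and "\<And>e u v. e \<in> edges G - Z \<Longrightarrow> ends G e = {#u, v#} \<Longrightarrow>
        \<exists>u' v'. ends G' (\<psi> e) = {#u', v'#} \<and> T u u' \<and> T v v'"
  shows "collapse_rel s G Z G' Z' T \<psi>"
  unfolding collapse_rel_def using assms by blast

lemma collapse_relD:
  assumes "collapse_rel s G Z G' Z' T \<psi>"
  shows "bij_betw \<psi> (edges G - Z) (edges G' - Z')"
    and "\<And>u u'. T u u' \<Longrightarrow> u \<in> verts G" "\<And>u u'. T u u' \<Longrightarrow> u' \<in> verts G'"
    and "\<And>u. u \<in> verts G \<Longrightarrow> \<exists>u'. T u u'" "\<And>u'. u' \<in> verts G' \<Longrightarrow> \<exists>u. T u u'"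
    and "\<And>i. i \<in> {1..s} \<Longrightarrow> T (leg G i) (leg G' i)"
    and "\<And>u u' v v'. T u u' \<Longrightarrow> T v v' \<Longrightarrow> linked G Z u v \<longleftrightarrow> linked G' Z' u' v'"
    and "\<And>e u v. e \<in> edges G - Z \<Longrightarrow> ends G e = {#u, v#} \<Longrightarrow>
        \<exists>u' v'. ends G' (\<psi> e) = {#u', v'#} \<and> T u u' \<and> T v v'"
  using assms unfolding collapse_rel_def by blast+

lemma collapse_rel_of_iso:
  assumes G: "legged_graph s G" and G': "legged_graph s G'"
    and iso: "graph_iso s (collapse G Z) (collapse G' Z') \<phi> \<psi>"
  shows "collapse_rel s G Z G' Z'
    (\<lambda>u u'. u \<in> verts G \<and> u' \<in> verts G' \<and> component G' Z' u' = \<phi> (component G Z u)) \<psi>"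
proof -
  interpret G: legged s G by (rule legged.intro[OF G])
  interpret G': legged s G' by (rule legged.intro[OF G'])
  let ?T = "\<lambda>u u'. u \<in> verts G \<and> u' \<in> verts G' \<and> component G' Z' u' = \<phi> (component G Z u)"
  have b: "bij_betw \<phi> (component G Z ` verts G) (component G' Z' ` verts G')"
    and e: "bij_betw \<psi> (edges G - Z) (edges G' - Z')"
    and ends: "\<And>e. e \<in> edges G - Z \<Longrightarrow> image_mset (component G' Z') (ends G' (\<psi> e))
        = image_mset \<phi> (image_mset (component G Z) (ends G e))"
    and legs: "\<And>i. i \<in> {1..s} \<Longrightarrow> component G' Z' (leg G' i) = \<phi> (component G Z (leg G i))"
    using iso by (simp_all add: graph_iso_def collapse_def)
  show ?thesis
  proof (rule collapse_relI[OF e])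
    show "\<exists>u'. ?T u u'" if "u \<in> verts G" for u
    proof -
      have "\<phi> (component G Z u) \<in> component G' Z' ` verts G'"
        using b that unfolding bij_betw_def by blast
      then show ?thesis using that by force
    qed
    show "\<exists>u. ?T u u'" if "u' \<in> verts G'" for u'
    proof -
      have "component G' Z' u' \<in> \<phi> ` component G Z ` verts G"
        using b that unfolding bij_betw_def by blast
      then show ?thesis using that by force
    qed
    show "?T (leg G i) (leg G' i)" if "i \<in> {1..s}" for i
      using legs[OF that] G.leg_in_verts[OF that] G'.leg_in_verts[OF that] by simp
    show "linked G Z u v \<longleftrightarrow> linked G' Z' u' v'" if "?T u u'" "?T v v'" for u u' v v'
    proof -
      have "inj_on \<phi> (component G Z ` verts G)" using b by (simp add: bij_betw_def)
      then have "\<phi> (component G Z u) = \<phi> (component G Z v) \<longleftrightarrow> component G Z u = component G Z v"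
        using that by (intro inj_on_eq_iff) auto
      then show ?thesis using that unfolding component_eq_iff[symmetric] by metis
    qed
    show "\<exists>u' v'. ends G' (\<psi> e) = {#u', v'#} \<and> ?T u u' \<and> ?T v v'"
      if f: "e \<in> edges G - Z" "ends G e = {#u, v#}" for e u v
    proof -
      have uv: "u \<in> verts G" "v \<in> verts G" using G.ends_subset[of e] f by auto
      have "\<psi> e \<in> edges G'" using e f(1) by (auto simp: bij_betw_def)
      then obtain a b where ab: "ends G' (\<psi> e) = {#a, b#}" "a \<in> verts G'" "b \<in> verts G'"
        by (rule G'.ends_pair)
      have "{#component G' Z' a, component G' Z' b#} = {#\<phi> (component G Z u), \<phi> (component G Z v)#}"
        using ends[OF f(1)] unfolding f(2) ab(1) by simp
      then consider "?T u a" "?T v b" | "?T u b" "?T v a"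
        unfolding add_mset_pair_eq using uv ab by blast
      then show ?thesis
      proof cases
        case 1
        then show ?thesis using ab(1) by blast
      next
        case 2
        moreover have "ends G' (\<psi> e) = {#b, a#}" using ab(1) by (simp add: add_mset_commute)
        ultimately show ?thesis by blast
      qed
    qed
  qed auto
qed

text \<open>T respects components in both directions, so any vertex of a component and any partner
  of it define the same image component.\<close>

lemma iso_of_collapse_rel:
  assumes G: "legged_graph s G" and G': "legged_graph s G'" and T: "collapse_rel s G Z G' Z' T \<psi>"
  shows "\<exists>\<phi>. graph_iso s (collapse G Z) (collapse G' Z') \<phi> \<psi>"
proof -
  interpret G: legged s G by (rule legged.intro[OF G])
  interpret G': legged s G' by (rule legged.intro[OF G'])
  note T = collapse_relD[OF T]
  define f where "f C = (SOME u. u \<in> verts G \<and> component G Z u = C)" for C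
  define g where "g u = (SOME u'. T u u')" for u
  define \<phi> where "\<phi> C = component G' Z' (g (f C))" for C
  have g: "T u (g u)" if "u \<in> verts G" for u
    unfolding g_def using T(4)[OF that] by (rule someI_ex)
  have \<phi>: "\<phi> (component G Z u) = component G' Z' u'" if "T u u'" for u u'
  proof -
    have u: "u \<in> verts G" using T(2)[OF that] .
    then have "\<exists>w. w \<in> verts G \<and> component G Z w = component G Z u" by blast
    then have f: "f (component G Z u) \<in> verts G" "component G Z (f (component G Z u)) = component G Z u"
      unfolding f_def using someI_ex[of "\<lambda>w. w \<in> verts G \<and> component G Z w = component G Z u"] by blast+
    then have "linked G Z (f (component G Z u)) u" unfolding component_eq_iff by blast
    then have "linked G' Z' (g (f (component G Z u))) u'"
      using T(7)[OF g[OF f(1)] that] by blast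
    then show ?thesis unfolding \<phi>_def component_eq_iff .
  qed
  have "graph_iso s (collapse G Z) (collapse G' Z') \<phi> \<psi>"
    unfolding graph_iso_def collapse_def legged_graph.simps
  proof (intro conjI ballI)
    show "bij_betw \<phi> (component G Z ` verts G) (component G' Z' ` verts G')"
      unfolding bij_betw_def
    proof
      show "inj_on \<phi> (component G Z ` verts G)"
      proof (rule inj_onI, elim imageE)
        fix C D u v assume C: "C = component G Z u" "u \<in> verts G" and D: "D = component G Z v" "v \<in> verts G"
          and eq: "\<phi> C = \<phi> D"
        have "component G' Z' (g u) = component G' Z' (g v)"
          using eq \<phi>[OF g[OF C(2)]] \<phi>[OF g[OF D(2)]] unfolding C(1) D(1) by simp
        then show "C = D"
          unfolding C(1) D(1) component_eq_iff using T(7)[OF g[OF C(2)] g[OF D(2)]] by blast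
      qed
      show "\<phi> ` component G Z ` verts G = component G' Z' ` verts G'"
      proof (intro equalityI subsetI)
        fix C assume "C \<in> \<phi> ` component G Z ` verts G"
        then obtain u where u: "u \<in> verts G" "C = \<phi> (component G Z u)" by blast
        then show "C \<in> component G' Z' ` verts G'"
          using \<phi>[OF g[OF u(1)]] T(3)[OF g[OF u(1)]] by simp
      next
        fix C assume "C \<in> component G' Z' ` verts G'"
        then obtain u' where u': "u' \<in> verts G'" "C = component G' Z' u'" by blast
        obtain u where u: "T u u'" using T(5)[OF u'(1)] by blast
        show "C \<in> \<phi> ` component G Z ` verts G"
          using \<phi>[OF u] T(2)[OF u] u'(2) by (metis imageI)
      qed
    qed
    show "bij_betw \<psi> (edges G - Z) (edges G' - Z')" by (rule T(1))
    show "image_mset (component G' Z') (ends G' (\<psi> e)) = image_mset \<phi> (image_mset (component G Z) (ends G e))"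
      if e: "e \<in> edges G - Z" for e
    proof -
      obtain u v where uv: "ends G e = {#u, v#}" using e by (auto elim: G.ends_pair)
      obtain u' v' where "ends G' (\<psi> e) = {#u', v'#}" "T u u'" "T v v'"
        using T(8)[OF e uv] by blast
      then show ?thesis using uv \<phi> by simp
    qed
    show "component G' Z' (leg G' i) = \<phi> (component G Z (leg G i))" if "i \<in> {1..s}" for i
      using \<phi>[OF T(6)[OF that]] by simp
  qed
  then show ?thesis by (intro exI[of _ \<phi>])
qed

lemma collapse_rel_sym:
  assumes G: "legged_graph s G" and G': "legged_graph s G'" and T: "collapse_rel s G Z G' Z' T \<psi>"
  shows "collapse_rel s G' Z' G Z (\<lambda>u' u. T u u') (inv_into (edges G - Z) \<psi>)"
proof -
  interpret G: legged s G by (rule legged.intro[OF G])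
  note T = collapse_relD[OF T]
  show ?thesis
  proof (rule collapse_relI)
    show "bij_betw (inv_into (edges G - Z) \<psi>) (edges G' - Z') (edges G - Z)"
      by (rule bij_betw_inv_into[OF T(1)])
    show "u' \<in> verts G' \<and> u \<in> verts G" if "T u u'" for u' u using T(2,3)[OF that] by blast
    show "linked G' Z' u' v' \<longleftrightarrow> linked G Z u v" if "T u u'" "T v v'" for u u' v v'
      using T(7)[OF that] by blast
    fix e' u' v' assume e': "e' \<in> edges G' - Z'" "ends G' e' = {#u', v'#}"
    define e where "e = inv_into (edges G - Z) \<psi> e'"
    have e: "e \<in> edges G - Z" "\<psi> e = e'"
      using bij_betw_inv_into_right[OF T(1) e'(1)] bij_betw_apply[OF bij_betw_inv_into[OF T(1)] e'(1)]
      by (simp_all add: e_def)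
    obtain u v where uv: "ends G e = {#u, v#}" using e(1) by (auto elim: G.ends_pair)
    obtain a b where ab: "ends G' (\<psi> e) = {#a, b#}" "T u a" "T v b"
      using T(8)[OF e(1) uv] by blast
    \<comment> \<open>Ends are unordered, so the partners may come in the opposite order.\<close>
    have "{#a, b#} = {#u', v'#}" using ab(1) e(2) e'(2) by simp
    then have "a = u' \<and> b = v' \<or> a = v' \<and> b = u'" by (simp only: add_mset_pair_eq)
    then have "ends G e = {#u, v#} \<and> T u u' \<and> T v v' \<or> ends G e = {#v, u#} \<and> T v u' \<and> T u v'"
      using ab uv by (auto simp: add_mset_commute)
    then show "\<exists>u v. ends G (inv_into (edges G - Z) \<psi> e') = {#u, v#} \<and> T u u' \<and> T v v'"
      unfolding e_def[symmetric] by blast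
  qed (use T(4-6) in blast)+
qed

text \<open>Follow the path edge by edge. An edge of Z stays within one component of Z'; an edge e
  of W is replaced by \<open>\<psi> e\<close>, whose ends are linked by Z' to the given
  partners.\<close>

lemma linked_collapse_more:
  assumes G: "legged_graph s G" and T: "collapse_rel s G Z G' Z' T \<psi>"
    and Z: "Z \<subseteq> edges G" and W: "W \<subseteq> edges G - Z"
    and uv: "linked G (Z \<union> W) u v" and u: "T u u'" and v: "T v v'"
  shows "linked G' (Z' \<union> \<psi> ` W) u' v'"
proof -
  interpret G: legged s G by (rule legged.intro[OF G])
  note T = collapse_relD[OF T]
  have up: "linked G' (Z' \<union> \<psi> ` W) a b" if "linked G' Z' a b" for a b
    using that by (rule linked_mono[rotated]) blast
  \<comment> \<open>Quantified over all partners of the endpoint, since a vertex may correspond to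
    several.\<close>
  have "\<forall>v'. T v v' \<longrightarrow> linked G' (Z' \<union> \<psi> ` W) u' v'"
    using uv
  proof (induction rule: rtrancl_induct)
    case base
    have "linked G' Z' u' w" if "T u w" for w using T(7)[OF u that] by blast
    then show ?case using up by blast
  next
    case (step y z)
    obtain e where e: "e \<in> Z \<union> W" "ends G e = {#y, z#}" using step.hyps(2) by (auto simp: adjacent_def)
    have "e \<in> edges G" using e(1) Z W by blast
    then have "y \<in> verts G" using G.ends_subset[of e] e(2) by auto
    then obtain y' where y': "T y y'" using T(4) by blast
    have uy: "linked G' (Z' \<union> \<psi> ` W) u' y'" using step.IH y' by blast
    show ?case
    proof (intro allI impI)
      fix z' assume z': "T z z'"
      show "linked G' (Z' \<union> \<psi> ` W) u' z'"
      proof (cases "e \<in> Z")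
        case True
        then have "linked G Z y z" using adjacentI[OF _ e(2)] by blast
        then have "linked G' Z' y' z'" using T(7)[OF y' z'] by blast
        then show ?thesis using uy up by (meson rtrancl_trans)
      next
        case False
        then have eW: "e \<in> W" "e \<in> edges G - Z" using e(1) W by blast+
        obtain a b where ab: "ends G' (\<psi> e) = {#a, b#}" "T y a" "T z b"
          using T(8)[OF eW(2) e(2)] by blast
        have "linked G' Z' y' a" using T(7)[OF y' ab(2)] by blast
        moreover have "(a, b) \<in> adjacent G' (Z' \<union> \<psi> ` W)"
          using eW(1) ab(1) by (intro adjacentI[of "\<psi> e"]) auto
        moreover have "linked G' Z' b z'" using T(7)[OF ab(3) z'] by blast
        ultimately show ?thesis using uy up by (meson rtrancl_trans r_into_rtrancl)
      qed
    qed
  qed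
  then show ?thesis using v by blast
qed

text \<open>The same T works. One direction for linked vertices is
  \<open>linked_collapse_more\<close>, the other is the same lemma for the inverse
  correspondence.\<close>

lemma collapse_rel_more:
  assumes G: "legged_graph s G" and G': "legged_graph s G'" and T: "collapse_rel s G Z G' Z' T \<psi>"
    and Z: "Z \<subseteq> edges G" "Z' \<subseteq> edges G'" and W: "W \<subseteq> edges G - Z"
  shows "collapse_rel s G (Z \<union> W) G' (Z' \<union> \<psi> ` W) T \<psi>"
proof (rule collapse_relI)
  note TD = collapse_relD[OF T]
  have inj: "inj_on \<psi> (edges G - Z)" and im: "\<psi> ` (edges G - Z) = edges G' - Z'"
    using TD(1) by (auto simp: bij_betw_def)
  have "\<psi> ` (edges G - Z - W) = \<psi> ` (edges G - Z) - \<psi> ` W"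
    using inj W by (intro inj_on_image_set_diff) auto
  then have "\<psi> ` (edges G - (Z \<union> W)) = edges G' - (Z' \<union> \<psi> ` W)"
    using im by (simp add: Diff_Diff_Int set_diff_eq Diff_eq Int_assoc)
  then show "bij_betw \<psi> (edges G - (Z \<union> W)) (edges G' - (Z' \<union> \<psi> ` W))"
    using inj_on_subset[OF inj, of "edges G - (Z \<union> W)"] by (auto simp: bij_betw_def)
  have W': "\<psi> ` W \<subseteq> edges G' - Z'" using im W by blast
  have inv: "inv_into (edges G - Z) \<psi> ` \<psi> ` W = W"
    using inj W by (auto simp: image_iff inv_into_f_f subset_eq intro!: bexI)
  show "linked G (Z \<union> W) u v \<longleftrightarrow> linked G' (Z' \<union> \<psi> ` W) u' v'" if "T u u'" "T v v'" for u u' v v'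
    using linked_collapse_more[OF G T Z(1) W _ that]
      linked_collapse_more[OF G' collapse_rel_sym[OF G G' T] Z(2) W' _ that] unfolding inv by blast
  show "u \<in> verts G \<and> u' \<in> verts G'" if "T u u'" for u u' using TD(2,3)[OF that] by blast
qed (use collapse_relD[OF T] in \<open>blast\<close>)+

lemma graph_iso_collapse_more:
  assumes G: "legged_graph s G" and G': "legged_graph s G'"
    and iso: "graph_iso s (collapse G Z) (collapse G' Z') \<phi> \<psi>"
    and Z: "Z \<subseteq> edges G" "Z' \<subseteq> edges G'" and W: "W \<subseteq> edges G - Z"
  shows "\<exists>\<phi>. graph_iso s (collapse G (Z \<union> W)) (collapse G' (Z' \<union> \<psi> ` W)) \<phi> \<psi>"
  using iso_of_collapse_rel[OF G G' collapse_rel_more[OF G G' collapse_rel_of_iso[OF G G' iso] Z W]] .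

text \<open>Start from Z = Z' = {}: with nothing collapsed, linked vertices are equal and T is the
  graph of \<phi>.\<close>

lemma graph_iso_collapse:
  assumes G: "legged_graph s G" and G': "legged_graph s G'" and iso: "graph_iso s G G' \<phi> \<psi>"
    and W: "W \<subseteq> edges G"
  shows "\<exists>\<phi>. graph_iso s (collapse G W) (collapse G' (\<psi> ` W)) \<phi> \<psi>"
proof -
  interpret G: legged s G by (rule legged.intro[OF G])
  interpret G': legged s G' by (rule legged.intro[OF G'])
  have b: "bij_betw \<phi> (verts G) (verts G')" and e: "bij_betw \<psi> (edges G) (edges G')"
    and ends: "\<And>e. e \<in> edges G \<Longrightarrow> ends G' (\<psi> e) = image_mset \<phi> (ends G e)"
    and legs: "\<And>i. i \<in> {1..s} \<Longrightarrow> leg G' i = \<phi> (leg G i)"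
    using iso by (simp_all add: graph_iso_def)
  let ?T = "\<lambda>u u'. u \<in> verts G \<and> u' = \<phi> u"
  have in': "\<phi> u \<in> verts G'" if "u \<in> verts G" for u using b that by (auto simp: bij_betw_def)
  have emp: "linked G {} u v \<longleftrightarrow> u = v" "linked G' {} u' v' \<longleftrightarrow> u' = v'" for u v u' v'
    by (simp_all add: adjacent_def)
  have "collapse_rel s G {} G' {} ?T \<psi>"
  proof (rule collapse_relI)
    show "bij_betw \<psi> (edges G - {}) (edges G' - {})" using e by simp
    show "\<exists>u. ?T u u'" if "u' \<in> verts G'" for u' using b that by (auto simp: bij_betw_def)
    show "?T (leg G i) (leg G' i)" if "i \<in> {1..s}" for i using legs[OF that] G.leg_in_verts[OF that] by simp
    show "linked G {} u v \<longleftrightarrow> linked G' {} u' v'" if "?T u u'" "?T v v'" for u u' v v'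
      unfolding emp using that b by (auto simp: bij_betw_def inj_on_eq_iff)
    show "\<exists>u' v'. ends G' (\<psi> e) = {#u', v'#} \<and> ?T u u' \<and> ?T v v'"
      if "e \<in> edges G - {}" "ends G e = {#u, v#}" for e u v
      using ends[of e] that G.ends_subset[of e] by auto
  qed (use in' in auto)
  from collapse_rel_more[OF G G' this _ _, of W] iso_of_collapse_rel[OF G G'] show ?thesis
    using W by auto
qed

lemma graph_iso_refl: "graph_iso s G G id id"
  by (simp add: graph_iso_def)

lemma graph_iso_trans:
  assumes "graph_iso s G H \<phi> \<psi>" "graph_iso s H K \<phi>' \<psi>'"
  shows "graph_iso s G K (\<phi>' \<circ> \<phi>) (\<psi>' \<circ> \<psi>)"
  using assms unfolding graph_iso_def
  by (auto intro: bij_betw_trans simp: bij_betw_apply multiset.map_comp)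

lemma graph_iso_sym:
  assumes iso: "graph_iso s G H \<phi> \<psi>"
    and ends: "\<And>e. e \<in> edges G \<Longrightarrow> set_mset (ends G e) \<subseteq> verts G"
    and legs: "\<And>i. i \<in> {1..s} \<Longrightarrow> leg G i \<in> verts G"
  shows "graph_iso s H G (inv_into (verts G) \<phi>) (inv_into (edges G) \<psi>)"
proof -
  have b: "bij_betw \<phi> (verts G) (verts H)" and e: "bij_betw \<psi> (edges G) (edges H)"
    and ends': "\<And>e. e \<in> edges G \<Longrightarrow> ends H (\<psi> e) = image_mset \<phi> (ends G e)"
    and legs': "\<And>i. i \<in> {1..s} \<Longrightarrow> leg H i = \<phi> (leg G i)"
    using iso by (simp_all add: graph_iso_def)
  have inv: "inv_into (verts G) \<phi> (\<phi> v) = v" if "v \<in> verts G" for v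
    using b that by (rule bij_betw_inv_into_left)
  show ?thesis
    unfolding graph_iso_def
  proof (intro conjI ballI)
    show "bij_betw (inv_into (verts G) \<phi>) (verts H) (verts G)" by (rule bij_betw_inv_into[OF b])
    show "bij_betw (inv_into (edges G) \<psi>) (edges H) (edges G)" by (rule bij_betw_inv_into[OF e])
    fix f assume f: "f \<in> edges H"
    have g: "inv_into (edges G) \<psi> f \<in> edges G" "\<psi> (inv_into (edges G) \<psi> f) = f"
      using bij_betw_apply[OF bij_betw_inv_into[OF e] f] bij_betw_inv_into_right[OF e f] by simp_all
    have "image_mset (inv_into (verts G) \<phi>) (ends H f)
        = image_mset (\<lambda>v. inv_into (verts G) \<phi> (\<phi> v)) (ends G (inv_into (edges G) \<psi> f))"
      using ends'[OF g(1)] unfolding g(2) by (simp add: multiset.map_comp o_def)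
    also have "\<dots> = image_mset (\<lambda>v. v) (ends G (inv_into (edges G) \<psi> f))"
      using inv ends[OF g(1)] by (intro image_mset_cong) auto
    finally show "ends G (inv_into (edges G) \<psi> f) = image_mset (inv_into (verts G) \<phi>) (ends H f)" by simp
  next
    fix i assume i: "i \<in> {1..s}"
    show "leg G i = inv_into (verts G) \<phi> (leg H i)"
      unfolding legs'[OF i] using inv[OF legs[OF i]] by simp
  qed
qed

lemma (in legged) collapse_ends_legs:
  "e \<in> edges (collapse G Z) \<Longrightarrow> set_mset (ends (collapse G Z) e) \<subseteq> verts (collapse G Z)"
  "i \<in> {1..s} \<Longrightarrow> leg (collapse G Z) i \<in> verts (collapse G Z)"
  using ends_subset leg_in_verts by (auto simp: collapse_def)

text \<open>Every vertex of a one-loop graph carries a leg, so an automorphism of a collapsed graph fixes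
  all vertices and can only exchange parallel edges; parallel edges occur only for two edges.\<close>

lemma (in one_loop) collapse_automorphism:
  assumes iso: "graph_iso s (collapse G Z) (collapse G Z) \<phi> \<psi>" and Z: "Z \<subseteq> edges G"
    and card: "card (edges G - Z) \<noteq> 2" and e: "e \<in> edges G - Z"
  shows "\<psi> e = e"
proof (rule ccontr)
  assume ne: "\<psi> e \<noteq> e"
  let ?C = "component G Z"
  have \<phi>: "\<phi> (?C v) = ?C v" if v: "v \<in> verts G" for v
  proof -
    obtain i where "i \<in> {1..s}" "leg G i = v" using leg_surj[OF v] by blast
    then show ?thesis using iso by (auto simp: graph_iso_def collapse_def)
  qed
  have b: "bij_betw \<psi> (edges G - Z) (edges G - Z)"
    and ends: "image_mset ?C (ends G (\<psi> e)) = image_mset \<phi> (image_mset ?C (ends G e))"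
    using iso e by (simp_all add: graph_iso_def collapse_def)
  have e': "\<psi> e \<in> edges G - Z" using b e by (rule bij_betw_apply)
  obtain u v where uv: "ends G e = {#u, v#}" "u \<in> verts G" "v \<in> verts G"
    using e by (auto elim: ends_pair)
  obtain u' v' where uv': "ends G (\<psi> e) = {#u', v'#}"
    using e' by (auto elim: ends_pair)
  have "{#?C u', ?C v'#} = {#?C u, ?C v#}"
    using ends uv(2,3) \<phi> unfolding uv(1) uv' by simp
  \<comment> \<open>So e and \<open>\<psi> e\<close> are parallel in the collapsed graph.\<close>
  then have par: "?C u' = ?C u \<and> ?C v' = ?C v \<or> ?C u' = ?C v \<and> ?C v' = ?C u"
    by (simp only: add_mset_pair_eq)
  have "card {e, \<psi> e} = 2" using ne by simp
  then have "edges G - Z \<noteq> {e, \<psi> e}" using card by metis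
  \<comment> \<open>A third remaining edge. Without e and f the ends of e are still linked through
    \<open>\<psi> e\<close> and Z, against \<open>not_linked_remove_two\<close>.\<close>
  then obtain f where f: "f \<in> edges G - Z" "f \<noteq> e" "f \<noteq> \<psi> e" using e e' by blast
  let ?F = "edges G - {e, f}"
  have ZF: "Z \<subseteq> ?F" using Z e f by blast
  have "\<psi> e \<in> ?F" using e' ne f(3) by blast
  then have adj: "(u', v') \<in> adjacent G ?F" by (rule adjacentI[OF _ uv'])
  have lift: "linked G ?F x y" if "?C x = ?C y" for x y
    using that unfolding component_eq_iff by (rule linked_mono[OF ZF])
  have step: "linked G ?F x v'" if "?C u' = ?C x" for x
    using lift[OF that[symmetric]] adj by (rule rtrancl_into_rtrancl)
  from par have "linked G ?F u v"
  proof
    assume "?C u' = ?C u \<and> ?C v' = ?C v"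
    then show ?thesis using step[of u] lift[of v' v] by (meson rtrancl_trans)
  next
    assume "?C u' = ?C v \<and> ?C v' = ?C u"
    then have "linked G ?F v u" using step[of v] lift[of v' u] by (meson rtrancl_trans)
    then show ?thesis by (rule linked_sym)
  qed
  then show False
    using not_linked_remove_two[OF _ uv(1), of f] e f(1,2) by simp
qed

section \<open>The moduli space\<close>

lemma one_loop_graph_iff: "one_loop_graph s G \<longleftrightarrow> one_loop s G"
  by (simp add: one_loop_graph_def one_loop_def legged_def one_loop_axioms_def)

lemma triplesD:
  assumes "(G, l, c) \<in> triples s m"
  shows "one_loop s G" "legged s G" "legged_graph s G" "l \<in> extensional (edges G)" "\<And>e. e \<in> edges G \<Longrightarrow> 0 \<le> l e"
    "forest G (zero_set G l)" "c \<in> colorings m G"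
proof -
  show "one_loop s G" using assms by (simp add: triples_def one_loop_graph_iff)
  then show "legged s G" by (simp add: one_loop_def)
  then show "legged_graph s G" by (simp add: legged_def)
qed (use assms in \<open>auto simp: triples_def regular_metrics_def PiE_def\<close>)

lemma edges_collapse [simp]: "edges (collapse G Z) = edges G - Z"
  by (simp add: collapse_def)

lemma zero_set_subset: "zero_set G l \<subseteq> edges G"
  by (auto simp: zero_set_def)

lemma triple_relI:
  assumes "(G, l, c) \<in> triples s m" "(G', l', c') \<in> triples s m"
    "graph_iso s (collapse G (zero_set G l)) (collapse G' (zero_set G' l')) \<phi> \<psi>" "a > 0"
    "\<And>e. e \<in> edges G - zero_set G l \<Longrightarrow> l' (\<psi> e) = a * l e \<and> c' (\<psi> e) = c e"
  shows "((G, l, c), (G', l', c')) \<in> triple_rel s m"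
  using assms unfolding triple_rel_def by blast

lemma triple_relE:
  assumes "((G, l, c), (G', l', c')) \<in> triple_rel s m"
  obtains \<phi> \<psi> a where "(G, l, c) \<in> triples s m" "(G', l', c') \<in> triples s m"
    "graph_iso s (collapse G (zero_set G l)) (collapse G' (zero_set G' l')) \<phi> \<psi>" "a > 0"
    "\<And>e. e \<in> edges G - zero_set G l \<Longrightarrow> l' (\<psi> e) = a * l e \<and> c' (\<psi> e) = c e"
proof -
  have t: "(G, l, c) \<in> triples s m" "(G', l', c') \<in> triples s m"
    and ex: "\<exists>\<phi> \<psi> a. graph_iso s (collapse G (zero_set G l)) (collapse G' (zero_set G' l')) \<phi> \<psi> \<and> a > 0 \<and>
        (\<forall>e\<in>edges G - zero_set G l. l' (\<psi> e) = a * l e \<and> c' (\<psi> e) = c e)"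
    using assms by (simp_all add: triple_rel_def)
  let ?P = "\<lambda>\<phi> \<psi> a. graph_iso s (collapse G (zero_set G l)) (collapse G' (zero_set G' l')) \<phi> \<psi> \<and> a > 0 \<and>
        (\<forall>e\<in>edges G - zero_set G l. l' (\<psi> e) = a * l e \<and> c' (\<psi> e) = c e)"
  from ex obtain \<phi> where "\<exists>\<psi> a. ?P \<phi> \<psi> a" ..
  then obtain \<psi> where "\<exists>a. ?P \<phi> \<psi> a" ..
  then obtain a where P: "?P \<phi> \<psi> a" ..
  show thesis
    by (rule that[OF t conjunct1[OF P] conjunct1[OF conjunct2[OF P]] bspec[OF conjunct2[OF conjunct2[OF P]]]])
qed

lemma graph_iso_edges: "graph_iso s G H \<phi> \<psi> \<Longrightarrow> bij_betw \<psi> (edges G) (edges H)"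
  by (simp add: graph_iso_def)

lemma triple_rel_refl: "x \<in> triples s m \<Longrightarrow> (x, x) \<in> triple_rel s m"
  by (cases x) (auto intro!: triple_relI[where a = 1] graph_iso_refl)

lemma triple_rel_sym:
  assumes "(x, y) \<in> triple_rel s m"
  shows "(y, x) \<in> triple_rel s m"
proof -
  obtain G l c G' l' c' where xy: "x = (G, l, c)" "y = (G', l', c')" by (cases x, cases y)
  have t: "(G, l, c) \<in> triples s m" "(G', l', c') \<in> triples s m"
    using assms by (simp_all add: xy triple_rel_def)
  from assms[unfolded xy] obtain \<phi> \<psi> a
    where iso: "graph_iso s (collapse G (zero_set G l)) (collapse G' (zero_set G' l')) \<phi> \<psi>" and a: "a > 0"
    and lc: "\<And>e. e \<in> edges G - zero_set G l \<Longrightarrow> l' (\<psi> e) = a * l e \<and> c' (\<psi> e) = c e"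
    by (rule triple_relE) blast
  interpret legged s G by (rule triplesD(2)[OF t(1)])
  let ?H = "collapse G (zero_set G l)"
  have b: "bij_betw \<psi> (edges G - zero_set G l) (edges G' - zero_set G' l')"
    using graph_iso_edges[OF iso] by simp
  have iso': "graph_iso s (collapse G' (zero_set G' l')) ?H (inv_into (verts ?H) \<phi>) (inv_into (edges ?H) \<psi>)"
    by (rule graph_iso_sym[OF iso collapse_ends_legs])
  show ?thesis
    unfolding xy
  proof (rule triple_relI[OF t(2,1) iso'])
    show "0 < 1 / a" using a by simp
    fix f assume f: "f \<in> edges G' - zero_set G' l'"
    define e where "e = inv_into (edges ?H) \<psi> f"
    have e: "e \<in> edges G - zero_set G l" "\<psi> e = f"
      using bij_betw_apply[OF bij_betw_inv_into[OF b] f] bij_betw_inv_into_right[OF b f]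
      by (simp_all add: e_def)
    show "l (inv_into (edges ?H) \<psi> f) = 1 / a * l' f \<and> c (inv_into (edges ?H) \<psi> f) = c' f"
      using lc[OF e(1)] a unfolding e_def[symmetric] e(2) by simp
  qed
qed

lemma triple_rel_trans:
  assumes "(x, y) \<in> triple_rel s m" "(y, z) \<in> triple_rel s m"
  shows "(x, z) \<in> triple_rel s m"
proof -
  obtain G l c G' l' c' G'' l'' c'' where xyz: "x = (G, l, c)" "y = (G', l', c')" "z = (G'', l'', c'')"
    by (cases x, cases y, cases z)
  from assms(1)[unfolded xyz] obtain \<phi> \<psi> a where t: "(G, l, c) \<in> triples s m"
    and iso: "graph_iso s (collapse G (zero_set G l)) (collapse G' (zero_set G' l')) \<phi> \<psi>" and a: "a > 0"
    and lc: "\<And>e. e \<in> edges G - zero_set G l \<Longrightarrow> l' (\<psi> e) = a * l e \<and> c' (\<psi> e) = c e"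
    by (rule triple_relE) blast
  from assms(2)[unfolded xyz] obtain \<phi>' \<psi>' a' where t': "(G'', l'', c'') \<in> triples s m"
    and iso': "graph_iso s (collapse G' (zero_set G' l')) (collapse G'' (zero_set G'' l'')) \<phi>' \<psi>'" and a': "a' > 0"
    and lc': "\<And>e. e \<in> edges G' - zero_set G' l' \<Longrightarrow> l'' (\<psi>' e) = a' * l' e \<and> c'' (\<psi>' e) = c' e"
    by (rule triple_relE) blast
  show ?thesis
    unfolding xyz
  proof (rule triple_relI[OF t t' graph_iso_trans[OF iso iso']])
    show "0 < a' * a" using a a' by simp
    fix e assume e: "e \<in> edges G - zero_set G l"
    then have "\<psi> e \<in> edges G' - zero_set G' l'"
      using graph_iso_edges[OF iso] by (auto simp: bij_betw_def)
    from lc'[OF this] lc[OF e] show "l'' ((\<psi>' \<circ> \<psi>) e) = a' * a * l e \<and> c'' ((\<psi>' \<circ> \<psi>) e) = c e" by simp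
  qed
qed

lemma equiv_triple_rel: "equiv (triples s m) (triple_rel s m)"
proof (rule equivI)
  show "triple_rel s m \<subseteq> triples s m \<times> triples s m" by (auto simp: triple_rel_def)
  show "refl_on (triples s m) (triple_rel s m)"
    unfolding refl_on_def by (auto simp: triple_rel_refl)
  show "sym (triple_rel s m)" by (rule symI) (rule triple_rel_sym)
  show "trans (triple_rel s m)" by (rule transI) (rule triple_rel_trans)
qed

section \<open>Colored graphs up to isomorphism\<close>

lemma colored_isoI:
  "graph_iso s G G' \<phi> \<psi> \<Longrightarrow> (\<And>e. e \<in> edges G \<Longrightarrow> c' (\<psi> e) = c e) \<Longrightarrow> colored_iso s (G, c) (G', c')"
  unfolding colored_iso_def by blast

lemma colored_isoE:
  assumes "colored_iso s (G, c) (G', c')"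
  obtains \<phi> \<psi> where "graph_iso s G G' \<phi> \<psi>" "\<And>e. e \<in> edges G \<Longrightarrow> c' (\<psi> e) = c e"
  using assms unfolding colored_iso_def by blast

lemma colored_iso_refl: "colored_iso s p p"
  by (cases p) (auto intro!: colored_isoI graph_iso_refl)

lemma colored_iso_trans:
  assumes "colored_iso s p q" "colored_iso s q r"
  shows "colored_iso s p r"
proof -
  obtain G c G' c' G'' c'' where pqr: "p = (G, c)" "q = (G', c')" "r = (G'', c'')" by (cases p, cases q, cases r)
  obtain \<phi> \<psi> where 1: "graph_iso s G G' \<phi> \<psi>" "\<And>e. e \<in> edges G \<Longrightarrow> c' (\<psi> e) = c e"
    using colored_isoE[OF assms(1)[unfolded pqr]] by blast
  obtain \<phi>' \<psi>' where 2: "graph_iso s G' G'' \<phi>' \<psi>'" "\<And>e. e \<in> edges G' \<Longrightarrow> c'' (\<psi>' e) = c' e"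
    using colored_isoE[OF assms(2)[unfolded pqr]] by blast
  show ?thesis
    unfolding pqr
  proof (rule colored_isoI[OF graph_iso_trans[OF 1(1) 2(1)]])
    fix e assume e: "e \<in> edges G"
    then have "\<psi> e \<in> edges G'" using graph_iso_edges[OF 1(1)] by (auto simp: bij_betw_def)
    then show "c'' ((\<psi>' \<circ> \<psi>) e) = c e" using 1(2)[OF e] 2(2) by simp
  qed
qed

lemma colored_graphsD:
  assumes "(G, c) \<in> colored_graphs s m"
  shows "one_loop s G" "legged_graph s G" "c \<in> colorings m G"
proof -
  show 1: "one_loop s G" "c \<in> colorings m G" using assms by (simp_all add: colored_graphs_def one_loop_graph_iff)
  then show "legged_graph s G" by (simp add: one_loop_def legged_def)
qed

lemma colored_iso_sym:
  assumes "p \<in> colored_graphs s m" "colored_iso s p q"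
  shows "colored_iso s q p"
proof -
  obtain G c G' c' where pq: "p = (G, c)" "q = (G', c')" by (cases p, cases q)
  obtain \<phi> \<psi> where 1: "graph_iso s G G' \<phi> \<psi>" "\<And>e. e \<in> edges G \<Longrightarrow> c' (\<psi> e) = c e"
    using colored_isoE[OF assms(2)[unfolded pq]] by blast
  interpret one_loop s G using assms(1) unfolding pq by (rule colored_graphsD)
  have b: "bij_betw \<psi> (edges G) (edges G')" by (rule graph_iso_edges[OF 1(1)])
  show ?thesis
    unfolding pq
  proof (rule colored_isoI[OF graph_iso_sym[OF 1(1) ends_subset leg_in_verts]])
    fix f assume f: "f \<in> edges G'"
    show "c (inv_into (edges G) \<psi> f) = c' f"
      using 1(2)[OF bij_betw_apply[OF bij_betw_inv_into[OF b] f]] bij_betw_inv_into_right[OF b f] by simp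
  qed
qed

definition rep :: "nat \<Rightarrow> nat \<Rightarrow> graph \<times> coloring \<Rightarrow> graph \<times> coloring" where
  "rep s m p = (SOME q. q \<in> colored_graphs s m \<and> colored_iso s p q)"

lemma representatives_eq: "representatives s m = rep s m ` colored_graphs s m"
  by (simp add: representatives_def rep_def)

lemma rep:
  assumes "p \<in> colored_graphs s m"
  shows "rep s m p \<in> colored_graphs s m" "colored_iso s p (rep s m p)"
proof -
  have "\<exists>q. q \<in> colored_graphs s m \<and> colored_iso s p q" using assms colored_iso_refl by blast
  from someI_ex[OF this] show "rep s m p \<in> colored_graphs s m" "colored_iso s p (rep s m p)"
    by (simp_all add: rep_def)
qed

text \<open>Isomorphic pairs have the same candidates and therefore the same choice.\<close>

lemma rep_cong:
  assumes "p \<in> colored_graphs s m" "colored_iso s p q"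
  shows "rep s m p = rep s m q"
proof -
  have "colored_iso s p r \<longleftrightarrow> colored_iso s q r" for r
    using colored_iso_trans[OF assms(2), of r] colored_iso_trans[OF colored_iso_sym[OF assms], of r] by blast
  then show ?thesis by (simp add: rep_def)
qed

lemma representatives_subset: "representatives s m \<subseteq> colored_graphs s m"
  unfolding representatives_eq using rep(1) by blast

text \<open>Choosing again in the class of a representative returns the representative
  itself.\<close>

lemma representatives_iso_eq:
  assumes "p \<in> representatives s m" "q \<in> representatives s m" "colored_iso s p q"
  shows "p = q"
proof -
  have fixp: "rep s m r = r" if r: "r \<in> representatives s m" for r
  proof -
    obtain r' where r': "r' \<in> colored_graphs s m" "r = rep s m r'" using r by (auto simp: representatives_eq)
    then show ?thesis using rep_cong[OF r'(1) rep(2)[OF r'(1)]] by simp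
  qed
  have "p \<in> colored_graphs s m" using assms(1) representatives_subset by blast
  then show ?thesis using rep_cong[OF _ assms(3), of m] fixp[OF assms(1)] fixp[OF assms(2)] by simp
qed

section \<open>Counting colored graphs by codes\<close>

lemma (in one_loop) card_edges_le: "card (edges G) \<le> s"
  using card_edges card_verts_le by simp

text \<open>Vertices and edges are numbered up to the same k. The code lists the ends of each edge,
  the vertex of each leg and the color of each edge. A colored graph has many codes, but a code
  determines it up to isomorphism.\<close>

definition has_code :: "nat \<Rightarrow> graph \<times> coloring \<Rightarrow>
    nat \<times> (nat \<Rightarrow> nat \<times> nat) \<times> (nat \<Rightarrow> nat) \<times> (nat \<Rightarrow> nat) \<Rightarrow> bool" where
  "has_code s = (\<lambda>(G, c) (k, a, L, C). \<exists>\<beta> \<epsilon>.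
     bij_betw \<beta> (verts G) {..<k} \<and> bij_betw \<epsilon> (edges G) {..<k} \<and>
     (\<forall>e\<in>edges G. ends G e = {#inv_into (verts G) \<beta> (fst (a (\<epsilon> e))), inv_into (verts G) \<beta> (snd (a (\<epsilon> e)))#} \<and>
        fst (a (\<epsilon> e)) < k \<and> snd (a (\<epsilon> e)) < k) \<and>
     (\<forall>i\<in>{1..s}. L i = \<beta> (leg G i)) \<and> (\<forall>e\<in>edges G. C (\<epsilon> e) = c e))"

text \<open>Entries range over numbers below s rather than below k, so that the set is a plain
  product and m enters as m^s.\<close>

definition codes :: "nat \<Rightarrow> nat \<Rightarrow> (nat \<times> (nat \<Rightarrow> nat \<times> nat) \<times> (nat \<Rightarrow> nat) \<times> (nat \<Rightarrow> nat)) set" where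
  "codes s m = {..s} \<times> ({..<s} \<rightarrow>\<^sub>E {..<s} \<times> {..<s}) \<times> ({1..s} \<rightarrow>\<^sub>E {..<s}) \<times> ({..<s} \<rightarrow>\<^sub>E {1..m})"

lemma finite_codes: "finite (codes s m)"
  unfolding codes_def by (intro finite_cartesian_product finite_PiE) auto

lemma card_codes: "card (codes s m) = Suc s * (s * s) ^ s * s ^ s * m ^ s"
  unfolding codes_def by (simp add: card_cartesian_product card_PiE algebra_simps)

lemma has_code_ex:
  assumes p: "p \<in> colored_graphs s m" and s: "1 \<le> s" and m: "1 \<le> m"
  shows "\<exists>x\<in>codes s m. has_code s p x"
proof -
  obtain G c where pGc: "p = (G, c)" by (cases p)
  interpret one_loop s G using p unfolding pGc by (rule colored_graphsD)
  have c: "c e \<in> {1..m}" if "e \<in> edges G" for e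
    using colored_graphsD(3)[OF p[unfolded pGc]] that by (auto simp: colorings_def)
  define k where "k = card (verts G)"
  have k: "k \<le> s" unfolding k_def by (rule card_verts_le)
  obtain \<beta> where \<beta>: "bij_betw \<beta> (verts G) {..<k}"
    using ex_bij_betw_finite_nat[OF finite_verts] unfolding k_def atLeast0LessThan by blast
  obtain \<epsilon> where \<epsilon>: "bij_betw \<epsilon> (edges G) {..<k}"
    using ex_bij_betw_finite_nat[OF finite_edges] unfolding k_def atLeast0LessThan card_edges by blast
  have \<beta>k: "\<beta> v < k" if "v \<in> verts G" for v using bij_betw_apply[OF \<beta> that] by simp
  have \<epsilon>k: "\<epsilon> e < k" if "e \<in> edges G" for e using bij_betw_apply[OF \<epsilon> that] by simp
  have \<epsilon>inv: "inv_into (edges G) \<epsilon> (\<epsilon> e) = e" if "e \<in> edges G" for e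
    by (rule bij_betw_inv_into_left[OF \<epsilon> that])
  have inE: "inv_into (edges G) \<epsilon> j \<in> edges G" if "j < k" for j
    using bij_betw_apply[OF bij_betw_inv_into[OF \<epsilon>], of j] that by simp
  have \<beta>inv: "inv_into (verts G) \<beta> (\<beta> v) = v" if "v \<in> verts G" for v
    by (rule bij_betw_inv_into_left[OF \<beta> that])
  have "\<forall>e\<in>edges G. \<exists>uv. ends G e = {#fst uv, snd uv#} \<and> fst uv \<in> verts G \<and> snd uv \<in> verts G"
  proof
    fix e assume "e \<in> edges G"
    then obtain u v where "ends G e = {#u, v#}" "u \<in> verts G" "v \<in> verts G" by (rule ends_pair)
    then show "\<exists>uv. ends G e = {#fst uv, snd uv#} \<and> fst uv \<in> verts G \<and> snd uv \<in> verts G"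
      by (intro exI[of _ "(u, v)"]) simp
  qed
  from bchoice[OF this] obtain w
    where w: "\<forall>e\<in>edges G. ends G e = {#fst (w e), snd (w e)#} \<and> fst (w e) \<in> verts G \<and> snd (w e) \<in> verts G" ..
  \<comment> \<open>Positions from k on carry default values: 0 is allowed as s >= 1, and below the
    color 1 as m >= 1.\<close>
  define a where "a = (\<lambda>j\<in>{..<s}. if j < k
      then (\<beta> (fst (w (inv_into (edges G) \<epsilon> j))), \<beta> (snd (w (inv_into (edges G) \<epsilon> j)))) else (0, 0))"
  define L where "L = (\<lambda>i\<in>{1..s}. \<beta> (leg G i))"
  define C where "C = (\<lambda>j\<in>{..<s}. if j < k then c (inv_into (edges G) \<epsilon> j) else 1)"
  have "(k, a, L, C) \<in> codes s m"
    unfolding codes_def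
  proof (intro SigmaI)
    show "k \<in> {..s}" using k by simp
    show "a \<in> {..<s} \<rightarrow>\<^sub>E {..<s} \<times> {..<s}"
    proof (rule PiE_I)
      fix j assume j: "j \<in> {..<s}"
      show "a j \<in> {..<s} \<times> {..<s}"
      proof (cases "j < k")
        case True
        then have "fst (w (inv_into (edges G) \<epsilon> j)) \<in> verts G" "snd (w (inv_into (edges G) \<epsilon> j)) \<in> verts G"
          using bspec[OF w inE[OF True]] by simp_all
        then have "\<beta> (fst (w (inv_into (edges G) \<epsilon> j))) < k" "\<beta> (snd (w (inv_into (edges G) \<epsilon> j))) < k"
          by (simp_all add: \<beta>k)
        then show ?thesis using True j k by (simp add: a_def)
      next
        case False
        then show ?thesis using j s by (simp add: a_def)
      qed
    qed (simp add: a_def)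
    show "L \<in> {1..s} \<rightarrow>\<^sub>E {..<s}"
      unfolding L_def restrict_PiE_iff
    proof
      fix i assume i: "i \<in> {1..s}"
      show "\<beta> (leg G i) \<in> {..<s}" using \<beta>k[OF leg_in_verts[OF i]] k by simp
    qed
    show "C \<in> {..<s} \<rightarrow>\<^sub>E {1..m}"
    proof (rule PiE_I)
      fix j assume j: "j \<in> {..<s}"
      show "C j \<in> {1..m}" using c[OF inE, of j] j m by (simp add: C_def)
    qed (simp add: C_def)
  qed
  moreover have "has_code s p (k, a, L, C)"
    unfolding has_code_def pGc prod.case
  proof (rule exI[of _ \<beta>], rule exI[of _ \<epsilon>], intro conjI ballI)
    fix e assume e: "e \<in> edges G"
    have \<epsilon>s: "\<epsilon> e < s" using \<epsilon>k[OF e] k by simp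
    have ae: "a (\<epsilon> e) = (\<beta> (fst (w e)), \<beta> (snd (w e)))"
      using \<epsilon>s \<epsilon>k[OF e] \<epsilon>inv[OF e] by (simp add: a_def)
    have we: "ends G e = {#fst (w e), snd (w e)#}" "fst (w e) \<in> verts G" "snd (w e) \<in> verts G"
      using bspec[OF w e] by simp_all
    show "ends G e = {#inv_into (verts G) \<beta> (fst (a (\<epsilon> e))), inv_into (verts G) \<beta> (snd (a (\<epsilon> e)))#}"
      unfolding ae fst_conv snd_conv \<beta>inv[OF we(2)] \<beta>inv[OF we(3)] by (rule we(1))
    show "fst (a (\<epsilon> e)) < k" "snd (a (\<epsilon> e)) < k" unfolding ae using \<beta>k we by simp_all
    show "C (\<epsilon> e) = c e" using \<epsilon>s \<epsilon>k[OF e] \<epsilon>inv[OF e] by (simp add: C_def)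
  qed (use \<beta> \<epsilon> in \<open>simp_all add: L_def\<close>)
  ultimately show ?thesis by blast
qed

text \<open>Compose the numberings of one graph with the inverse numberings of the other.\<close>

lemma has_code_iso:
  assumes p: "p \<in> colored_graphs s m" "has_code s p x" and q: "q \<in> colored_graphs s m" "has_code s q x"
  shows "colored_iso s p q"
proof -
  obtain G c G' c' k a L C where eq: "p = (G, c)" "q = (G', c')" "x = (k, a, L, C)"
    by (cases p, cases q, cases x)
  interpret G: one_loop s G using p(1) unfolding eq by (rule colored_graphsD)
  interpret G': one_loop s G' using q(1) unfolding eq by (rule colored_graphsD)
  obtain \<beta> \<epsilon> where b: "bij_betw \<beta> (verts G) {..<k}" "bij_betw \<epsilon> (edges G) {..<k}"
     "\<And>e. e \<in> edges G \<Longrightarrow> ends G e = {#inv_into (verts G) \<beta> (fst (a (\<epsilon> e))), inv_into (verts G) \<beta> (snd (a (\<epsilon> e)))#}"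
     "\<And>e. e \<in> edges G \<Longrightarrow> fst (a (\<epsilon> e)) < k \<and> snd (a (\<epsilon> e)) < k"
     "\<And>i. i \<in> {1..s} \<Longrightarrow> L i = \<beta> (leg G i)" "\<And>e. e \<in> edges G \<Longrightarrow> C (\<epsilon> e) = c e"
    using p(2) unfolding eq has_code_def prod.case by blast
  obtain \<beta>' \<epsilon>' where b': "bij_betw \<beta>' (verts G') {..<k}" "bij_betw \<epsilon>' (edges G') {..<k}"
     "\<And>e. e \<in> edges G' \<Longrightarrow> ends G' e = {#inv_into (verts G') \<beta>' (fst (a (\<epsilon>' e))), inv_into (verts G') \<beta>' (snd (a (\<epsilon>' e)))#}"
     "\<And>i. i \<in> {1..s} \<Longrightarrow> L i = \<beta>' (leg G' i)" "\<And>e. e \<in> edges G' \<Longrightarrow> C (\<epsilon>' e) = c' e"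
    using q(2) unfolding eq has_code_def prod.case by blast
  let ?\<phi> = "inv_into (verts G') \<beta>' \<circ> \<beta>" and ?\<psi> = "inv_into (edges G') \<epsilon>' \<circ> \<epsilon>"
  have \<phi>: "bij_betw ?\<phi> (verts G) (verts G')" by (rule bij_betw_trans[OF b(1) bij_betw_inv_into[OF b'(1)]])
  have \<psi>: "bij_betw ?\<psi> (edges G) (edges G')" by (rule bij_betw_trans[OF b(2) bij_betw_inv_into[OF b'(2)]])
  have \<epsilon>': "\<epsilon>' (?\<psi> e) = \<epsilon> e" "?\<psi> e \<in> edges G'" if e: "e \<in> edges G" for e
    using bij_betw_inv_into_right[OF b'(2) bij_betw_apply[OF b(2) e]] bij_betw_apply[OF \<psi> e] by simp_all
  show ?thesis
    unfolding eq
  proof (rule colored_isoI)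
    show "graph_iso s G G' ?\<phi> ?\<psi>"
      unfolding graph_iso_def
    proof (intro conjI ballI \<phi> \<psi>)
      fix e assume e: "e \<in> edges G"
      have "\<beta> (inv_into (verts G) \<beta> j) = j" if "j < k" for j
        using bij_betw_inv_into_right[OF b(1)] that by simp
      then have "image_mset ?\<phi> (ends G e) = {#inv_into (verts G') \<beta>' (fst (a (\<epsilon> e))), inv_into (verts G') \<beta>' (snd (a (\<epsilon> e)))#}"
        unfolding b(3)[OF e] using b(4)[OF e] by simp
      also have "\<dots> = ends G' (?\<psi> e)"
        unfolding b'(3)[OF \<epsilon>'(2)[OF e]] \<epsilon>'(1)[OF e] ..
      finally show "ends G' (?\<psi> e) = image_mset ?\<phi> (ends G e)" by simp
    next
      fix i assume i: "i \<in> {1..s}"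
      have "inv_into (verts G') \<beta>' (\<beta>' (leg G' i)) = leg G' i"
        by (rule bij_betw_inv_into_left[OF b'(1) G'.leg_in_verts[OF i]])
      then show "leg G' i = ?\<phi> (leg G i)"
        using b(5)[OF i] b'(4)[OF i] by simp
    qed
    fix e assume e: "e \<in> edges G"
    show "c' (?\<psi> e) = c e"
      using b(6)[OF e] b'(5)[OF \<epsilon>'(2)[OF e]] unfolding \<epsilon>'(1)[OF e] by simp
  qed
qed

text \<open>Distinct representatives are not isomorphic, so they have different codes.\<close>

lemma card_representatives:
  assumes "1 \<le> s" "1 \<le> m"
  shows "finite (representatives s m)" "card (representatives s m) \<le> Suc s * (s * s) ^ s * s ^ s * m ^ s"
proof -
  have "\<forall>p\<in>representatives s m. \<exists>x. x \<in> codes s m \<and> has_code s p x"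
  proof
    fix p assume "p \<in> representatives s m"
    then have "p \<in> colored_graphs s m" using representatives_subset by blast
    then show "\<exists>x. x \<in> codes s m \<and> has_code s p x" using has_code_ex[OF _ assms] by blast
  qed
  from bchoice[OF this] obtain f where f: "\<forall>p\<in>representatives s m. f p \<in> codes s m \<and> has_code s p (f p)" ..
  have inj: "inj_on f (representatives s m)"
  proof (rule inj_onI)
    fix p q assume p: "p \<in> representatives s m" and q: "q \<in> representatives s m" and eq: "f p = f q"
    have "p \<in> colored_graphs s m" "q \<in> colored_graphs s m" using p q representatives_subset by blast+
    moreover have "has_code s p (f p)" "has_code s q (f p)"
      using bspec[OF f p] bspec[OF f q] eq by simp_all
    ultimately have "colored_iso s p q" using has_code_iso[of p s m "f p" q] by simp
    then show "p = q" by (rule representatives_iso_eq[OF p q])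
  qed
  have sub: "f ` representatives s m \<subseteq> codes s m" using f by auto
  show "finite (representatives s m)"
    by (rule inj_on_finite[OF inj sub finite_codes])
  have "card (representatives s m) \<le> card (codes s m)"
    by (rule card_inj_on_le[OF inj sub finite_codes])
  then show "card (representatives s m) \<le> Suc s * (s * s) ^ s * s ^ s * m ^ s"
    unfolding card_codes .
qed

section \<open>The moduli space as a glued complex\<close>

text \<open>A face S stands for the graph in which all edges outside S are collapsed. Faces are
  glued by color-preserving isomorphisms of these collapsed graphs; lengths do not enter.\<close>

definition face_glue :: "nat \<Rightarrow> graph \<times> coloring \<Rightarrow> graph \<times> coloring \<Rightarrow> (nat \<Rightarrow> nat) \<Rightarrow> nat set \<Rightarrow> bool" where
  "face_glue s = (\<lambda>(G, c) (G', c') \<psi> S. one_loop s G \<and> one_loop s G' \<and> S \<subseteq> edges G \<and> \<psi> ` S \<subseteq> edges G' \<and> inj_on \<psi> S \<and>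
     (\<forall>e\<in>S. c' (\<psi> e) = c e) \<and>
     (\<exists>\<phi>. graph_iso s (collapse G (edges G - S)) (collapse G' (edges G' - \<psi> ` S)) \<phi> \<psi>))"

lemma zero_set_eq: "zero_set G l = edges G - supp (edges G) l"
  by (auto simp: zero_set_def supp_def)

lemma edges_minus_zero_set: "edges G - zero_set G l = supp (edges G) l"
  by (auto simp: zero_set_def supp_def)

lemma supp_subset: "supp E x \<subseteq> E"
  by (auto simp: supp_def)

text \<open>In rank one, regularity excludes only the zero metric, which total length 1 excludes
  already; so the simplex keeps all its faces.\<close>

lemma regular_simplex_eq:
  assumes "one_loop s G"
  shows "{l \<in> regular_metrics G. (\<Sum>e\<in>edges G. l e) = 1} = simplex (edges G)"
proof -
  interpret one_loop s G by fact
  have "forest G (zero_set G l)" if "l \<in> simplex (edges G)" for l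
  proof -
    have "zero_set G l \<noteq> edges G"
      using supp_nonempty[OF that] supp_subset[of "edges G" l] unfolding zero_set_eq by blast
    then show ?thesis by (simp add: forest_iff[OF zero_set_subset])
  qed
  then show ?thesis
    by (auto simp: regular_metrics_def simplex_def PiE_def Pi_def)
qed

lemma triple_of_simplex:
  assumes "(G, c) \<in> colored_graphs s m" "l \<in> simplex (edges G)"
  shows "(G, l, c) \<in> triples s m"
proof -
  have "l \<in> regular_metrics G" using regular_simplex_eq[OF colored_graphsD(1)[OF assms(1)]] assms(2) by blast
  then show ?thesis using assms(1) by (simp add: triples_def colored_graphs_def)
qed

lemma point_of_eq: "point_of s m ((G, c), l) = triple_rel s m `` {(G, l, c)}"
  by (simp add: point_of_def)

lemma point_of_eq_iff:
  assumes "(G, l, c) \<in> triples s m" "(G', l', c') \<in> triples s m"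
  shows "point_of s m ((G, c), l) = point_of s m ((G', c'), l') \<longleftrightarrow> ((G, l, c), (G', l', c')) \<in> triple_rel s m"
  unfolding point_of_eq by (rule eq_equiv_class_iff[OF equiv_triple_rel assms])

lemma openin_MCG1_iff:
  "openin (MCG1 s m) U \<longleftrightarrow> U \<subseteq> triples s m // triple_rel s m \<and>
     (\<forall>r\<in>representatives s m. openin (subtopology (real_space (edges (fst r))) (simplex (edges (fst r))))
        {l \<in> simplex (edges (fst r)). point_of s m (r, l) \<in> U})"
proof -
  have top: "topspace (simplex_of (fst r)) = simplex (edges (fst r))"
    and sub: "simplex_of (fst r) = subtopology (real_space (edges (fst r))) (simplex (edges (fst r)))"
    if "r \<in> representatives s m" for r
  proof -
    have "(fst r, snd r) \<in> colored_graphs s m" using that representatives_subset by auto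
    then have "one_loop s (fst r)" by (rule colored_graphsD)
    then show sub: "simplex_of (fst r) = subtopology (real_space (edges (fst r))) (simplex (edges (fst r)))"
      unfolding simplex_of_def by (simp only: regular_simplex_eq)
    have "simplex (edges (fst r)) \<subseteq> extensional (edges (fst r))" by (auto simp: simplex_def)
    then show "topspace (simplex_of (fst r)) = simplex (edges (fst r))"
      unfolding sub topspace_subtopology topspace_real_space by blast
  qed
  have simp': "simplices s m = sum_topology (\<lambda>r. simplex_of (fst r)) (representatives s m)"
    by (simp add: simplices_def case_prod_unfold)
  have tops: "topspace (simplices s m) = (SIGMA r:representatives s m. simplex (edges (fst r)))"
    unfolding simp' topspace_sum_topology using top by (intro Sigma_cong) auto
  have slice: "{l. (r, l) \<in> {x \<in> topspace (simplices s m). point_of s m x \<in> U}}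
      = {l \<in> simplex (edges (fst r)). point_of s m (r, l) \<in> U}" if "r \<in> representatives s m" for r
    unfolding tops using that by auto
  have "openin (simplices s m) {x \<in> topspace (simplices s m). point_of s m x \<in> U} \<longleftrightarrow>
    (\<forall>r\<in>representatives s m. openin (subtopology (real_space (edges (fst r))) (simplex (edges (fst r))))
        {l \<in> simplex (edges (fst r)). point_of s m (r, l) \<in> U})"
  proof -
    have "{x \<in> topspace (simplices s m). point_of s m x \<in> U} \<subseteq> topspace (simplices s m)" by blast
    then have "openin (simplices s m) {x \<in> topspace (simplices s m). point_of s m x \<in> U} \<longleftrightarrow>
      (\<forall>r\<in>representatives s m. openin (simplex_of (fst r)) {l. (r, l) \<in> {x \<in> topspace (simplices s m). point_of s m x \<in> U}})"
      unfolding simp' openin_sum_topology topspace_sum_topology by blast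
    then show ?thesis using slice sub by simp
  qed
  then show ?thesis unfolding openin_MCG1 by blast
qed

lemma topspace_MCG1: "topspace (MCG1 s m) = triples s m // triple_rel s m"
proof (rule antisym)
  show "topspace (MCG1 s m) \<subseteq> triples s m // triple_rel s m"
    using openin_topspace[of "MCG1 s m"] unfolding openin_MCG1_iff by blast
  have "openin (MCG1 s m) (triples s m // triple_rel s m)"
    unfolding openin_MCG1_iff
  proof (intro conjI ballI order_refl)
    fix r assume r: "r \<in> representatives s m"
    have "(fst r, snd r) \<in> colored_graphs s m" using r representatives_subset by auto
    then have "point_of s m (r, l) \<in> triples s m // triple_rel s m" if "l \<in> simplex (edges (fst r))" for l
      using triple_of_simplex[of "fst r" "snd r" s m l] that point_of_eq[of s m "fst r" "snd r" l]
      by (simp add: quotientI)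
    then have "{l \<in> simplex (edges (fst r)). point_of s m (r, l) \<in> triples s m // triple_rel s m} = simplex (edges (fst r))"
      by blast
    moreover have "simplex (edges (fst r)) \<subseteq> extensional (edges (fst r))" by (auto simp: simplex_def)
    then have "topspace (subtopology (real_space (edges (fst r))) (simplex (edges (fst r)))) = simplex (edges (fst r))"
      unfolding topspace_subtopology topspace_real_space by blast
    ultimately show "openin (subtopology (real_space (edges (fst r))) (simplex (edges (fst r))))
        {l \<in> simplex (edges (fst r)). point_of s m (r, l) \<in> triples s m // triple_rel s m}"
      using openin_topspace[of "subtopology (real_space (edges (fst r))) (simplex (edges (fst r)))"] by simp
  qed
  then show "triples s m // triple_rel s m \<subseteq> topspace (MCG1 s m)" by (rule openin_subset)
qed

lemma closedin_MCG1_iff: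
  "closedin (MCG1 s m) C \<longleftrightarrow> C \<subseteq> topspace (MCG1 s m) \<and>
     (\<forall>r\<in>representatives s m. closedin (subtopology (real_space (edges (fst r))) (simplex (edges (fst r))))
        {l \<in> simplex (edges (fst r)). point_of s m (r, l) \<in> C})"
proof -
  have *: "openin (subtopology (real_space (edges (fst r))) (simplex (edges (fst r))))
        {l \<in> simplex (edges (fst r)). point_of s m (r, l) \<in> topspace (MCG1 s m) - C} \<longleftrightarrow>
      closedin (subtopology (real_space (edges (fst r))) (simplex (edges (fst r))))
        {l \<in> simplex (edges (fst r)). point_of s m (r, l) \<in> C}" if r: "r \<in> representatives s m" for r
  proof -
    let ?D = "simplex (edges (fst r))"
    have "?D \<subseteq> extensional (edges (fst r))" by (auto simp: simplex_def)
    then have top: "topspace (subtopology (real_space (edges (fst r))) ?D) = ?D"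
      unfolding topspace_subtopology topspace_real_space by blast
    have "(fst r, snd r) \<in> colored_graphs s m" using r representatives_subset by auto
    then have "point_of s m (r, l) \<in> topspace (MCG1 s m)" if "l \<in> ?D" for l
      using triple_of_simplex[of "fst r" "snd r" s m l] that point_of_eq[of s m "fst r" "snd r" l]
      by (simp add: quotientI topspace_MCG1)
    then have "{l \<in> ?D. point_of s m (r, l) \<in> topspace (MCG1 s m) - C} = ?D - {l \<in> ?D. point_of s m (r, l) \<in> C}"
      by blast
    then show ?thesis unfolding closedin_def top by simp
  qed
  have "topspace (MCG1 s m) - C \<subseteq> triples s m // triple_rel s m" unfolding topspace_MCG1 by blast
  then have "openin (MCG1 s m) (topspace (MCG1 s m) - C) \<longleftrightarrow>
     (\<forall>r\<in>representatives s m. closedin (subtopology (real_space (edges (fst r))) (simplex (edges (fst r))))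
        {l \<in> simplex (edges (fst r)). point_of s m (r, l) \<in> C})"
    unfolding openin_MCG1_iff using * by simp
  then show ?thesis unfolding closedin_def[of "MCG1 s m" C] by simp
qed

text \<open>Rescale to total length 1 and transport the metric along an isomorphism to the chosen
  representative of (G, c).\<close>

lemma triple_eq_point_of:
  assumes t: "(G, l, c) \<in> triples s m"
  shows "\<exists>r\<in>representatives s m. \<exists>x\<in>simplex (edges (fst r)). triple_rel s m `` {(G, l, c)} = point_of s m (r, x)"
proof -
  interpret one_loop s G by (rule triplesD(1)[OF t])
  note l = triplesD(4-7)[OF t]
  have p: "(G, c) \<in> colored_graphs s m" using t by (simp add: triples_def colored_graphs_def)
  obtain G' c' where r: "rep s m (G, c) = (G', c')" by (cases "rep s m (G, c)")
  have r': "(G', c') \<in> colored_graphs s m" "colored_iso s (G, c) (G', c')" using rep[OF p] unfolding r .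
  have rrep: "(G', c') \<in> representatives s m" unfolding representatives_eq r[symmetric] using p by (rule imageI)
  obtain \<phi> \<psi> where iso: "graph_iso s G G' \<phi> \<psi>" and col: "\<And>e. e \<in> edges G \<Longrightarrow> c' (\<psi> e) = c e"
    using colored_isoE[OF r'(2)] by blast
  have b: "bij_betw \<psi> (edges G) (edges G')" by (rule graph_iso_edges[OF iso])
  define a where "a = (\<Sum>e\<in>edges G. l e)"
  \<comment> \<open>Regularity makes some length positive, so the total length can be divided
    by.\<close>
  have "zero_set G l \<noteq> edges G" using l(3) forest_iff[OF zero_set_subset] by simp
  then obtain e0 where e0: "e0 \<in> edges G" "l e0 \<noteq> 0" by (auto simp: zero_set_def)
  have "l e0 \<le> a" unfolding a_def using e0 l(2) finite_edges by (intro member_le_sum) auto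
  then have a: "a > 0" using e0 l(2)[OF e0(1)] by simp
  define x where "x = (\<lambda>f\<in>edges G'. l (inv_into (edges G) \<psi> f) / a)"
  have x: "x (\<psi> e) = l e / a" if "e \<in> edges G" for e
    using bij_betw_apply[OF b that] bij_betw_inv_into_left[OF b that] by (simp add: x_def)
  have "(\<Sum>f\<in>edges G'. x f) = (\<Sum>e\<in>edges G. l e / a)"
    using sum.reindex_bij_betw[OF b, of x] x by simp
  also have "\<dots> = 1" using a by (simp add: a_def flip: sum_divide_distrib)
  finally have x1: "x \<in> simplex (edges G')"
    using l(2) a bij_betw_apply[OF bij_betw_inv_into[OF b]] by (simp add: simplex_def x_def)
  have t': "(G', x, c') \<in> triples s m" by (rule triple_of_simplex[OF r'(1) x1])
  have zero: "zero_set G' x = \<psi> ` zero_set G l"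
  proof (intro equalityI subsetI)
    fix f assume f: "f \<in> zero_set G' x"
    then obtain e where "e \<in> edges G" "f = \<psi> e" using b by (auto simp: zero_set_def bij_betw_def)
    then show "f \<in> \<psi> ` zero_set G l" using f x[of e] a by (auto simp: zero_set_def)
  next
    fix f assume "f \<in> \<psi> ` zero_set G l"
    then obtain e where "e \<in> edges G" "l e = 0" "f = \<psi> e" by (auto simp: zero_set_def)
    then show "f \<in> zero_set G' x" using x[of e] bij_betw_apply[OF b, of e] by (simp add: zero_set_def)
  qed
  obtain \<phi>' where iso': "graph_iso s (collapse G (zero_set G l)) (collapse G' (zero_set G' x)) \<phi>' \<psi>"
    using graph_iso_collapse[OF triplesD(3)[OF t] triplesD(3)[OF t'] iso zero_set_subset[of G l]]
    unfolding zero by blast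
  have "((G, l, c), (G', x, c')) \<in> triple_rel s m"
  proof (rule triple_relI[OF t t' iso'])
    show "0 < 1 / a" using a by simp
    show "x (\<psi> e) = 1 / a * l e \<and> c' (\<psi> e) = c e" if "e \<in> edges G - zero_set G l" for e
      using that x[of e] col[of e] by simp
  qed
  then have "triple_rel s m `` {(G, l, c)} = point_of s m ((G', c'), x)"
    unfolding point_of_eq by (rule equiv_class_eq[OF equiv_triple_rel])
  then show ?thesis using rrep x1 by (intro bexI[of _ "(G', c')"] bexI[of _ x]) simp_all
qed

text \<open>Proportional lengths with the same total are equal, so the scaling factor of
  \<open>triple_rel\<close> is 1 and disappears.\<close>

lemma point_of_eq_iff_glue:
  assumes p: "(G, c) \<in> colored_graphs s m" "(G', c') \<in> colored_graphs s m"
    and x: "x \<in> simplex (edges G)" "y \<in> simplex (edges G')"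
  shows "point_of s m ((G, c), x) = point_of s m ((G', c'), y) \<longleftrightarrow>
    (\<exists>\<psi>. face_glue s (G, c) (G', c') \<psi> (supp (edges G) x) \<and> \<psi> ` supp (edges G) x = supp (edges G') y \<and>
       (\<forall>e\<in>supp (edges G) x. y (\<psi> e) = x e))"
proof -
  let ?S = "supp (edges G) x" and ?S' = "supp (edges G') y"
  interpret G: one_loop s G by (rule colored_graphsD(1)[OF p(1)])
  interpret G': one_loop s G' by (rule colored_graphsD(1)[OF p(2)])
  have t: "(G, x, c) \<in> triples s m" "(G', y, c') \<in> triples s m"
    using triple_of_simplex[OF p(1) x(1)] triple_of_simplex[OF p(2) x(2)] .
  have sumS: "(\<Sum>e\<in>?S. x e) = 1"
  proof -
    have "(\<Sum>e\<in>?S. x e) = (\<Sum>e\<in>edges G. x e)"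
      using G.finite_edges by (intro sum.mono_neutral_left) (auto simp: supp_def)
    then show ?thesis using x(1) by (simp add: simplex_def)
  qed
  have sumS': "(\<Sum>e\<in>?S'. y e) = 1"
  proof -
    have "(\<Sum>e\<in>?S'. y e) = (\<Sum>e\<in>edges G'. y e)"
      using G'.finite_edges by (intro sum.mono_neutral_left) (auto simp: supp_def)
    then show ?thesis using x(2) by (simp add: simplex_def)
  qed
  have "((G, x, c), (G', y, c')) \<in> triple_rel s m \<longleftrightarrow>
    (\<exists>\<psi>. face_glue s (G, c) (G', c') \<psi> ?S \<and> \<psi> ` ?S = ?S' \<and> (\<forall>e\<in>?S. y (\<psi> e) = x e))"
  proof
    assume "((G, x, c), (G', y, c')) \<in> triple_rel s m"
    then obtain \<phi> \<psi> a where iso: "graph_iso s (collapse G (edges G - ?S)) (collapse G' (edges G' - ?S')) \<phi> \<psi>"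
      and lc: "\<And>e. e \<in> ?S \<Longrightarrow> y (\<psi> e) = a * x e \<and> c' (\<psi> e) = c e"
      by (rule triple_relE) (unfold edges_minus_zero_set, unfold zero_set_eq, blast)
    have "edges G - (edges G - ?S) = ?S" "edges G' - (edges G' - ?S') = ?S'"
      using supp_subset[of "edges G" x] supp_subset[of "edges G'" y] by blast+
    then have b: "bij_betw \<psi> ?S ?S'" using graph_iso_edges[OF iso] by simp
    then have im: "\<psi> ` ?S = ?S'" "inj_on \<psi> ?S" by (simp_all add: bij_betw_def)
    have "1 = (\<Sum>e\<in>?S. y (\<psi> e))" using sum.reindex_bij_betw[OF b, of y] sumS' by simp
    also have "\<dots> = a * (\<Sum>e\<in>?S. x e)" using lc by (simp add: sum_distrib_left)
    finally have "a = 1" using sumS by simp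
    have "face_glue s (G, c) (G', c') \<psi> ?S"
      unfolding face_glue_def prod.case im(1)
      using iso lc im(2) supp_subset[of "edges G" x] supp_subset[of "edges G'" y] G.one_loop_axioms G'.one_loop_axioms
      by auto
    then show "\<exists>\<psi>. face_glue s (G, c) (G', c') \<psi> ?S \<and> \<psi> ` ?S = ?S' \<and> (\<forall>e\<in>?S. y (\<psi> e) = x e)"
      using im(1) lc \<open>a = 1\<close> by (intro exI[of _ \<psi>] conjI ballI) simp_all
  next
    assume "\<exists>\<psi>. face_glue s (G, c) (G', c') \<psi> ?S \<and> \<psi> ` ?S = ?S' \<and> (\<forall>e\<in>?S. y (\<psi> e) = x e)"
    then obtain \<psi> where g: "face_glue s (G, c) (G', c') \<psi> ?S" and im: "\<psi> ` ?S = ?S'"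
      and v: "\<forall>e\<in>?S. y (\<psi> e) = x e" by blast
    from g obtain \<phi> where iso: "graph_iso s (collapse G (zero_set G x)) (collapse G' (zero_set G' y)) \<phi> \<psi>"
      and col: "\<forall>e\<in>?S. c' (\<psi> e) = c e"
      unfolding face_glue_def prod.case im zero_set_eq by blast
    show "((G, x, c), (G', y, c')) \<in> triple_rel s m"
      by (rule triple_relI[OF t iso, of 1]) (use v col in \<open>simp_all add: edges_minus_zero_set\<close>)
  qed
  then show ?thesis unfolding point_of_eq_iff[OF t] .
qed

text \<open>Passing from S to T collapses the edges of S - T as well, on both sides.\<close>

lemma face_glue_subset:
  assumes g: "face_glue s (G, c) (G', c') \<psi> S" and T: "T \<subseteq> S"
  shows "face_glue s (G, c) (G', c') \<psi> T"
proof -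
  from g obtain \<phi> where p: "one_loop s G" "one_loop s G'"
    and S: "S \<subseteq> edges G" "\<psi> ` S \<subseteq> edges G'" "inj_on \<psi> S" "\<forall>e\<in>S. c' (\<psi> e) = c e"
    and iso: "graph_iso s (collapse G (edges G - S)) (collapse G' (edges G' - \<psi> ` S)) \<phi> \<psi>"
    unfolding face_glue_def prod.case by blast
  have "S - T \<subseteq> edges G - (edges G - S)" using S(1) by blast
  then obtain \<phi>' where "graph_iso s (collapse G (edges G - S \<union> (S - T)))
      (collapse G' (edges G' - \<psi> ` S \<union> \<psi> ` (S - T))) \<phi>' \<psi>"
    using graph_iso_collapse_more[OF _ _ iso, of "S - T"] p by (auto simp: one_loop_def legged_def)
  moreover have "edges G - S \<union> (S - T) = edges G - T" using S(1) T by blast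
  moreover have "\<psi> ` (S - T) = \<psi> ` S - \<psi> ` T" using S(3) T by (intro inj_on_image_set_diff) auto
  then have "edges G' - \<psi> ` S \<union> \<psi> ` (S - T) = edges G' - \<psi> ` T" using S(2) T by blast
  ultimately have "graph_iso s (collapse G (edges G - T)) (collapse G' (edges G' - \<psi> ` T)) \<phi>' \<psi>" by simp
  then show ?thesis
    unfolding face_glue_def prod.case using p S T inj_on_subset[OF S(3) T] by blast
qed

lemma face_glue_self:
  assumes g: "face_glue s (G, c) (G, c) \<psi> S"
    and im: "\<psi> ` S = S" and card: "card S \<noteq> 2" and e: "e \<in> S"
  shows "\<psi> e = e"
proof -
  interpret one_loop s G using g by (simp add: face_glue_def)
  from g obtain \<phi> where S: "S \<subseteq> edges G"
    and iso: "graph_iso s (collapse G (edges G - S)) (collapse G (edges G - S)) \<phi> \<psi>"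
    unfolding face_glue_def prod.case im by blast
  have "edges G - (edges G - S) = S" using S by blast
  then show ?thesis using collapse_automorphism[OF iso] card e by simp
qed

lemma glued_simplices_MCG1:
  assumes s: "1 \<le> s" and m: "1 \<le> m"
  shows "glued_simplices (MCG1 s m) (representatives s m) (\<lambda>r. edges (fst r))
    (\<lambda>r l. point_of s m (r, l)) (face_glue s)"
proof
  have cg: "(fst r, snd r) \<in> colored_graphs s m" if "r \<in> representatives s m" for r
    using that representatives_subset by auto
  show "finite (representatives s m)" by (rule card_representatives(1)[OF s m])
  show "finite (edges (fst r))" if "r \<in> representatives s m" for r
  proof -
    interpret one_loop s "fst r" by (rule colored_graphsD(1)[OF cg[OF that]])
    show ?thesis by (rule finite_edges)
  qed
  show "topspace (MCG1 s m) = (\<Union>r\<in>representatives s m. (\<lambda>l. point_of s m (r, l)) ` simplex (edges (fst r)))"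
  proof (intro equalityI subsetI)
    fix z assume "z \<in> topspace (MCG1 s m)"
    then obtain t where t: "t \<in> triples s m" "z = triple_rel s m `` {t}"
      unfolding topspace_MCG1 by (rule quotientE)
    obtain G l c where "t = (G, l, c)" by (cases t)
    then show "z \<in> (\<Union>r\<in>representatives s m. (\<lambda>l. point_of s m (r, l)) ` simplex (edges (fst r)))"
      using triple_eq_point_of[of G l c s m] t by blast
  next
    fix z assume "z \<in> (\<Union>r\<in>representatives s m. (\<lambda>l. point_of s m (r, l)) ` simplex (edges (fst r)))"
    then obtain r l where r: "r \<in> representatives s m" "l \<in> simplex (edges (fst r))" "z = point_of s m (r, l)" by blast
    have "(fst r, l, snd r) \<in> triples s m" by (rule triple_of_simplex[OF cg[OF r(1)] r(2)])
    then have "triple_rel s m `` {(fst r, l, snd r)} \<in> triples s m // triple_rel s m" by (rule quotientI)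
    then show "z \<in> topspace (MCG1 s m)"
      unfolding topspace_MCG1 r(3) using point_of_eq[of s m "fst r" "snd r" l] by simp
  qed
  show "closedin (MCG1 s m) C \<longleftrightarrow> C \<subseteq> topspace (MCG1 s m) \<and>
     (\<forall>r\<in>representatives s m. closedin (subtopology (real_space (edges (fst r))) (simplex (edges (fst r))))
        {l \<in> simplex (edges (fst r)). point_of s m (r, l) \<in> C})" for C
    by (rule closedin_MCG1_iff)
  show "point_of s m (r, x) = point_of s m (q, y) \<longleftrightarrow>
      (\<exists>\<psi>. face_glue s r q \<psi> (supp (edges (fst r)) x) \<and> \<psi> ` supp (edges (fst r)) x = supp (edges (fst q)) y \<and>
        (\<forall>e\<in>supp (edges (fst r)) x. y (\<psi> e) = x e))"
    if "r \<in> representatives s m" "q \<in> representatives s m" "x \<in> simplex (edges (fst r))" "y \<in> simplex (edges (fst q))"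
    for r q x y
    using point_of_eq_iff_glue[OF cg[OF that(1)] cg[OF that(2)] that(3,4)] by simp
  show "face_glue s r q \<psi> T" if "face_glue s r q \<psi> S" "T \<subseteq> S" "T \<noteq> {}" for r q \<psi> S T
    using face_glue_subset[of s "fst r" "snd r" "fst q" "snd q" \<psi> S T] that by simp
  show "S \<subseteq> edges (fst r) \<and> \<psi> ` S \<subseteq> edges (fst q) \<and> inj_on \<psi> S" if "face_glue s r q \<psi> S" for r q \<psi> S
    using that by (simp add: face_glue_def case_prod_beta)
  show "\<psi> e = e" if "face_glue s r r \<psi> S" "\<psi> ` S = S" "card S \<noteq> 2" "e \<in> S" for r \<psi> S e
    using face_glue_self[of s "fst r" "snd r" \<psi> S e] that by simp
qed

text \<open>In K, the factors s + 1, (s^2)^s and s^s count the numbers of edges, the ends of edges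
  and the positions of legs in a code; the two factors 2^s come from
  \<open>rank_le_homology_glued\<close>. The colors give m^s.\<close>

lemma dim_rat_homology_MCG1_le:
  assumes s: "1 \<le> s" and m: "1 \<le> m"
  defines "K \<equiv> Suc s * (s * s) ^ s * s ^ s * 2 ^ s * 2 ^ s"
  shows "vectorspace.fin_dim class_ring (rat_homology p (MCG1 s m)) \<and>
    vectorspace.dim class_ring (rat_homology p (MCG1 s m)) \<le> K * m ^ s"
proof (rule fin_dim_rat_homology)
  interpret glued_simplices "MCG1 s m" "representatives s m" "\<lambda>r. edges (fst r)"
    "\<lambda>r l. point_of s m (r, l)" "face_glue s"
    by (rule glued_simplices_MCG1[OF s m])
  have "card (edges (fst r)) \<le> s" if "r \<in> representatives s m" for r
  proof -
    have "(fst r, snd r) \<in> colored_graphs s m" using that representatives_subset by auto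
    then interpret one_loop s "fst r" by (rule colored_graphsD)
    show ?thesis by (rule card_edges_le)
  qed
  then have "rank_le (homology_group (int p) (MCG1 s m)) (card (representatives s m) * 2 ^ s * 2 ^ s)"
    by (rule rank_le_homology_glued)
  moreover have "card (representatives s m) * 2 ^ s * 2 ^ s \<le> K * m ^ s"
  proof -
    have "card (representatives s m) * (2 ^ s * 2 ^ s) \<le> Suc s * (s * s) ^ s * s ^ s * m ^ s * (2 ^ s * 2 ^ s)"
      by (intro mult_le_mono1 card_representatives(2)[OF s m])
    then show ?thesis unfolding K_def by (simp only: ac_simps)
  qed
  ultimately show "rank_le (homology_group (int p) (MCG1 s m)) (K * m ^ s)"
    by (rule rank_le_mono)
qed

theorem theorem4p13:
  fixes s :: nat
  assumes "s \<ge> 1"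
  shows "\<exists>P :: real poly. degree P = s \<and>
           (\<forall>m::nat. m \<ge> 1 \<longrightarrow>
              vectorspace.fin_dim class_ring (rat_homology (s - 1) (MCG1 s m)) \<and>
              real (vectorspace.dim class_ring (rat_homology (s - 1) (MCG1 s m)))
                \<le> poly P (real m))"
proof -
  define K where "K = Suc s * (s * s) ^ s * s ^ s * 2 ^ s * 2 ^ s"
  \<comment> \<open>So that the monomial has degree exactly s.\<close>
  have "K \<noteq> 0" using assms by (simp add: K_def)
  show ?thesis
  proof (intro exI[of _ "monom (real K) s"] conjI allI impI)
    show "degree (monom (real K) s) = s" using \<open>K \<noteq> 0\<close> by (simp add: degree_monom_eq)
    fix m :: nat assume m: "1 \<le> m"
    note dim = dim_rat_homology_MCG1_le[OF assms m, of "s - 1", folded K_def]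
    show "vectorspace.fin_dim class_ring (rat_homology (s - 1) (MCG1 s m))" using dim by simp
    have "real (vectorspace.dim class_ring (rat_homology (s - 1) (MCG1 s m))) \<le> real (K * m ^ s)"
      using dim by (simp only: of_nat_le_iff)
    then show "real (vectorspace.dim class_ring (rat_homology (s - 1) (MCG1 s m))) \<le> poly (monom (real K) s) (real m)"
      by (simp add: poly_monom)
  qed
qed

end
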